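(* Let $n\in\{1,2,3,4\}$ and let $V=V(\mathbf r)$ and $\mathbf A=\mathbf A(\mathbf r)$ be time-independent potentials. The Schrödinger equation $$L\Psi\equiv\Big(i\partial_t-\tfrac12\big((\mathbf p-e\mathbf A(\mathbf r))^2+V(\mathbf r)\big)\Big)\Psi=0$$ possesses time-dependent symmetry operators if and only if it possesses at least one symmetry operator of the form $$Q=\exp(\lambda t)\,K_0,\qquad \lambda\in\mathbb C,\ \lambda\neq0,\ K_0\neq 0,$$ or of the form $$Q=K_0+tK_1,\qquad K_1\neq0,$$ where $K_0,K_1$ are linear differential operators in the space variables (of finite order) with time-independent coefficients.
   Context: Here $\mathbf r=(x_1,\dots,x_n)$ with $x_a\in\mathbb R$, $t\in\mathbb R$, $p_a=-i\,\partial/\partial x_a$, $\mathbf p=(p_1,\dots,p_n)$, $e$ is a constant, $\mathbf A=(A_1,\dots,A_n)$ is an $n$-component function, and for an $n$-component operator $\mathbf u$ one writes $\mathbf u^2=\sum_{a=1}^n u_au_a$. The potentials are smooth functions on $\mathbb R^n$, and the coefficients of operators are smooth, possibly complex-valued functions. A symmetry operator of the equation is a linear differential operator in the space variables only (no $\partial_t$), of some finite order $q\ge 0$, with coefficients depending on $\mathbf r$ and $t$, of the form $$Q=\sum_{j=0}^{q}\big[\cdots\big[F^{a_1,\dots,a_j}(\mathbf r,t),p_{a_1}\big]_+,\cdots,p_{a_j}\big]_+=\sum_{j=0}^q b^{a_1,\dots,a_j}(\mathbf r,t)\,\frac{\partial}{\partial x_{a_1}}\cdots\frac{\partial}{\partial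 x_{a_j}},$$ such that $[L,Q]=LQ-QL=0$ as operators. Here $[A,B]_+=AB+BA$, the functions $F^{a_1,\dots,a_j}$ and $b^{a_1,\dots,a_j}$ are symmetric in their indices, repeated indices are summed from $1$ to $n$, and the $j=0$ term is multiplication by a function. A symmetry operator is time-dependent if its coefficients are not all independent of $t$. The operators $K_0,K_1$ are of the same form with coefficients depending on $\mathbf r$ only. *)

theory Defs
  imports "HOL-Analysis.Analysis" "HOL-Library.Multiset"
begin

definition dir_deriv ::
    "'a \<Rightarrow> ('a::real_normed_vector \<Rightarrow> 'b::real_normed_vector) \<Rightarrow> 'a \<Rightarrow> 'b" where
  "dir_deriv v f = (\<lambda>z. frechet_derivative f (at z) v)"

text \<open>\<open>Ck k f\<close>: the function is k times continuously differentiable on the whole space.\<close>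

primrec Ck :: "nat \<Rightarrow> ('a::real_normed_vector \<Rightarrow> 'b::real_normed_vector) \<Rightarrow> bool" where
  "Ck 0 f \<longleftrightarrow> continuous_on UNIV f"
| "Ck (Suc k) f \<longleftrightarrow> (\<forall>z. f differentiable (at z)) \<and> (\<forall>v. Ck k (dir_deriv v f))"

definition smooth :: "('a::real_normed_vector \<Rightarrow> 'b::real_normed_vector) \<Rightarrow> bool" where
  "smooth f \<longleftrightarrow> (\<forall>k. Ck k f)"

text \<open>
  Functions of space and time take a pair \<open>(r, t)\<close>. Operators are total maps on such functions,
  but only their values on smooth functions are meaningful; hence operators are compared by
  \<open>op_eq\<close> and not by equality of HOL functions.
\<close>

type_synonym 'n stfun = "(real ^ 'n) \<times> real \<Rightarrow> complex"
type_synonym 'n oper = "'n stfun \<Rightarrow> 'n stfun"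

definition op_eq :: "'n::finite oper \<Rightarrow> 'n oper \<Rightarrow> bool" where
  "op_eq P Q \<longleftrightarrow> (\<forall>\<psi>. smooth \<psi> \<longrightarrow> P \<psi> = Q \<psi>)"

definition op_zero :: "'n::finite oper" where
  "op_zero \<psi> = (\<lambda>z. 0)"

definition mult_op :: "'n::finite stfun \<Rightarrow> 'n oper" where
  "mult_op f \<psi> = (\<lambda>z. f z * \<psi> z)"

definition anticommutator :: "'n::finite oper \<Rightarrow> 'n oper \<Rightarrow> 'n oper" where
  "anticommutator P Q \<psi> = (\<lambda>z. P (Q \<psi>) z + Q (P \<psi>) z)"

definition commutator :: "'n::finite oper \<Rightarrow> 'n oper \<Rightarrow> 'n oper" where
  "commutator P Q \<psi> = (\<lambda>z. P (Q \<psi>) z - Q (P \<psi>) z)"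

definition partial_x :: "'n::finite \<Rightarrow> 'n oper" where
  "partial_x a = dir_deriv (axis a 1, 0)"

definition partial_t :: "'n::finite oper" where
  "partial_t = dir_deriv (0, 1)"

definition momentum :: "'n::finite \<Rightarrow> 'n oper" where
  "momentum a \<psi> = (\<lambda>z. - \<i> * partial_x a \<psi> z)"

definition kinetic_momentum ::
    "real \<Rightarrow> (real ^ 'n \<Rightarrow> real ^ 'n) \<Rightarrow> 'n::finite \<Rightarrow> 'n oper" where
  "kinetic_momentum e A a \<psi> =
     (\<lambda>z. momentum a \<psi> z - complex_of_real (e * A (fst z) $ a) * \<psi> z)"

text \<open>The factor 1/2 multiplies the potential V as well as the kinetic term.\<close>

definition schroedinger_op ::
    "real \<Rightarrow> (real ^ 'n \<Rightarrow> real ^ 'n) \<Rightarrow> (real ^ 'n \<Rightarrow> real) \<Rightarrow> 'n::finite oper" where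
  "schroedinger_op e A V \<psi> =
     (\<lambda>z. \<i> * partial_t \<psi> z
        - 1 / 2 * ((\<Sum>a\<in>UNIV. kinetic_momentum e A a (kinetic_momentum e A a \<psi>) z)
                   + complex_of_real (V (fst z)) * \<psi> z))"

text \<open>
  An indexed family of coefficient functions is indexed by words: the list \<open>[a1, \<dots>, aj]\<close> is
  the index tuple of a component of rank j. Repeated indices are summed by summing over all words
  of length j.
\<close>

definition symmetric_smooth :: "('n::finite list \<Rightarrow> 'n stfun) \<Rightarrow> bool" where
  "symmetric_smooth c \<longleftrightarrow>
     (\<forall>w w'. mset w = mset w' \<longrightarrow> c w = c w') \<and> (\<forall>w. smooth (c w))"

definition anticommutator_form :: "nat \<Rightarrow> ('n::finite list \<Rightarrow> 'n stfun) \<Rightarrow> 'n oper" where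
  "anticommutator_form q F \<psi> =
     (\<lambda>z. \<Sum>j\<le>q. \<Sum>w\<in>{w. length w = j}.
        foldl (\<lambda>P a. anticommutator P (momentum a)) (mult_op (F w)) w \<psi> z)"

definition derivative_form :: "nat \<Rightarrow> ('n::finite list \<Rightarrow> 'n stfun) \<Rightarrow> 'n oper" where
  "derivative_form q b \<psi> =
     (\<lambda>z. \<Sum>j\<le>q. \<Sum>w\<in>{w. length w = j}. b w z * foldr partial_x w \<psi> z)"

text \<open>
  The derivative-form coefficients \<open>b\<close> are uniquely determined by the operator (apart from the
  irrelevant ones on words longer than \<open>q\<close>), and so are the \<open>F\<close>; the coefficients of
  either form are independent of t iff those of the other are. Below, the coefficients
  of an operator always mean \<open>b\<close>.
\<close>

definition diff_operator ::
    "nat \<Rightarrow> ('n::finite list \<Rightarrow> 'n stfun) \<Rightarrow> 'n oper \<Rightarrow> bool" where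
  "diff_operator q b Q \<longleftrightarrow>
     (\<exists>F. symmetric_smooth F \<and> op_eq Q (anticommutator_form q F)) \<and>
     symmetric_smooth b \<and> op_eq Q (derivative_form q b)"

definition time_independent_coeffs ::
    "nat \<Rightarrow> ('n::finite list \<Rightarrow> 'n stfun) \<Rightarrow> bool" where
  "time_independent_coeffs q b \<longleftrightarrow>
     (\<forall>w. length w \<le> q \<longrightarrow> (\<forall>x t t'. b w (x, t) = b w (x, t')))"

definition time_independent_op :: "'n::finite oper \<Rightarrow> bool" where
  "time_independent_op K \<longleftrightarrow> (\<exists>q b. diff_operator q b K \<and> time_independent_coeffs q b)"

definition time_dependent_op :: "'n::finite oper \<Rightarrow> bool" where
  "time_dependent_op Q \<longleftrightarrow> (\<exists>q b. diff_operator q b Q \<and> \<not> time_independent_coeffs q b)"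

definition symmetry_operator ::
    "real \<Rightarrow> (real ^ 'n \<Rightarrow> real ^ 'n) \<Rightarrow> (real ^ 'n \<Rightarrow> real) \<Rightarrow> 'n::finite oper \<Rightarrow> bool" where
  "symmetry_operator e A V Q \<longleftrightarrow>
     (\<exists>q b. diff_operator q b Q) \<and>
     op_eq (commutator (schroedinger_op e A V) Q) op_zero"

definition exp_times :: "complex \<Rightarrow> 'n::finite oper \<Rightarrow> 'n oper" where
  "exp_times \<mu> K \<psi> = (\<lambda>z. exp (\<mu> * complex_of_real (snd z)) * K \<psi> z)"

definition linear_in_time :: "'n::finite oper \<Rightarrow> 'n oper \<Rightarrow> 'n oper" where
  "linear_in_time K0 K1 \<psi> = (\<lambda>z. K0 \<psi> z + complex_of_real (snd z) * K1 \<psi> z)"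

end

theory Submission
  imports Defs "HOL-Computational_Algebra.Fundamental_Theorem_Algebra"
begin

text \<open>
  Write \<open>L = \<i>\<partial>\<^sub>t - H\<close>, where \<open>H\<close> is time-independent because the potentials are. Then \<open>[L, Q] = 0\<close> means
  \<open>[H, Q] = \<i> \<partial>\<^sub>tQ\<close>, where \<open>\<partial>\<^sub>tQ\<close> has the differentiated coefficients and is again a symmetry operator of order at
  most \<open>q\<close> (\<open>symmetry_chain\<close>). Fix a time \<open>t0\<close> at which \<open>\<partial>\<^sub>tQ\<close> is not zero and let \<open>K\<close> be the
  operator \<open>Q\<close> at that time. All the iterated commutators \<open>ad\<^sub>H\<^sup>j K\<close> then have order at most \<open>q\<close>.

  The heart of the proof is that the operators \<open>K\<close> with this property form a finite-dimensional space
  (\<open>chain_determined_by_jet\<close>). A commutator with \<open>H\<close> raises the order by one and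
  applies \<open>-T\<close> to the leading symbol, \<open>T = \<Sum>\<^sub>a \<xi>\<^sub>a \<partial>/\<partial>x\<^sub>a\<close> (\<open>commutator_symbol\<close>). If \<open>K\<close> has order \<open>r \<le> q\<close> and
  leading symbol \<open>\<sigma>(x, \<xi>)\<close>, the bound on the orders therefore forces \<open>T\<^sup>m \<sigma> = 0\<close> for \<open>m = q + 1 - r\<close>. As
  \<open>[\<partial>/\<partial>\<xi>\<^sub>a, T] = \<partial>/\<partial>x\<^sub>a\<close>, every derivative in \<open>\<xi>\<close> costs one further power of \<open>T\<close>, and after \<open>r\<close> of them a single
  coefficient \<open>b\<close> of \<open>K\<close> is left: \<open>(\<xi>\<cdot>\<partial>)\<^sup>n b = 0\<close> with \<open>n = q + 1\<close>, for all \<open>\<xi>\<close>. So \<open>b\<close> is determined by its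
  derivatives of order at most \<open>q\<close> at the origin. If these vanish, \<open>K\<close> has smaller order, and the argument
  is repeated. Thus finitely many numbers determine \<open>K\<close>.

  Hence \<open>ad\<^sub>H K, ad\<^sub>H\<^sup>2 K, \<dots>\<close> are linearly dependent, and the fundamental theorem of algebra provides \<open>\<delta>\<close> and
  \<open>\<gamma> \<noteq> 0\<close> in the span of the iterated commutators, with \<open>[H, \<delta>] = \<gamma>\<close> and \<open>[H, \<gamma>] = \<mu> \<gamma>\<close>
  (\<open>chain_eigenvector\<close>). If \<open>\<mu> \<noteq> 0\<close> then \<open>exp (-\<i>\<mu>t) \<gamma>\<close> is a symmetry operator, and if \<open>\<mu> = 0\<close> then
  \<open>\<delta> - \<i>t \<gamma>\<close> is one.

  Conversely, operators of the two special forms depend on time: applied to a suitable function that is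
  constant in time, they give one that is not, whereas time-independent coefficients preserve
  constancy in time.

  Operators must also be exhibited in anticommutator form. Passing between the two forms is a triangular
  change of coefficients (\<open>order_below_imp_anticommutator_form\<close>).
\<close>

section \<open>Calculus of smooth functions\<close>

lemma differentiable_imp_has_dir_deriv:
  "f differentiable (at z) \<Longrightarrow> (f has_derivative (\<lambda>v. dir_deriv v f z)) (at z)"
  unfolding dir_deriv_def by (simp add: frechet_derivative_works)

lemma dir_deriv_eqI:
  "(f has_derivative f') (at z) \<Longrightarrow> dir_deriv v f z = f' v"
  unfolding dir_deriv_def by (metis frechet_derivative_at)

lemma Ck_Suc_imp: "Ck (Suc k) f \<Longrightarrow> Ck k f"
proof (induction k arbitrary: f)
  case 0
  then show ?case
    by (auto simp: continuous_on_eq_continuous_at intro!: differentiable_imp_continuous_within)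
next
  case (Suc k)
  then show ?case by (metis Ck.simps(2))
qed

lemma smooth_unfold:
  "smooth f \<longleftrightarrow> (\<forall>z. f differentiable (at z)) \<and> (\<forall>v. smooth (dir_deriv v f))"
  unfolding smooth_def
proof safe
  assume "\<forall>k. Ck k f"
  then have *: "Ck (Suc k) f" for k by blast
  show "f differentiable at z" for z using *[of 0] by simp
  show "Ck k (dir_deriv v f)" for k v using *[of k] by simp
next
  fix k assume "\<forall>z. f differentiable at z" "\<forall>v k. Ck k (dir_deriv v f)"
  then have "Ck (Suc k) f" by simp
  then show "Ck k f" by (rule Ck_Suc_imp)
qed

lemma smooth_dir_deriv: "smooth f \<Longrightarrow> smooth (dir_deriv v f)"
  and smooth_differentiable: "smooth f \<Longrightarrow> f differentiable (at z)"
  using smooth_unfold by blast+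

lemma smooth_has_derivative:
  "smooth f \<Longrightarrow> (f has_derivative (\<lambda>v. dir_deriv v f z)) (at z)"
  by (simp add: differentiable_imp_has_dir_deriv smooth_differentiable)

lemma smooth_continuous: "smooth f \<Longrightarrow> isCont f z"
  using smooth_has_derivative has_derivative_continuous by blast

lemma smooth_const: "smooth (\<lambda>z::'a::real_normed_vector. c :: 'b::real_normed_vector)"
proof -
  have "Ck k (\<lambda>z::'a. c)" for k and c :: 'b
  proof (induction k arbitrary: c)
    case (Suc k)
    have "dir_deriv v (\<lambda>z::'a. c) = (\<lambda>z. 0)" for v unfolding dir_deriv_def by auto
    then show ?case using Suc by simp
  qed auto
  then show ?thesis by (simp add: smooth_def)
qed

lemma dir_deriv_add:
  "f differentiable (at z) \<Longrightarrow> g differentiable (at z) \<Longrightarrow>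
    dir_deriv v (\<lambda>z. f z + g z) z = dir_deriv v f z + dir_deriv v g z"
  by (rule dir_deriv_eqI[OF has_derivative_add])
     (auto intro: differentiable_imp_has_dir_deriv)

lemma Ck_add: "Ck k f \<Longrightarrow> Ck k g \<Longrightarrow> Ck k (\<lambda>z. f z + g z)"
proof (induction k arbitrary: f g)
  case 0
  then show ?case by (auto intro: continuous_intros)
next
  case (Suc k)
  then have "dir_deriv v (\<lambda>z. f z + g z) = (\<lambda>z. dir_deriv v f z + dir_deriv v g z)" for v
    by (intro ext dir_deriv_add) auto
  then show ?case using Suc by (auto intro!: differentiable_add)
qed

lemma smooth_add: "smooth f \<Longrightarrow> smooth g \<Longrightarrow> smooth (\<lambda>z. f z + g z)"
  by (simp add: smooth_def Ck_add)

lemma dir_deriv_mult: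
  fixes f g :: "'a::real_normed_vector \<Rightarrow> complex"
  shows "f differentiable (at z) \<Longrightarrow> g differentiable (at z) \<Longrightarrow>
    dir_deriv v (\<lambda>z. f z * g z) z = dir_deriv v f z * g z + f z * dir_deriv v g z"
  by (subst dir_deriv_eqI[OF has_derivative_mult[OF differentiable_imp_has_dir_deriv
      differentiable_imp_has_dir_deriv]]) (auto simp: add.commute)

lemma Ck_mult:
  fixes f g :: "'a::real_normed_vector \<Rightarrow> complex"
  shows "Ck k f \<Longrightarrow> Ck k g \<Longrightarrow> Ck k (\<lambda>z. f z * g z)"
proof (induction k arbitrary: f g)
  case 0
  then show ?case by (auto intro: continuous_intros)
next
  case (Suc k)
  then have "dir_deriv v (\<lambda>z. f z * g z) = (\<lambda>z. dir_deriv v f z * g z + f z * dir_deriv v g z)" for v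
    by (intro ext dir_deriv_mult) auto
  moreover have "Ck k (\<lambda>z. dir_deriv v f z * g z + f z * dir_deriv v g z)" for v
    using Suc Ck_Suc_imp[of k f] Ck_Suc_imp[of k g] by (intro Ck_add Suc.IH) auto
  ultimately show ?case using Suc by (auto intro!: differentiable_mult)
qed

lemma smooth_mult:
  fixes f g :: "'a::real_normed_vector \<Rightarrow> complex"
  shows "smooth f \<Longrightarrow> smooth g \<Longrightarrow> smooth (\<lambda>z. f z * g z)"
  by (simp add: smooth_def Ck_mult)

lemma smooth_sum: "(\<And>i. i \<in> I \<Longrightarrow> smooth (f i)) \<Longrightarrow> smooth (\<lambda>z. \<Sum>i\<in>I. f i z)"
  by (induction I rule: infinite_finite_induct) (auto intro: smooth_const smooth_add)

lemma smooth_minus: "smooth f \<Longrightarrow> smooth (\<lambda>z. - f z)"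
  for f :: "'a::real_normed_vector \<Rightarrow> complex"
  using smooth_mult[OF smooth_const[of "-1"], of f] by simp

lemma smooth_diff: "smooth f \<Longrightarrow> smooth g \<Longrightarrow> smooth (\<lambda>z. f z - g z)"
  for f g :: "'a::real_normed_vector \<Rightarrow> complex"
  using smooth_add[OF _ smooth_minus, of f g] by simp

lemma smooth_if: "smooth f \<Longrightarrow> smooth g \<Longrightarrow> smooth (\<lambda>z. if P then f z else g z)"
  by (cases P) auto

lemma dir_deriv_compose_affine:
  assumes "bounded_linear B" "bounded_linear C" "f differentiable (at (C z + d))"
  shows "dir_deriv v (\<lambda>z. B (f (C z + d))) z = B (dir_deriv (C v) f (C z + d))"
    and "(\<lambda>z. B (f (C z + d))) differentiable (at z)"
proof -
  have C: "((\<lambda>z. C z + d) has_derivative C) (at z)"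
    using assms by (auto intro!: derivative_eq_intros bounded_linear_imp_has_derivative)
  have "((\<lambda>z. f (C z + d)) has_derivative (\<lambda>v. dir_deriv (C v) f (C z + d))) (at z)"
    using diff_chain_at[OF C differentiable_imp_has_dir_deriv[OF assms(3)]] by (simp add: o_def)
  then have *: "((\<lambda>z. B (f (C z + d))) has_derivative (\<lambda>v. B (dir_deriv (C v) f (C z + d)))) (at z)"
    by (rule bounded_linear.has_derivative[OF assms(1)])
  show "dir_deriv v (\<lambda>z. B (f (C z + d))) z = B (dir_deriv (C v) f (C z + d))"
    by (rule dir_deriv_eqI[OF *])
  show "(\<lambda>z. B (f (C z + d))) differentiable (at z)"
    using * differentiable_def by blast
qed

lemma smooth_compose_affine:
  assumes "bounded_linear B" "bounded_linear C" "smooth f"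
  shows "smooth (\<lambda>z. B (f (C z + d)))"
proof -
  have "Ck k f \<Longrightarrow> Ck k (\<lambda>z. B (f (C z + d)))" for k f
  proof (induction k arbitrary: f)
    case 0
    have "continuous_on UNIV (\<lambda>z. C z + d)"
      using assms(2) by (intro continuous_on_add continuous_on_const linear_continuous_on)
    then have "continuous_on UNIV (\<lambda>z. f (C z + d))"
      using continuous_on_compose2[of UNIV f UNIV] 0 by simp
    then show ?case using bounded_linear.continuous_on[OF assms(1)] by simp
  next
    case (Suc k)
    then have "dir_deriv v (\<lambda>z. B (f (C z + d))) = (\<lambda>z. B (dir_deriv (C v) f (C z + d)))" for v
      by (intro ext dir_deriv_compose_affine assms) auto
    then show ?case
      using Suc by (simp add: dir_deriv_compose_affine(2) assms)
  qed
  then show ?thesis using assms(3) by (simp add: smooth_def)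
qed

lemma smooth_bounded_linear: "bounded_linear B \<Longrightarrow> smooth B"
proof -
  assume B: "bounded_linear B"
  have "dir_deriv v B = (\<lambda>z. B v)" for v
    by (intro ext dir_deriv_eqI bounded_linear_imp_has_derivative B)
  then show ?thesis
    by (subst smooth_unfold) (simp add: bounded_linear_imp_differentiable[OF B] smooth_const)
qed

lemma dir_deriv_exp:
  fixes f :: "'a::real_normed_vector \<Rightarrow> complex"
  assumes "f differentiable (at z)"
  shows "dir_deriv v (\<lambda>z. exp (f z)) z = dir_deriv v f z * exp (f z)"
    and "(\<lambda>z. exp (f z)) differentiable (at z)"
proof -
  have *: "((\<lambda>z. exp (f z)) has_derivative (\<lambda>v. dir_deriv v f z * exp (f z))) (at z)"
    using diff_chain_at[OF differentiable_imp_has_dir_deriv[OF assms]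
        DERIV_exp[THEN has_field_derivative_imp_has_derivative]]
    by (simp add: o_def mult.commute)
  show "dir_deriv v (\<lambda>z. exp (f z)) z = dir_deriv v f z * exp (f z)"
    by (rule dir_deriv_eqI[OF *])
  show "(\<lambda>z. exp (f z)) differentiable (at z)"
    using * differentiable_def by blast
qed

lemma smooth_exp:
  fixes f :: "'a::real_normed_vector \<Rightarrow> complex"
  assumes "smooth f"
  shows "smooth (\<lambda>z. exp (f z))"
proof -
  have "Ck k (\<lambda>z. exp (f z))" for k
  proof (induction k)
    case 0
    show ?case using smooth_continuous[OF assms]
      by (auto intro!: continuous_at_imp_continuous_on continuous_intros)
  next
    case (Suc k)
    have "dir_deriv v (\<lambda>z. exp (f z)) = (\<lambda>z. dir_deriv v f z * exp (f z))" for v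
      by (intro ext dir_deriv_exp smooth_differentiable assms)
    then show ?case
      using Suc smooth_dir_deriv[OF assms] smooth_differentiable[OF assms]
      by (auto intro!: dir_deriv_exp(2) Ck_mult simp: smooth_def)
  qed
  then show ?thesis by (simp add: smooth_def)
qed

section \<open>Symmetry of second derivatives\<close>

text \<open>
  Two applications of the mean value theorem. The left-hand side is symmetric in \<open>u\<close> and \<open>v\<close>, so
  exchanging them compares the two mixed second derivatives at points near \<open>z\<close>.
\<close>

lemma second_difference_mean_value:
  fixes f :: "'a::real_normed_vector \<Rightarrow> real"
  assumes "smooth f" "h > 0"
  obtains s t where "0 < s" "s < h" "0 < t" "t < h"
    "f (z + h *\<^sub>R u + h *\<^sub>R v) - f (z + h *\<^sub>R u) - f (z + h *\<^sub>R v) + f z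
      = h * h * dir_deriv v (dir_deriv u f) (z + s *\<^sub>R u + t *\<^sub>R v)"
proof -
  have line: "((\<lambda>s. g (y + s *\<^sub>R w)) has_real_derivative dir_deriv w g (y + s *\<^sub>R w)) (at s)"
    if "smooth g" for g :: "'a \<Rightarrow> real" and y w s
  proof -
    have "((\<lambda>s. y + s *\<^sub>R w) has_derivative (\<lambda>s. s *\<^sub>R w)) (at s)"
      by (intro has_derivative_eq_rhs[OF has_derivative_add[OF has_derivative_const
            has_derivative_scaleR_left[OF has_derivative_ident]]]) simp
    from diff_chain_at[OF this smooth_has_derivative[OF that]]
    have "((\<lambda>s. g (y + s *\<^sub>R w)) has_derivative (\<lambda>r. dir_deriv (r *\<^sub>R w) g (y + s *\<^sub>R w))) (at s)"
      by (simp add: o_def)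
    moreover have "dir_deriv (r *\<^sub>R w) g (y + s *\<^sub>R w) = r * dir_deriv w g (y + s *\<^sub>R w)" for r
      using linear_cmul[OF has_derivative_linear[OF smooth_has_derivative[OF that]]] by simp
    ultimately show ?thesis
      by (simp add: has_field_derivative_def mult.commute[of _ "dir_deriv w g _"])
  qed
  \<comment> \<open>The second difference is the increment of \<open>p\<close> over \<open>[0, h]\<close>.\<close>
  define p where "p = (\<lambda>s. f (z + h *\<^sub>R v + s *\<^sub>R u) - f (z + s *\<^sub>R u))"
  have "(p has_real_derivative
      dir_deriv u f (z + h *\<^sub>R v + s *\<^sub>R u) - dir_deriv u f (z + s *\<^sub>R u)) (at s)" for s
    unfolding p_def by (rule DERIV_diff[OF line[OF assms(1)] line[OF assms(1)]])
  from MVT2[OF assms(2) this] obtain s where s: "0 < s" "s < h"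
    "p h - p 0 = (h - 0) * (dir_deriv u f (z + h *\<^sub>R v + s *\<^sub>R u) - dir_deriv u f (z + s *\<^sub>R u))"
    by blast
  from MVT2[OF assms(2) line[OF smooth_dir_deriv[OF assms(1), of u], of "z + s *\<^sub>R u" v]]
  obtain t where t: "0 < t" "t < h"
    "dir_deriv u f (z + s *\<^sub>R u + h *\<^sub>R v) - dir_deriv u f (z + s *\<^sub>R u + 0 *\<^sub>R v)
      = (h - 0) * dir_deriv v (dir_deriv u f) (z + s *\<^sub>R u + t *\<^sub>R v)"
    by blast
  have "f (z + h *\<^sub>R u + h *\<^sub>R v) - f (z + h *\<^sub>R u) - f (z + h *\<^sub>R v) + f z = p h - p 0"
    unfolding p_def by (simp add: add.assoc add.commute[of "h *\<^sub>R u"])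
  also have "\<dots> = h * (dir_deriv u f (z + s *\<^sub>R u + h *\<^sub>R v) - dir_deriv u f (z + s *\<^sub>R u))"
    unfolding s(3) by (simp add: add.assoc add.commute[of "h *\<^sub>R v"])
  also have "\<dots> = h * h * dir_deriv v (dir_deriv u f) (z + s *\<^sub>R u + t *\<^sub>R v)"
    using t(3) by simp
  finally show thesis
    by (rule that[OF s(1,2) t(1,2)])
qed

lemma dir_deriv_commute_real:
  fixes f :: "'a::real_normed_vector \<Rightarrow> real"
  assumes "smooth f"
  shows "dir_deriv u (dir_deriv v f) z = dir_deriv v (dir_deriv u f) z"
proof -
  define P where "P = dir_deriv u (dir_deriv v f)"
  define Q where "Q = dir_deriv v (dir_deriv u f)"
  have "isCont P z" "isCont Q z"
    unfolding P_def Q_def using assms by (auto intro!: smooth_continuous smooth_dir_deriv)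
  then have cont: "\<exists>d>0. \<forall>y. dist y z < d \<longrightarrow> dist (P y) (P z) < r \<and> dist (Q y) (Q z) < r" if r: "r > 0" for r
  proof -
    obtain d1 where d1: "d1 > 0" "\<And>y. dist y z < d1 \<Longrightarrow> dist (P y) (P z) < r"
      using \<open>isCont P z\<close> r unfolding continuous_at_eps_delta by blast
    obtain d2 where d2: "d2 > 0" "\<And>y. dist y z < d2 \<Longrightarrow> dist (Q y) (Q z) < r"
      using \<open>isCont Q z\<close> r unfolding continuous_at_eps_delta by blast
    show ?thesis
      by (rule exI[of _ "min d1 d2"]) (use d1 d2 in simp)
  qed
  have close: "dist (P z) (Q z) \<le> r" if "r > 0" for r
  proof -
    obtain d where d: "d > 0" "\<And>y. dist y z < d \<Longrightarrow> dist (P y) (P z) < r/2"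
      "\<And>y. dist y z < d \<Longrightarrow> dist (Q y) (Q z) < r/2"
      using cont[of "r/2"] \<open>r > 0\<close> by auto
    define h where "h = d / (norm u + norm v + 1)"
    have pos: "norm u + norm v + 1 > 0" by (simp add: add_nonneg_pos)
    then have "h > 0" using d(1) by (simp add: h_def)
    have near: "dist (z + s *\<^sub>R u + t *\<^sub>R v) z < d" if "0 < s" "s < h" "0 < t" "t < h" for s t
    proof -
      have "dist (z + s *\<^sub>R u + t *\<^sub>R v) z \<le> s * norm u + t * norm v"
        using that norm_triangle_ineq[of "s *\<^sub>R u" "t *\<^sub>R v"] by (simp add: dist_norm)
      also have "\<dots> \<le> h * norm u + h * norm v"
        using that by (intro add_mono mult_right_mono) auto
      also have "\<dots> < h * (norm u + norm v + 1)" using \<open>h > 0\<close> by (simp add: algebra_simps)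
      also have "\<dots> = d" using pos by (simp add: h_def)
      finally show ?thesis .
    qed
    obtain s t where st: "0 < s" "s < h" "0 < t" "t < h"
      "f (z + h *\<^sub>R u + h *\<^sub>R v) - f (z + h *\<^sub>R u) - f (z + h *\<^sub>R v) + f z
        = h * h * Q (z + s *\<^sub>R u + t *\<^sub>R v)"
      unfolding Q_def by (rule second_difference_mean_value[OF assms \<open>h > 0\<close>])
    obtain s' t' where st': "0 < s'" "s' < h" "0 < t'" "t' < h"
      "f (z + h *\<^sub>R v + h *\<^sub>R u) - f (z + h *\<^sub>R v) - f (z + h *\<^sub>R u) + f z
        = h * h * P (z + s' *\<^sub>R v + t' *\<^sub>R u)"
      unfolding P_def by (rule second_difference_mean_value[OF assms \<open>h > 0\<close>])
    have "h * h * Q (z + s *\<^sub>R u + t *\<^sub>R v) = h * h * P (z + s' *\<^sub>R v + t' *\<^sub>R u)"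
      using st(5) st'(5) by (simp add: algebra_simps)
    then have eq: "Q (z + s *\<^sub>R u + t *\<^sub>R v) = P (z + t' *\<^sub>R u + s' *\<^sub>R v)"
      using \<open>h > 0\<close> by (simp add: add_ac)
    have "dist (P z) (Q z) < r"
      using d(2)[OF near[OF st'(3,4,1,2)]] d(3)[OF near[OF st(1-4)]] unfolding eq
      by (rule dist_triangle_half_r)
    then show ?thesis by simp
  qed
  have "dist (P z) (Q z) \<le> 0"
    by (rule field_le_epsilon) (use close in simp)
  then have "P z = Q z" by simp
  then show ?thesis by (simp add: P_def Q_def)
qed

lemma dir_deriv_bounded_linear:
  assumes "bounded_linear B" "smooth f"
  shows "dir_deriv v (\<lambda>z. B (f z)) = (\<lambda>z. B (dir_deriv v f z))"
  using dir_deriv_compose_affine(1)[OF assms(1) bounded_linear_ident, of f _ 0 v]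
    smooth_differentiable[OF assms(2)] by auto

text \<open>
  The mean value argument needs real values; it is applied to real and imaginary parts.
\<close>

lemma dir_deriv_commute:
  fixes f :: "'a::real_normed_vector \<Rightarrow> complex"
  assumes "smooth f"
  shows "dir_deriv u (dir_deriv v f) = dir_deriv v (dir_deriv u f)"
proof
  fix z
  have "B (dir_deriv u (dir_deriv v f) z) = B (dir_deriv v (dir_deriv u f) z)"
    if B: "bounded_linear B" for B :: "complex \<Rightarrow> real"
  proof -
    have "smooth (\<lambda>z. B (f z))"
      using smooth_compose_affine[OF B bounded_linear_ident assms, of 0] by simp
    from dir_deriv_commute_real[OF this, of u v z] show ?thesis
      by (simp add: dir_deriv_bounded_linear[OF B] assms smooth_dir_deriv)
  qed
  from this[OF bounded_linear_Re] this[OF bounded_linear_Im]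
  show "dir_deriv u (dir_deriv v f) z = dir_deriv v (dir_deriv u f) z"
    by (simp add: complex_eq_iff)
qed

section \<open>Iterated partial derivatives\<close>

lemma dir_deriv_cmult:
  fixes f :: "'a::real_normed_vector \<Rightarrow> complex"
  assumes "smooth f"
  shows "dir_deriv v (\<lambda>z. c * f z) = (\<lambda>z. c * dir_deriv v f z)"
  by (rule dir_deriv_bounded_linear[OF bounded_linear_mult_right assms])

lemma dir_deriv_add_smooth:
  "smooth f \<Longrightarrow> smooth g \<Longrightarrow>
    dir_deriv v (\<lambda>z. f z + g z) = (\<lambda>z. dir_deriv v f z + dir_deriv v g z)"
  by (rule ext, rule dir_deriv_add) (auto intro: smooth_differentiable)

lemma dir_deriv_mult_smooth:
  fixes f g :: "'a::real_normed_vector \<Rightarrow> complex"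
  shows "smooth f \<Longrightarrow> smooth g \<Longrightarrow>
    dir_deriv v (\<lambda>z. f z * g z) = (\<lambda>z. dir_deriv v f z * g z + f z * dir_deriv v g z)"
  by (rule ext, rule dir_deriv_mult) (auto intro: smooth_differentiable)

lemma dir_deriv_sum:
  assumes "\<And>i. i \<in> I \<Longrightarrow> smooth (f i)"
  shows "dir_deriv v (\<lambda>z. \<Sum>i\<in>I. f i z) = (\<lambda>z. \<Sum>i\<in>I. dir_deriv v (f i) z)"
  using assms
proof (induction I rule: infinite_finite_induct)
  case (insert x F)
  then show ?case
    by (auto simp: dir_deriv_add smooth_differentiable smooth_sum)
qed (auto simp: dir_deriv_def)

lemma dir_deriv_zero: "dir_deriv v (\<lambda>z. c) = (\<lambda>z. 0)"
  by (auto simp: dir_deriv_def)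

lemma dir_deriv_at_0: "smooth f \<Longrightarrow> dir_deriv 0 f = (\<lambda>z. 0)"
  by (rule ext) (rule linear_0[OF has_derivative_linear[OF smooth_has_derivative]])

lemma smooth_partial_x: "smooth \<psi> \<Longrightarrow> smooth (partial_x a \<psi>)"
  by (simp add: partial_x_def smooth_dir_deriv)

lemma partial_x_add:
  "smooth \<psi> \<Longrightarrow> smooth \<phi> \<Longrightarrow>
    partial_x a (\<lambda>z. \<psi> z + \<phi> z) = (\<lambda>z. partial_x a \<psi> z + partial_x a \<phi> z)"
  by (auto simp: partial_x_def dir_deriv_add smooth_differentiable)

lemma partial_x_mult:
  "smooth \<psi> \<Longrightarrow> smooth \<phi> \<Longrightarrow>
    partial_x a (\<lambda>z. \<psi> z * \<phi> z) = (\<lambda>z. partial_x a \<psi> z * \<phi> z + \<psi> z * partial_x a \<phi> z)"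
  by (auto simp: partial_x_def dir_deriv_mult smooth_differentiable)

lemma partial_x_cmult:
  "smooth \<psi> \<Longrightarrow> partial_x a (\<lambda>z. c * \<psi> z) = (\<lambda>z. c * partial_x a \<psi> z)"
  by (simp add: partial_x_def dir_deriv_cmult)

lemma partial_x_const: "partial_x a (\<lambda>z. c) = (\<lambda>z. 0)"
  by (simp add: partial_x_def dir_deriv_zero)

lemma partial_x_sum:
  "(\<And>i. i \<in> I \<Longrightarrow> smooth (f i)) \<Longrightarrow>
    partial_x a (\<lambda>z. \<Sum>i\<in>I. f i z) = (\<lambda>z. \<Sum>i\<in>I. partial_x a (f i) z)"
  unfolding partial_x_def by (rule dir_deriv_sum)

lemma partial_x_commute:
  "smooth \<psi> \<Longrightarrow> partial_x a (partial_x b \<psi>) = partial_x b (partial_x a \<psi>)"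
  unfolding partial_x_def by (rule dir_deriv_commute)

abbreviation partial_word :: "'n::finite list \<Rightarrow> 'n oper" where
  "partial_word w \<equiv> foldr partial_x w"

lemma smooth_partial_word: "smooth \<psi> \<Longrightarrow> smooth (partial_word w \<psi>)"
  by (induction w) (auto intro: smooth_partial_x)

lemma partial_word_add:
  assumes "smooth \<psi>" "smooth \<phi>"
  shows "partial_word w (\<lambda>z. \<psi> z + \<phi> z) = (\<lambda>z. partial_word w \<psi> z + partial_word w \<phi> z)"
  by (induction w) (simp_all add: partial_x_add smooth_partial_word assms)

lemma partial_word_cmult:
  assumes "smooth \<psi>"
  shows "partial_word w (\<lambda>z. c * \<psi> z) = (\<lambda>z. c * partial_word w \<psi> z)"
  by (induction w) (simp_all add: partial_x_cmult smooth_partial_word assms)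

lemma partial_word_partial_x:
  "smooth \<psi> \<Longrightarrow> partial_word w (partial_x a \<psi>) = partial_x a (partial_word w \<psi>)"
  by (induction w) (simp_all add: partial_x_commute[of _ a] smooth_partial_word)

text \<open>
  By Schwarz's theorem only the multiset of letters matters. This is what allows coefficients to be
  replaced by symmetric ones.
\<close>

lemma partial_word_permute:
  assumes "smooth \<psi>" "mset w = mset w'"
  shows "partial_word w \<psi> = partial_word w' \<psi>"
  using assms(2)
proof (induction w arbitrary: w')
  case (Cons a w)
  then have "a \<in> set w'" by (metis list.set_intros(1) mset_eq_setD)
  then obtain u v where w': "w' = u @ a # v" by (meson split_list)
  then have "mset w = mset (u @ v)" using Cons.prems by simp
  then have "partial_word w \<psi> = partial_word (u @ v) \<psi>" by (rule Cons.IH)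
  then show ?case
    using partial_word_partial_x[OF smooth_partial_word[OF assms(1), of v], of u a] by (simp add: w')
qed simp

section \<open>Differential operators of bounded order\<close>

lemma finite_words: "finite {w :: 'n::finite list. length w = k}" "finite {w :: 'n list. length w < k}"
proof -
  have *: "finite {w :: 'n list. length w = k}" for k
    using finite_lists_length_eq[of "UNIV :: 'n set" k] by simp
  show "finite {w :: 'n::finite list. length w = k}" by (rule *)
  have "{w :: 'n list. length w < k} = (\<Union>j\<in>{..<k}. {w. length w = j})" by auto
  then show "finite {w :: 'n list. length w < k}" using * by simp
qed

lemma sum_words_below_Suc:
  fixes f :: "'n::finite list \<Rightarrow> 'b::comm_monoid_add"
  shows "(\<Sum>w | length w < Suc k. f w) = (\<Sum>w | length w < k. f w) + (\<Sum>w | length w = k. f w)"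
proof -
  have "{w :: 'n list. length w < Suc k} = {w. length w < k} \<union> {w. length w = k}" by auto
  then show ?thesis by (simp add: sum.union_disjoint finite_words disjoint_iff)
qed

lemma sum_words_graded:
  fixes f :: "'n::finite list \<Rightarrow> 'b::comm_monoid_add"
  shows "(\<Sum>j\<le>q. \<Sum>w | length w = j. f w) = (\<Sum>w | length w < Suc q. f w)"
proof (induction q)
  case 0
  have "(\<Sum>w :: 'n list | length w < 0. f w) = 0" by simp
  then show ?case using sum_words_below_Suc[of f 0] by simp
qed (simp add: sum_words_below_Suc)

lemma sum_words_Suc:
  fixes f :: "'n::finite list \<Rightarrow> 'b::comm_monoid_add"
  shows "(\<Sum>w | length w = Suc k. f w) = (\<Sum>a\<in>UNIV. \<Sum>w | length w = k. f (a # w))"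
proof -
  have "{w :: 'n list. length w = Suc k} = (\<lambda>(a, w). a # w) ` (UNIV \<times> {w. length w = k})"
    by (auto simp: length_Suc_conv)
  moreover have "inj_on (\<lambda>(a, w). a # w) (UNIV \<times> {w :: 'n list. length w = k})"
    by (auto simp: inj_on_def)
  ultimately show ?thesis
    by (simp add: sum.reindex sum.cartesian_product case_prod_unfold)
qed

text \<open>
  The bound on the order is strict, so that the induction on the order in the conversion to
  anticommutator form can start from the operator \<open>0\<close>.
\<close>

definition diff_op :: "nat \<Rightarrow> ('n::finite list \<Rightarrow> 'n stfun) \<Rightarrow> 'n oper" where
  "diff_op k c \<psi> = (\<lambda>z. \<Sum>w | length w < k. c w z * partial_word w \<psi> z)"

lemma derivative_form_eq: "derivative_form q c = diff_op (Suc q) c"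
  by (intro ext) (simp add: derivative_form_def diff_op_def sum_words_graded)

lemma smooth_diff_op:
  "(\<And>w. smooth (c w)) \<Longrightarrow> smooth \<psi> \<Longrightarrow> smooth (diff_op k c \<psi>)"
  unfolding diff_op_def by (intro smooth_sum smooth_mult smooth_partial_word)

lemma diff_op_add:
  "smooth \<psi> \<Longrightarrow> smooth \<phi> \<Longrightarrow>
    diff_op k c (\<lambda>z. \<psi> z + \<phi> z) = (\<lambda>z. diff_op k c \<psi> z + diff_op k c \<phi> z)"
  by (simp add: diff_op_def partial_word_add distrib_left sum.distrib)

lemma diff_op_cmult:
  "smooth \<psi> \<Longrightarrow> diff_op k c (\<lambda>z. m * \<psi> z) = (\<lambda>z. m * diff_op k c \<psi> z)"
  by (simp add: diff_op_def partial_word_cmult sum_distrib_left mult.left_commute)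

lemma diff_op_sum:
  assumes "finite I" "\<And>i. i \<in> I \<Longrightarrow> smooth (f i)"
  shows "diff_op k c (\<lambda>z. \<Sum>i\<in>I. f i z) = (\<lambda>z. \<Sum>i\<in>I. diff_op k c (f i) z)"
  using assms
proof (induction I rule: finite_induct)
  case empty
  show ?case using diff_op_cmult[OF smooth_const[of 0], of k c 0] by simp
qed (simp add: diff_op_add smooth_sum)

lemma partial_x_diff_op:
  assumes "\<And>w. smooth (c w)" "smooth \<psi>"
  shows "partial_x a (diff_op k c \<psi>)
    = (\<lambda>z. diff_op k (\<lambda>w. partial_x a (c w)) \<psi> z + diff_op k c (partial_x a \<psi>) z)"
  unfolding diff_op_def
  by (subst partial_x_sum)
     (simp_all add: assms smooth_mult smooth_partial_word partial_x_mult partial_word_partial_x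
        sum.distrib)

definition order_below :: "nat \<Rightarrow> 'n::finite oper \<Rightarrow> bool" where
  "order_below k P \<longleftrightarrow> (\<exists>c. (\<forall>w. smooth (c w)) \<and> (\<forall>\<psi>. smooth \<psi> \<longrightarrow> P \<psi> = diff_op k c \<psi>))"

lemma order_belowE:
  assumes "order_below k P"
  obtains c where "\<And>w. smooth (c w)" "\<And>\<psi>. smooth \<psi> \<Longrightarrow> P \<psi> = diff_op k c \<psi>"
  using assms unfolding order_below_def by blast

lemma order_below_diff_op: "(\<And>w. smooth (c w)) \<Longrightarrow> order_below k (diff_op k c)"
  unfolding order_below_def by blast

lemma order_below_cong:
  "order_below k P \<Longrightarrow> (\<And>\<psi>. smooth \<psi> \<Longrightarrow> Q \<psi> = P \<psi>) \<Longrightarrow> order_below k Q"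
  unfolding order_below_def by metis

lemma order_below_add:
  assumes "order_below k P" "order_below k Q"
  shows "order_below k (\<lambda>\<psi> z. P \<psi> z + Q \<psi> z)"
proof -
  obtain c d where "\<And>w. smooth (c w)" "\<And>w. smooth (d w)"
    "\<And>\<psi>. smooth \<psi> \<Longrightarrow> P \<psi> = diff_op k c \<psi>" "\<And>\<psi>. smooth \<psi> \<Longrightarrow> Q \<psi> = diff_op k d \<psi>"
    using assms by (metis order_belowE)
  then show ?thesis unfolding order_below_def
    by (intro exI[of _ "\<lambda>w z. c w z + d w z"])
       (auto simp: smooth_add diff_op_def distrib_right sum.distrib)
qed

lemma order_below_cmult:
  assumes "order_below k P"
  shows "order_below k (\<lambda>\<psi> z. m * P \<psi> z)"
proof -
  obtain c where "\<And>w. smooth (c w)" "\<And>\<psi>. smooth \<psi> \<Longrightarrow> P \<psi> = diff_op k c \<psi>"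
    using assms by (metis order_belowE)
  then show ?thesis unfolding order_below_def
    by (intro exI[of _ "\<lambda>w z. m * c w z"])
       (auto intro!: smooth_mult smooth_const simp: diff_op_def sum_distrib_left mult.assoc)
qed

lemma order_below_zero: "order_below k (\<lambda>\<psi> z. 0)"
  unfolding order_below_def
  by (intro exI[of _ "\<lambda>w z. 0"]) (auto simp: diff_op_def smooth_const)

lemma order_below_sum:
  "(\<And>i. i \<in> I \<Longrightarrow> order_below k (P i)) \<Longrightarrow> order_below k (\<lambda>\<psi> z. \<Sum>i\<in>I. P i \<psi> z)"
  by (induction I rule: infinite_finite_induct) (auto intro: order_below_add order_below_zero)

lemma order_below_term:
  assumes "smooth f" "length u < k"
  shows "order_below k (\<lambda>\<psi> z. f z * partial_word u \<psi> z)"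
  unfolding order_below_def
proof (intro exI[of _ "\<lambda>w z. if w = u then f z else 0"] conjI allI impI)
  show "smooth (\<lambda>z. if w = u then f z else 0)" for w
    using assms by (cases "w = u") (auto simp: smooth_const)
  show "(\<lambda>z. f z * partial_word u \<psi> z) = diff_op k (\<lambda>w z. if w = u then f z else 0) \<psi>" for \<psi>
    unfolding diff_op_def
    by (rule ext, subst sum.mono_neutral_right[of _ "{u}"]) (use assms finite_words in auto)
qed

lemma order_below_compose_partial_x:
  assumes "order_below k P"
  shows "order_below (Suc k) (\<lambda>\<psi>. P (partial_x a \<psi>))"
proof -
  obtain c where c: "\<And>w. smooth (c w)" "\<And>\<psi>. smooth \<psi> \<Longrightarrow> P \<psi> = diff_op k c \<psi>"
    using assms by (metis order_belowE)
  have "order_below (Suc k) (\<lambda>\<psi> z. \<Sum>w | length w < k. c w z * partial_word (w @ [a]) \<psi> z)"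
    by (intro order_below_sum order_below_term c) auto
  then show ?thesis
    by (rule order_below_cong) (simp add: c smooth_partial_x diff_op_def)
qed

lemma order_below_partial_x_compose:
  assumes "order_below k P"
  shows "order_below (Suc k) (\<lambda>\<psi>. partial_x a (P \<psi>))"
proof -
  obtain c where c: "\<And>w. smooth (c w)" "\<And>\<psi>. smooth \<psi> \<Longrightarrow> P \<psi> = diff_op k c \<psi>"
    using assms by (metis order_belowE)
  have "order_below (Suc k) (\<lambda>\<psi> z. (\<Sum>w | length w < k. partial_x a (c w) z * partial_word w \<psi> z)
      + diff_op k c (partial_x a \<psi>) z)"
    by (intro order_below_add order_below_sum order_below_term order_below_compose_partial_x
        order_below_diff_op c smooth_partial_x) auto
  then show ?thesis
    by (rule order_below_cong) (simp add: c partial_x_diff_op, simp add: diff_op_def)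
qed

section \<open>Anticommutator form\<close>

abbreviation iterated_anticommutator :: "'n::finite stfun \<Rightarrow> 'n list \<Rightarrow> 'n oper" where
  "iterated_anticommutator F w \<equiv> foldl (\<lambda>P a. anticommutator P (momentum a)) (mult_op F) w"

text \<open>
  Each anticommutator with \<open>p\<^sub>a = -\<i> \<partial>\<^sub>a\<close> moves the derivative to the right twice and so doubles the leading
  term; the commutators produced on the way have lower order.
\<close>

lemma iterated_anticommutator_leading:
  assumes "smooth F"
  shows "\<exists>R. order_below (length w) R \<and> (\<forall>\<psi>. smooth \<psi> \<longrightarrow>
    iterated_anticommutator F w \<psi>
      = (\<lambda>z. (- 2 * \<i>) ^ length w * F z * partial_word w \<psi> z + R \<psi> z))"
proof (induction w rule: rev_induct)
  case Nil
  show ?case by (intro exI[of _ "\<lambda>\<psi> z. 0"]) (auto simp: order_below_zero mult_op_def)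
next
  case (snoc a w)
  define m where "m = (- 2 * \<i>) ^ length w"
  obtain R where R: "order_below (length w) R"
    "\<And>\<psi>. smooth \<psi> \<Longrightarrow> iterated_anticommutator F w \<psi>
      = (\<lambda>z. m * F z * partial_word w \<psi> z + R \<psi> z)"
    using snoc unfolding m_def by blast
  obtain c where c: "\<And>w. smooth (c w)" "\<And>\<psi>. smooth \<psi> \<Longrightarrow> R \<psi> = diff_op (length w) c \<psi>"
    using R(1) by (metis order_belowE)
  define S where "S = (\<lambda>\<psi> z. - \<i> * (((m * partial_x a F z) * partial_word w \<psi> z
    + R (partial_x a \<psi>) z) + partial_x a (R \<psi>) z))"
  have "order_below (Suc (length w)) S"
    unfolding S_def using R(1)
    by (intro order_below_cmult order_below_add order_below_term order_below_compose_partial_x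
        order_below_partial_x_compose smooth_mult smooth_const smooth_partial_x assms)
      simp_all
  then have "order_below (length (w @ [a])) S" by simp
  moreover have "iterated_anticommutator F (w @ [a]) \<psi>
      = (\<lambda>z. (- 2 * \<i>) ^ length (w @ [a]) * F z * partial_word (w @ [a]) \<psi> z + S \<psi> z)"
    if \<psi>: "smooth \<psi>" for \<psi>
  proof
    fix z
    have sm: "smooth (momentum a \<psi>)"
      unfolding momentum_def by (intro smooth_mult smooth_const smooth_partial_x \<psi>)
    have 1: "iterated_anticommutator F w (momentum a \<psi>) z
      = m * F z * (- \<i> * partial_word w (partial_x a \<psi>) z) - \<i> * R (partial_x a \<psi>) z"
      unfolding R(2)[OF sm] c(2)[OF sm] c(2)[OF smooth_partial_x[OF \<psi>]]
      unfolding momentum_def partial_word_cmult[OF smooth_partial_x[OF \<psi>]]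
        diff_op_cmult[OF smooth_partial_x[OF \<psi>]] by simp
    have sR: "smooth (R \<psi>)" unfolding c(2)[OF \<psi>] by (intro smooth_diff_op c \<psi>)
    have "partial_x a (\<lambda>z. (m * F z) * partial_word w \<psi> z + R \<psi> z) z
      = (m * partial_x a F z) * partial_word w \<psi> z
        + (m * F z) * partial_x a (partial_word w \<psi>) z + partial_x a (R \<psi>) z"
      using sR by (simp add: partial_x_add partial_x_mult partial_x_const smooth_mult smooth_const
          smooth_partial_word assms \<psi>)
    then have 2: "momentum a (iterated_anticommutator F w \<psi>) z
      = - \<i> * ((m * partial_x a F z) * partial_word w \<psi> z
        + (m * F z) * partial_word w (partial_x a \<psi>) z + partial_x a (R \<psi>) z)"
      unfolding R(2)[OF \<psi>] momentum_def partial_word_partial_x[OF \<psi>] by simp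
    have "iterated_anticommutator F (w @ [a]) \<psi> z
        = iterated_anticommutator F w (momentum a \<psi>) z
          + momentum a (iterated_anticommutator F w \<psi>) z"
      by (simp add: anticommutator_def)
    also have "\<dots> = (- 2 * \<i> * m) * F z * partial_word w (partial_x a \<psi>) z + S \<psi> z"
      unfolding 1 2 S_def by (simp add: algebra_simps)
    finally show "iterated_anticommutator F (w @ [a]) \<psi> z
      = (- 2 * \<i>) ^ length (w @ [a]) * F z * partial_word (w @ [a]) \<psi> z + S \<psi> z"
      by (simp add: m_def)
  qed
  ultimately show ?case by blast
qed

definition symmetrize :: "('n::finite list \<Rightarrow> 'n stfun) \<Rightarrow> 'n list \<Rightarrow> 'n stfun" where
  "symmetrize c w = (\<lambda>z. (\<Sum>w' | mset w' = mset w. c w' z) / of_nat (card {w'. mset w' = mset w}))"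

lemma finite_permutations: "finite {w' :: 'n::finite list. mset w' = mset w}"
  by (rule finite_subset[OF _ finite_words(1)[of "length w"]]) (auto dest: mset_eq_length)

lemma symmetrize_symmetric: "mset w = mset w' \<Longrightarrow> symmetrize c w = symmetrize c w'"
  by (simp add: symmetrize_def)

lemma smooth_symmetrize: "(\<And>w. smooth (c w)) \<Longrightarrow> smooth (symmetrize c w)"
  unfolding symmetrize_def divide_inverse by (intro smooth_mult smooth_sum smooth_const)

text \<open>
  Averaging over the rearrangements of a word leaves the operator unchanged, because derivatives
  commute.
\<close>

lemma sum_symmetrize:
  fixes c :: "'n::finite list \<Rightarrow> 'n stfun"
  assumes "smooth \<psi>"
  shows "(\<Sum>w | length w = k. symmetrize c w z * partial_word w \<psi> z)
    = (\<Sum>w | length w = k. c w z * partial_word w \<psi> z)"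
proof -
  let ?W = "{w :: 'n list. length w = k}"
  let ?N = "\<lambda>w :: 'n list. of_nat (card {w'. mset w' = mset w}) :: complex"
  have N: "?N w \<noteq> 0" for w
    using finite_permutations[of w] by (auto simp: card_eq_0_iff)
  have "(\<Sum>w\<in>?W. symmetrize c w z * partial_word w \<psi> z)
      = (\<Sum>w\<in>?W. \<Sum>w' | w' \<in> ?W \<and> mset w' = mset w. c w' z * partial_word w' \<psi> z / ?N w')"
  proof (rule sum.cong[OF refl])
    fix w :: "'n list" assume "w \<in> ?W"
    then have "{w'. w' \<in> ?W \<and> mset w' = mset w} = {w'. mset w' = mset w}"
      by (auto dest: mset_eq_length)
    moreover have "symmetrize c w z * partial_word w \<psi> z
        = (\<Sum>w' | mset w' = mset w. c w' z * partial_word w \<psi> z / ?N w)"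
      by (simp add: symmetrize_def sum_distrib_right sum_divide_distrib)
    moreover have "\<dots> = (\<Sum>w' | mset w' = mset w. c w' z * partial_word w' \<psi> z / ?N w')"
    proof (rule sum.cong[OF refl])
      fix w' assume "w' \<in> {w'. mset w' = mset w}"
      then have "mset w' = mset w" by simp
      moreover from this have "partial_word w' \<psi> = partial_word w \<psi>"
        by (rule partial_word_permute[OF assms])
      ultimately show "c w' z * partial_word w \<psi> z / ?N w = c w' z * partial_word w' \<psi> z / ?N w'"
        by simp
    qed
    ultimately show "symmetrize c w z * partial_word w \<psi> z
      = (\<Sum>w' | w' \<in> ?W \<and> mset w' = mset w. c w' z * partial_word w' \<psi> z / ?N w')" by simp
  qed
  also have "\<dots> = (\<Sum>w'\<in>?W. \<Sum>w | w \<in> ?W \<and> mset w' = mset w. c w' z * partial_word w' \<psi> z / ?N w')"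
    by (rule sum.swap_restrict) (simp_all add: finite_words)
  also have "\<dots> = (\<Sum>w'\<in>?W. c w' z * partial_word w' \<psi> z)"
  proof (rule sum.cong[OF refl])
    fix w' :: "'n list" assume "w' \<in> ?W"
    then have "{w. w \<in> ?W \<and> mset w' = mset w} = {w. mset w = mset w'}"
      by (auto dest: mset_eq_length)
    then show "(\<Sum>w | w \<in> ?W \<and> mset w' = mset w. c w' z * partial_word w' \<psi> z / ?N w')
        = c w' z * partial_word w' \<psi> z"
      using N[of w'] by simp
  qed
  finally show ?thesis .
qed

text \<open>
  Triangularity: choosing \<open>F\<close> as the symmetrized leading coefficients divided by \<open>(-2\<i>)\<^sup>k\<close>
  reproduces the part of order \<open>k\<close>, and the error has lower order, so the induction hypothesis
  supplies the remaining \<open>F\<close>.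
\<close>

lemma order_below_imp_anticommutator_form:
  assumes "order_below k P"
  shows "\<exists>F. symmetric_smooth F \<and> (\<forall>\<psi>. smooth \<psi> \<longrightarrow>
    P \<psi> = (\<lambda>z. \<Sum>w | length w < k. iterated_anticommutator (F w) w \<psi> z))"
  using assms
proof (induction k arbitrary: P)
  case 0
  have "symmetric_smooth (\<lambda>w z. 0)" by (simp add: symmetric_smooth_def smooth_const)
  then show ?case using 0 by (auto simp: order_below_def diff_op_def)
next
  case (Suc k)
  obtain c where c: "\<And>w. smooth (c w)" "\<And>\<psi>. smooth \<psi> \<Longrightarrow> P \<psi> = diff_op (Suc k) c \<psi>"
    using Suc.prems by (metis order_belowE)
  \<comment> \<open>The choice of \<open>F\<close> on the words of the top length \<open>k\<close>.\<close>
  define G where "G = (\<lambda>w z. inverse ((- 2 * \<i>) ^ k) * symmetrize c w z)"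
  have G: "smooth (G w)" for w
    unfolding G_def by (intro smooth_mult smooth_const smooth_symmetrize c)
  have lead: "(- 2 * \<i>) ^ k * G w z = symmetrize c w z" for w z
    unfolding G_def mult.assoc[symmetric] by (subst right_inverse) simp_all
  have "\<forall>w. \<exists>R. order_below (length w) R \<and> (\<forall>\<psi>. smooth \<psi> \<longrightarrow>
      iterated_anticommutator (G w) w \<psi>
        = (\<lambda>z. (- 2 * \<i>) ^ length w * G w z * partial_word w \<psi> z + R \<psi> z))"
    using iterated_anticommutator_leading[OF G] by (rule allI)
  from choice[OF this] obtain R where R: "\<And>w. order_below (length w) (R w)"
    "\<And>w \<psi>. smooth \<psi> \<Longrightarrow> iterated_anticommutator (G w) w \<psi>
      = (\<lambda>z. (- 2 * \<i>) ^ length w * G w z * partial_word w \<psi> z + R w \<psi> z)"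
    by blast
  have top: "(\<Sum>w | length w = k. iterated_anticommutator (G w) w \<psi> z)
      = (\<Sum>w | length w = k. c w z * partial_word w \<psi> z) + (\<Sum>w | length w = k. R w \<psi> z)"
    if "smooth \<psi>" for \<psi> z
  proof -
    have "(\<Sum>w | length w = k. iterated_anticommutator (G w) w \<psi> z)
      = (\<Sum>w | length w = k. symmetrize c w z * partial_word w \<psi> z + R w \<psi> z)"
      using lead by (intro sum.cong refl) (auto simp: R(2)[OF that])
    then show ?thesis by (simp add: sum.distrib sum_symmetrize[OF that])
  qed
  define P' where "P' = (\<lambda>\<psi> z. diff_op k c \<psi> z + (- 1) * (\<Sum>w | length w = k. R w \<psi> z))"
  have "order_below k (\<lambda>\<psi> z. \<Sum>w | length w = k. R w \<psi> z)"
    by (rule order_below_sum) (use R(1) in auto)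
  then have "order_below k P'"
    unfolding P'_def by (rule order_below_add[OF order_below_diff_op[OF c(1)] order_below_cmult])
  note Suc.IH[OF this]
  then obtain F where F: "symmetric_smooth F" and F2: "\<forall>\<psi>. smooth \<psi> \<longrightarrow>
    P' \<psi> = (\<lambda>z. \<Sum>w | length w < k. iterated_anticommutator (F w) w \<psi> z)"
    by (elim exE conjE)
  \<comment> \<open>Below the top length, the error left by \<open>G\<close> is absorbed in \<open>F\<close>.\<close>
  define H where "H = (\<lambda>w. if length w = k then G w else F w)"
  have "symmetric_smooth H"
    unfolding symmetric_smooth_def
  proof (intro conjI allI impI)
    fix w w' :: "'a list" assume w: "mset w = mset w'"
    have "F w = F w'" using F w unfolding symmetric_smooth_def by blast
    then show "H w = H w'"
      using symmetrize_symmetric[OF w, of c] mset_eq_length[OF w] by (simp add: H_def G_def)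
  next
    show "smooth (H w)" for w
    proof -
      have "smooth (F w)" using F unfolding symmetric_smooth_def by blast
      then show ?thesis using G by (simp add: H_def)
    qed
  qed
  moreover have "P \<psi> = (\<lambda>z. \<Sum>w | length w < Suc k. iterated_anticommutator (H w) w \<psi> z)"
    if \<psi>: "smooth \<psi>" for \<psi>
  proof
    fix z
    have "P \<psi> z = P' \<psi> z + (\<Sum>w | length w = k. iterated_anticommutator (G w) w \<psi> z)"
      unfolding c(2)[OF \<psi>] top[OF \<psi>] P'_def by (simp add: diff_op_def sum_words_below_Suc)
    also have "\<dots> = (\<Sum>w | length w < k. iterated_anticommutator (H w) w \<psi> z)
      + (\<Sum>w | length w = k. iterated_anticommutator (H w) w \<psi> z)"
      unfolding F2[rule_format, OF \<psi>] by (intro arg_cong2[where f = "(+)"] sum.cong) (auto simp: H_def)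
    finally show "P \<psi> z = (\<Sum>w | length w < Suc k. iterated_anticommutator (H w) w \<psi> z)"
      by (simp add: sum_words_below_Suc)
  qed
  ultimately show ?case by blast
qed

text \<open>
  Every operator with symmetric smooth coefficients also has an anticommutator form; hence only
  the derivative form needs to be considered from here on.
\<close>

lemma diff_operatorI:
  assumes "symmetric_smooth b" "op_eq Q (diff_op (Suc q) b)"
  shows "diff_operator q b Q"
proof -
  have "order_below (Suc q) (diff_op (Suc q) b)"
    using assms(1) by (auto intro: order_below_diff_op simp: symmetric_smooth_def)
  from order_below_imp_anticommutator_form[OF this]
  obtain F where "symmetric_smooth F" "\<And>\<psi>. smooth \<psi> \<Longrightarrow> diff_op (Suc q) b \<psi>
      = (\<lambda>z. \<Sum>w | length w < Suc q. iterated_anticommutator (F w) w \<psi> z)"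
    by blast
  then show ?thesis
    using assms unfolding diff_operator_def op_eq_def anticommutator_form_def sum_words_graded
      derivative_form_eq
    by (intro conjI exI[of _ F]) simp_all
qed

section \<open>Action on plane waves\<close>

text \<open>
  Applied to \<open>exp (s \<xi>\<cdot>x)\<close>, a differential operator gives the wave times a polynomial in \<open>s\<close> whose
  coefficients are the homogeneous parts of its symbol. Orders and leading symbols of composed
  operators can thus be read off as degrees and top coefficients of polynomials in \<open>s\<close>.
\<close>

definition plane_wave :: "real ^ 'n \<Rightarrow> complex \<Rightarrow> 'n::finite stfun" where
  "plane_wave \<xi> s z = exp (s * complex_of_real (\<xi> \<bullet> fst z))"

lemma bounded_linear_phase:
  "bounded_linear (\<lambda>z :: (real ^ 'n::finite) \<times> real. s * complex_of_real (\<xi> \<bullet> fst z))"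
  by (intro bounded_linear_const_mult bounded_linear_compose[OF bounded_linear_of_real]
      bounded_linear_compose[OF bounded_linear_inner_right] bounded_linear_fst)

lemma smooth_plane_wave: "smooth (plane_wave \<xi> s)"
  unfolding plane_wave_def by (intro smooth_exp smooth_bounded_linear bounded_linear_phase)

lemma partial_x_plane_wave:
  fixes \<xi> :: "real ^ 'n::finite"
  shows "partial_x a (plane_wave \<xi> s) = (\<lambda>z. s * complex_of_real (\<xi> $ a) * plane_wave \<xi> s z)"
proof
  fix z :: "(real ^ 'n) \<times> real"
  have "dir_deriv (axis a 1, 0) (\<lambda>z. s * complex_of_real (\<xi> \<bullet> fst z)) z
      = s * complex_of_real (\<xi> $ a)"
    by (subst dir_deriv_eqI[OF bounded_linear_imp_has_derivative[OF bounded_linear_phase]])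
       (simp add: inner_axis)
  then show "partial_x a (plane_wave \<xi> s) z
      = s * complex_of_real (\<xi> $ a) * plane_wave \<xi> s z"
    unfolding partial_x_def plane_wave_def
    by (subst dir_deriv_exp[OF smooth_differentiable[OF smooth_bounded_linear[OF bounded_linear_phase]]])
       simp
qed

text \<open>
  The coefficient \<open>g\<close> of \<open>s\<^sup>d\<close> may vanish; \<open>d\<close> is only an upper bound for the degree. This makes the
  predicate stable under addition even when leading terms cancel.
\<close>

definition has_top_coeff ::
    "real ^ 'n \<Rightarrow> nat \<Rightarrow> 'n::finite stfun \<Rightarrow> (complex \<Rightarrow> 'n stfun) \<Rightarrow> bool" where
  "has_top_coeff \<xi> d g F \<longleftrightarrow> (\<exists>h. (\<forall>i. smooth (h i)) \<and> h d = g \<and>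
     (\<forall>s. F s = (\<lambda>z. plane_wave \<xi> s z * (\<Sum>i\<le>d. s ^ i * h i z))))"

lemma has_top_coeffE:
  assumes "has_top_coeff \<xi> d g F"
  obtains h where "\<And>i. smooth (h i)" "h d = g"
    "\<And>s. F s = (\<lambda>z. plane_wave \<xi> s z * (\<Sum>i\<le>d. s ^ i * h i z))"
  using assms unfolding has_top_coeff_def by blast

lemma has_top_coeff_plane_wave: "has_top_coeff \<xi> 0 (\<lambda>z. 1) (plane_wave \<xi>)"
  unfolding has_top_coeff_def
  by (intro exI[of _ "\<lambda>i z. 1"]) (simp add: smooth_const)

lemma has_top_coeff_add:
  assumes "has_top_coeff \<xi> d g F" "has_top_coeff \<xi> d g' F'"
  shows "has_top_coeff \<xi> d (\<lambda>z. g z + g' z) (\<lambda>s z. F s z + F' s z)"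
proof -
  obtain h where h: "\<And>i. smooth (h i)" "h d = g"
    "\<And>s. F s = (\<lambda>z. plane_wave \<xi> s z * (\<Sum>i\<le>d. s ^ i * h i z))"
    by (rule has_top_coeffE[OF assms(1)]) blast
  obtain h' where h': "\<And>i. smooth (h' i)" "h' d = g'"
    "\<And>s. F' s = (\<lambda>z. plane_wave \<xi> s z * (\<Sum>i\<le>d. s ^ i * h' i z))"
    by (rule has_top_coeffE[OF assms(2)]) blast
  show ?thesis unfolding has_top_coeff_def
    by (intro exI[of _ "\<lambda>i z. h i z + h' i z"])
       (use h h' in \<open>auto intro: smooth_add simp: distrib_left sum.distrib\<close>)
qed

lemma has_top_coeff_mult:
  assumes "has_top_coeff \<xi> d g F" "smooth f"
  shows "has_top_coeff \<xi> d (\<lambda>z. f z * g z) (\<lambda>s z. f z * F s z)"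
proof -
  obtain h where h: "\<And>i. smooth (h i)" "h d = g"
    "\<And>s. F s = (\<lambda>z. plane_wave \<xi> s z * (\<Sum>i\<le>d. s ^ i * h i z))"
    by (rule has_top_coeffE[OF assms(1)]) blast
  show ?thesis unfolding has_top_coeff_def
    by (intro exI[of _ "\<lambda>i z. f z * h i z"])
       (use h assms(2) in \<open>auto intro: smooth_mult simp: sum_distrib_left mult.left_commute\<close>)
qed

lemma has_top_coeff_cmult:
  "has_top_coeff \<xi> d g F \<Longrightarrow> has_top_coeff \<xi> d (\<lambda>z. m * g z) (\<lambda>s z. m * F s z)"
  by (rule has_top_coeff_mult[OF _ smooth_const])

lemma has_top_coeff_zero: "has_top_coeff \<xi> d (\<lambda>z. 0) (\<lambda>s z. 0)"
  unfolding has_top_coeff_def by (intro exI[of _ "\<lambda>i z. 0"]) (simp add: smooth_const)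

lemma has_top_coeff_sum:
  "(\<And>i. i \<in> I \<Longrightarrow> has_top_coeff \<xi> d (g i) (F i)) \<Longrightarrow>
    has_top_coeff \<xi> d (\<lambda>z. \<Sum>i\<in>I. g i z) (\<lambda>s z. \<Sum>i\<in>I. F i s z)"
proof (induction I rule: infinite_finite_induct)
  case (insert x I)
  have "has_top_coeff \<xi> d (g x) (F x)" by (rule insert.prems) simp
  moreover have "has_top_coeff \<xi> d (\<lambda>z. \<Sum>i\<in>I. g i z) (\<lambda>s z. \<Sum>i\<in>I. F i s z)"
    by (rule insert.IH, rule insert.prems) simp
  ultimately show ?case
    using insert.hyps by (simp add: has_top_coeff_add)
qed (simp_all add: has_top_coeff_zero)

text \<open>
  Raising the degree records that a term of lower degree does not contribute to the top coefficient.
\<close>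

lemma has_top_coeff_raise:
  assumes "has_top_coeff \<xi> d g F" "d < d'"
  shows "has_top_coeff \<xi> d' (\<lambda>z. 0) F"
proof -
  obtain h where h: "\<And>i. smooth (h i)" "h d = g"
    "\<And>s. F s = (\<lambda>z. plane_wave \<xi> s z * (\<Sum>i\<le>d. s ^ i * h i z))"
    by (rule has_top_coeffE[OF assms(1)]) blast
  have "(\<Sum>i\<le>d'. s ^ i * (if i \<le> d then h i z else 0)) = (\<Sum>i\<le>d. s ^ i * h i z)" for s z
    by (rule sum.mono_neutral_cong_right) (use assms(2) in auto)
  then show ?thesis unfolding has_top_coeff_def
    by (intro exI[of _ "\<lambda>i z. if i \<le> d then h i z else 0"])
       (use h assms(2) in \<open>auto intro!: smooth_if smooth_const\<close>)
qed

lemma has_top_coeff_partial_x: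
  assumes "has_top_coeff \<xi> d g F"
  shows "has_top_coeff \<xi> (Suc d) (\<lambda>z. complex_of_real (\<xi> $ a) * g z) (\<lambda>s. partial_x a (F s))"
proof -
  obtain h where h: "\<And>i. smooth (h i)" "h d = g"
    "\<And>s. F s = (\<lambda>z. plane_wave \<xi> s z * (\<Sum>i\<le>d. s ^ i * h i z))"
    by (rule has_top_coeffE[OF assms(1)]) blast
  define k where "k = (\<lambda>i z. (if i \<le> d then partial_x a (h i) z else 0)
    + (case i of 0 \<Rightarrow> 0 | Suc j \<Rightarrow> complex_of_real (\<xi> $ a) * h j z))"
  have "smooth (k i)" for i
    unfolding k_def
    by (cases i) (auto intro!: smooth_add smooth_if smooth_const smooth_mult smooth_partial_x h)
  moreover have "k (Suc d) = (\<lambda>z. complex_of_real (\<xi> $ a) * g z)"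
    by (simp add: k_def h(2))
  moreover have "partial_x a (F s) = (\<lambda>z. plane_wave \<xi> s z * (\<Sum>i\<le>Suc d. s ^ i * k i z))" for s
  proof
    fix z
    have sm: "smooth (\<lambda>z. \<Sum>i\<le>d. s ^ i * h i z)"
      by (intro smooth_sum smooth_mult smooth_const h)
    have "(\<Sum>i\<le>Suc d. s ^ i * k i z)
        = (\<Sum>i\<le>Suc d. s ^ i * (if i \<le> d then partial_x a (h i) z else 0))
          + (\<Sum>i\<le>Suc d. s ^ i * (case i of 0 \<Rightarrow> 0 | Suc j \<Rightarrow> complex_of_real (\<xi> $ a) * h j z))"
      by (simp only: k_def distrib_left sum.distrib)
    also have "(\<Sum>i\<le>Suc d. s ^ i * (if i \<le> d then partial_x a (h i) z else 0))
        = (\<Sum>i\<le>d. s ^ i * partial_x a (h i) z)"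
      by simp
    also have "(\<Sum>i\<le>Suc d. s ^ i * (case i of 0 \<Rightarrow> 0 | Suc j \<Rightarrow> complex_of_real (\<xi> $ a) * h j z))
        = s * complex_of_real (\<xi> $ a) * (\<Sum>i\<le>d. s ^ i * h i z)"
      by (subst sum.atMost_Suc_shift) (simp add: sum_distrib_left mult_ac)
    finally have "(\<Sum>i\<le>Suc d. s ^ i * k i z) = (\<Sum>i\<le>d. s ^ i * partial_x a (h i) z)
      + s * complex_of_real (\<xi> $ a) * (\<Sum>i\<le>d. s ^ i * h i z)" .
    moreover have "partial_x a (F s) z
      = s * complex_of_real (\<xi> $ a) * plane_wave \<xi> s z * (\<Sum>i\<le>d. s ^ i * h i z)
        + plane_wave \<xi> s z * (\<Sum>i\<le>d. s ^ i * partial_x a (h i) z)"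
      unfolding h(3) partial_x_mult[OF smooth_plane_wave sm] partial_x_plane_wave
      by (subst partial_x_sum) (auto intro!: smooth_mult smooth_const h simp: partial_x_cmult h)
    ultimately show "partial_x a (F s) z = plane_wave \<xi> s z * (\<Sum>i\<le>Suc d. s ^ i * k i z)"
      by (simp add: algebra_simps)
  qed
  ultimately show ?thesis unfolding has_top_coeff_def by blast
qed

text \<open>
  The wave has no zeros, and a polynomial in \<open>s\<close> determines its coefficients.
\<close>

lemma has_top_coeff_unique:
  assumes "has_top_coeff \<xi> d g F"
    and "\<And>s z. F s z = plane_wave \<xi> s z * (\<Sum>j<k. s ^ j * \<sigma> j z)"
  shows "\<And>j z. d < j \<Longrightarrow> j < k \<Longrightarrow> \<sigma> j z = 0" "\<And>z. g z = (if d < k then \<sigma> d z else 0)"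
proof -
  obtain h where h: "\<And>i. smooth (h i)" "h d = g"
    "\<And>s. F s = (\<lambda>z. plane_wave \<xi> s z * (\<Sum>i\<le>d. s ^ i * h i z))"
    by (rule has_top_coeffE[OF assms(1)]) blast
  have *: "(if i \<le> d then h i z else 0) = (if i < k then \<sigma> i z else 0)" if "i \<le> d + k" for i z
  proof -
    have eq: "(\<Sum>i\<le>d+k. (if i \<le> d then h i z else 0) * s ^ i)
        = (\<Sum>i\<le>d+k. (if i < k then \<sigma> i z else 0) * s ^ i)" for s
    proof -
      have "(\<Sum>i\<le>d+k. (if i \<le> d then h i z else 0) * s ^ i) = (\<Sum>i\<le>d. s ^ i * h i z)"
        by (rule sum.mono_neutral_cong_right) auto
      also have "\<dots> = (\<Sum>j<k. s ^ j * \<sigma> j z)"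
      proof -
        have "plane_wave \<xi> s z * (\<Sum>i\<le>d. s ^ i * h i z)
            = plane_wave \<xi> s z * (\<Sum>j<k. s ^ j * \<sigma> j z)"
          using assms(2)[of s z] h(3)[of s] by simp
        then show ?thesis by (simp add: plane_wave_def)
      qed
      also have "\<dots> = (\<Sum>i\<le>d+k. (if i < k then \<sigma> i z else 0) * s ^ i)"
        by (rule sum.mono_neutral_cong_left) auto
      finally show ?thesis .
    qed
    have "\<forall>i\<le>d+k. (if i \<le> d then h i z else 0) = (if i < k then \<sigma> i z else 0)"
      by (rule polyfun_eq_coeffs[THEN iffD1]) (rule allI, rule eq)
    then show ?thesis using that by blast
  qed
  show "\<sigma> j z = 0" if "d < j" "j < k" for j z using *[of j z] that by simp
  show "g z = (if d < k then \<sigma> d z else 0)" for z using *[of d z] h(2) by auto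
qed

definition monomial :: "real ^ 'n \<Rightarrow> 'n::finite list \<Rightarrow> complex" where
  "monomial \<xi> w = (\<Prod>a\<leftarrow>w. complex_of_real (\<xi> $ a))"

lemma monomial_simps [simp]:
  "monomial \<xi> [] = 1" "monomial \<xi> (a # w) = complex_of_real (\<xi> $ a) * monomial \<xi> w"
  by (simp_all add: monomial_def)

definition symbol ::
    "nat \<Rightarrow> ('n::finite list \<Rightarrow> 'n stfun) \<Rightarrow> ((real ^ 'n) \<times> real) \<times> (real ^ 'n) \<Rightarrow> complex" where
  "symbol k c = (\<lambda>(z, \<xi>). \<Sum>w | length w = k. c w z * monomial \<xi> w)"

lemma has_top_coeff_partial_word:
  "has_top_coeff \<xi> d g F \<Longrightarrow>
    has_top_coeff \<xi> (d + length w) (\<lambda>z. monomial \<xi> w * g z) (\<lambda>s. partial_word w (F s))"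
proof (induction w)
  case (Cons a w)
  from has_top_coeff_partial_x[OF Cons.IH[OF Cons.prems], of a]
  show ?case by (simp add: mult.assoc)
qed simp

lemma has_top_coeff_diff_op:
  assumes F: "has_top_coeff \<xi> d g F" and c: "\<And>w. smooth (c w)"
    and r: "r < k" "\<And>w. r < length w \<Longrightarrow> length w < k \<Longrightarrow> c w = (\<lambda>z. 0)"
  shows "has_top_coeff \<xi> (d + r) (\<lambda>z. symbol r c (z, \<xi>) * g z) (\<lambda>s. diff_op k c (F s))"
proof -
  \<comment> \<open>Words shorter than \<open>r\<close> contribute only to lower powers of \<open>s\<close>, longer ones have coefficient 0.\<close>
  define T where "T = (\<lambda>w z. if length w = r then c w z * (monomial \<xi> w * g z) else 0)"
  have "has_top_coeff \<xi> (d + r) (T w) (\<lambda>s z. c w z * partial_word w (F s) z)"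
    if "w \<in> {w. length w < k}" for w
  proof -
    note * = has_top_coeff_mult[OF has_top_coeff_partial_word[OF F] c, of w w]
    consider "length w = r" | "length w < r" | "r < length w" by linarith
    then show ?thesis
    proof cases
      case 1
      then show ?thesis using * by (simp add: T_def)
    next
      case 2
      then show ?thesis using has_top_coeff_raise[OF *, of "d + r"] by (simp add: T_def)
    next
      case 3
      then show ?thesis using r(2)[of w] that has_top_coeff_zero by (simp add: T_def)
    qed
  qed
  from has_top_coeff_sum[of "{w. length w < k}", OF this]
  have "has_top_coeff \<xi> (d + r) (\<lambda>z. \<Sum>w | length w < k. T w z) (\<lambda>s. diff_op k c (F s))"
    by (simp add: diff_op_def)
  moreover have "(\<Sum>w | length w < k. T w z) = symbol r c (z, \<xi>) * g z" for z
  proof -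
    have "(\<Sum>w | length w < k. T w z) = (\<Sum>w | length w = r. c w z * (monomial \<xi> w * g z))"
      by (rule sum.mono_neutral_cong_right) (use r(1) in \<open>auto simp: T_def finite_words\<close>)
    then show ?thesis by (simp add: symbol_def sum_distrib_right mult.assoc)
  qed
  ultimately show ?thesis by simp
qed

lemma diff_op_plane_wave:
  "diff_op k c (plane_wave \<xi> s) z = plane_wave \<xi> s z * (\<Sum>j<k. s ^ j * symbol j c (z, \<xi>))"
proof -
  have pw: "partial_word w (plane_wave \<xi> s)
      = (\<lambda>z. s ^ length w * monomial \<xi> w * plane_wave \<xi> s z)" for w
  proof (induction w)
    case (Cons a w)
    have "partial_word (a # w) (plane_wave \<xi> s)
        = partial_x a (\<lambda>z. s ^ length w * monomial \<xi> w * plane_wave \<xi> s z)"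
      using Cons by simp
    also have "\<dots> = (\<lambda>z. s ^ length w * monomial \<xi> w * partial_x a (plane_wave \<xi> s) z)"
      by (rule partial_x_cmult[OF smooth_plane_wave])
    finally show ?case by (simp add: partial_x_plane_wave mult_ac)
  qed simp
  show ?thesis
  proof (induction k)
    case (Suc k)
    have "(\<Sum>w | length w = k. c w z * partial_word w (plane_wave \<xi> s) z)
        = plane_wave \<xi> s z * (s ^ k * symbol k c (z, \<xi>))"
      unfolding pw symbol_def prod.case sum_distrib_left by (intro sum.cong) (auto simp: mult_ac)
    then show ?case
      using Suc by (simp add: diff_op_def sum_words_below_Suc distrib_left)
  qed (simp add: diff_op_def)
qed

section \<open>The leading symbol of a commutator\<close>

text \<open>
  The time-independent part of the Schroedinger operator after expanding the square of the kinetic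
  momentum: \<open>p\<close> and \<open>v\<close> absorb the vector potential, its divergence and the scalar potential.
\<close>

definition spatial_op :: "('n::finite \<Rightarrow> 'n stfun) \<Rightarrow> 'n stfun \<Rightarrow> 'n oper" where
  "spatial_op p v \<psi> = (\<lambda>z. - (1 / 2) * (\<Sum>a\<in>UNIV. partial_x a (partial_x a \<psi>) z)
     + ((\<Sum>a\<in>UNIV. p a z * partial_x a \<psi> z) + v z * \<psi> z))"

lemma smooth_spatial_op:
  assumes "\<And>a. smooth (p a)" "smooth v" "smooth \<psi>"
  shows "smooth (spatial_op p v \<psi>)"
  unfolding spatial_op_def
  by (intro smooth_add smooth_mult smooth_sum smooth_const smooth_partial_x assms)

text \<open>
  Since \<open>[\<partial>\<^sub>a, D]\<close> differentiates the coefficients of \<open>D\<close>, the Laplacian contributes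
  \<open>\<partial>\<^sub>a [\<partial>\<^sub>a, D] + [\<partial>\<^sub>a, D] \<partial>\<^sub>a\<close>. Next to \<open>p\<^sub>a [\<partial>\<^sub>a, D]\<close>, of the order of \<open>D\<close>, there remain two
  differences in which the leading symbols cancel.
\<close>

lemma spatial_op_diff_op_commutator:
  assumes p: "\<And>a. smooth (p a)" and v: "smooth v" and c: "\<And>w. smooth (c w)" and \<psi>: "smooth \<psi>"
  shows "spatial_op p v (diff_op k c \<psi>) z - diff_op k c (spatial_op p v \<psi>) z
    = (\<Sum>a\<in>UNIV. - (1 / 2) * (partial_x a (diff_op k (\<lambda>w. partial_x a (c w)) \<psi>) z
          + diff_op k (\<lambda>w. partial_x a (c w)) (partial_x a \<psi>) z)
        + (p a z * diff_op k (\<lambda>w. partial_x a (c w)) \<psi> z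
          + (p a z * diff_op k c (partial_x a \<psi>) z
            + - 1 * diff_op k c (\<lambda>z. p a z * partial_x a \<psi> z) z)))
      + (v z * diff_op k c \<psi> z + - 1 * diff_op k c (\<lambda>z. v z * \<psi> z) z)"
proof -
  let ?D = "diff_op k c" and ?D' = "\<lambda>a. diff_op k (\<lambda>w. partial_x a (c w))"
  have c': "smooth (partial_x a (c w))" for a w by (intro smooth_partial_x c)
  have d\<psi>: "smooth (partial_x a \<psi>)" for a by (intro smooth_partial_x \<psi>)
  have 1: "partial_x a (partial_x a (?D \<psi>)) z = partial_x a (?D' a \<psi>) z
      + ?D' a (partial_x a \<psi>) z + ?D (partial_x a (partial_x a \<psi>)) z" for a
    unfolding partial_x_diff_op[OF c \<psi>]
      partial_x_add[OF smooth_diff_op[OF c' \<psi>] smooth_diff_op[OF c d\<psi>]] partial_x_diff_op[OF c d\<psi>]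
    by simp
  have sm: "smooth (\<lambda>z. p a z * partial_x a \<psi> z)" "smooth (\<lambda>z. v z * \<psi> z)"
    "smooth (partial_x a (partial_x a \<psi>))" for a
    by (intro smooth_mult smooth_partial_x p v \<psi>)+
  have kin: "smooth (\<lambda>z. - (1 / 2) * (\<Sum>a\<in>UNIV. partial_x a (partial_x a \<psi>) z))"
    by (intro smooth_mult smooth_const smooth_sum sm)
  have drift: "smooth (\<lambda>z. \<Sum>a\<in>UNIV. p a z * partial_x a \<psi> z)" by (intro smooth_sum sm)
  have pot: "smooth (\<lambda>z. (\<Sum>a\<in>UNIV. p a z * partial_x a \<psi> z) + v z * \<psi> z)"
    by (intro smooth_add drift sm)
  have "?D (spatial_op p v \<psi>) z = ?D (\<lambda>z. - (1 / 2) * (\<Sum>a\<in>UNIV. partial_x a (partial_x a \<psi>) z)) z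
     + (?D (\<lambda>z. \<Sum>a\<in>UNIV. p a z * partial_x a \<psi> z) z + ?D (\<lambda>z. v z * \<psi> z) z)"
    unfolding spatial_op_def
    by (simp only: diff_op_add[OF kin pot] diff_op_add[OF drift sm(2)])
  also have "?D (\<lambda>z. \<Sum>a\<in>UNIV. p a z * partial_x a \<psi> z) z
      = (\<Sum>a\<in>UNIV. ?D (\<lambda>z. p a z * partial_x a \<psi> z) z)"
    by (simp only: diff_op_sum[OF finite sm(1)])
  also have "?D (\<lambda>z. - (1 / 2) * (\<Sum>a\<in>UNIV. partial_x a (partial_x a \<psi>) z)) z
      = - (1 / 2) * (\<Sum>a\<in>UNIV. ?D (partial_x a (partial_x a \<psi>)) z)"
    by (simp only: diff_op_cmult[OF smooth_sum[OF sm(3)]] diff_op_sum[OF finite sm(3)])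
  finally have 2: "?D (spatial_op p v \<psi>) z
      = - (1 / 2) * (\<Sum>a\<in>UNIV. ?D (partial_x a (partial_x a \<psi>)) z)
        + ((\<Sum>a\<in>UNIV. ?D (\<lambda>z. p a z * partial_x a \<psi> z) z) + ?D (\<lambda>z. v z * \<psi> z) z)" .
  have 3: "p a z * partial_x a (?D \<psi>) z = p a z * ?D' a \<psi> z + p a z * ?D (partial_x a \<psi>) z" for a
    unfolding partial_x_diff_op[OF c \<psi>] by (simp add: distrib_left)
  show ?thesis
    unfolding 2 unfolding spatial_op_def 1 3
    by (simp only: sum.distrib distrib_left sum_distrib_left[symmetric]) (simp add: algebra_simps)
qed

text \<open>
  If \<open>D\<close> has order \<open>r\<close> then \<open>[H, D]\<close> has order at most \<open>r + 1\<close>, and its symbol of that order is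
  \<open>- \<Sum>\<^sub>a \<xi>\<^sub>a \<partial>\<sigma>/\<partial>x\<^sub>a\<close> with \<open>\<sigma>\<close> the symbol of \<open>D\<close>: only the Laplacian contributes. When the
  commutator is known to have order less than \<open>k\<close> and \<open>r + 1 = k\<close>, this expression must vanish.
\<close>

lemma commutator_symbol:
  assumes p: "\<And>a. smooth (p a)" and v: "smooth v"
    and c: "\<And>w. smooth (c w)"
    and comm: "\<And>\<psi> z. smooth \<psi> \<Longrightarrow>
      spatial_op p v (diff_op k c \<psi>) z - diff_op k c (spatial_op p v \<psi>) z = diff_op k c' \<psi> z"
    and r: "r < k" "\<And>w. r < length w \<Longrightarrow> length w < k \<Longrightarrow> c w = (\<lambda>z. 0)"
  shows "\<And>j z. Suc r < j \<Longrightarrow> j < k \<Longrightarrow> symbol j c' (z, \<xi>) = 0"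
    and "\<And>z. (\<Sum>a\<in>UNIV. complex_of_real (\<xi> $ a) * symbol r (\<lambda>w. partial_x a (c w)) (z, \<xi>))
      = (if Suc r < k then - symbol (Suc r) c' (z, \<xi>) else 0)"
proof -
  let ?D = "diff_op k c" and ?D' = "\<lambda>a. diff_op k (\<lambda>w. partial_x a (c w))"
  let ?e = "plane_wave \<xi>" and ?\<xi> = "\<lambda>a. complex_of_real (\<xi> $ a)"
  define \<sigma> where "\<sigma> = (\<lambda>z. symbol r c (z, \<xi>))"
  define \<sigma>' where "\<sigma>' = (\<lambda>a z. symbol r (\<lambda>w. partial_x a (c w)) (z, \<xi>))"
  have c': "smooth (partial_x a (c w))" for a w by (intro smooth_partial_x c)
  have r': "partial_x a (c w) = (\<lambda>z. 0)" if "r < length w" "length w < k" for a w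
    using r(2)[OF that] by (simp add: partial_x_const)
  have D: "has_top_coeff \<xi> (d + r) (\<lambda>z. \<sigma> z * g z) (\<lambda>s. ?D (F s))"
    if "has_top_coeff \<xi> d g F" for d g F
    unfolding \<sigma>_def by (rule has_top_coeff_diff_op[OF that c r])
  have D': "has_top_coeff \<xi> (d + r) (\<lambda>z. \<sigma>' a z * g z) (\<lambda>s. ?D' a (F s))"
    if "has_top_coeff \<xi> d g F" for d g F a
    unfolding \<sigma>'_def by (rule has_top_coeff_diff_op[OF that c' r(1) r'])
  note e = has_top_coeff_plane_wave[of \<xi>]
  have de: "has_top_coeff \<xi> 1 (\<lambda>z. ?\<xi> a) (\<lambda>s. partial_x a (?e s))" for a
    using has_top_coeff_partial_x[OF e, of a] by simp
  have t1: "has_top_coeff \<xi> (Suc r) (\<lambda>z. ?\<xi> a * \<sigma>' a z) (\<lambda>s. partial_x a (?D' a (?e s)))" for a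
    using has_top_coeff_partial_x[OF D'[OF e], of a a] by simp
  have t2: "has_top_coeff \<xi> (Suc r) (\<lambda>z. \<sigma>' a z * ?\<xi> a) (\<lambda>s. ?D' a (partial_x a (?e s)))" for a
    using D'[OF de, of a a] by simp
  have t3: "has_top_coeff \<xi> (Suc r) (\<lambda>z. 0) (\<lambda>s z. p a z * ?D' a (?e s) z)" for a
    by (rule has_top_coeff_raise[OF has_top_coeff_mult[OF D'[OF e] p]]) simp
  have t4: "has_top_coeff \<xi> (Suc r) (\<lambda>z. p a z * (\<sigma> z * ?\<xi> a)) (\<lambda>s z. p a z * ?D (partial_x a (?e s)) z)" for a
    using has_top_coeff_mult[OF D[OF de, of a] p[of a]] by simp
  have t5: "has_top_coeff \<xi> (Suc r) (\<lambda>z. \<sigma> z * (p a z * ?\<xi> a)) (\<lambda>s. ?D (\<lambda>z. p a z * partial_x a (?e s) z))" for a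
    using D[OF has_top_coeff_mult[OF de[of a] p[of a]]] by simp
  have t6: "has_top_coeff \<xi> (Suc r) (\<lambda>z. 0) (\<lambda>s z. v z * ?D (?e s) z)"
    by (rule has_top_coeff_raise[OF has_top_coeff_mult[OF D[OF e] v]]) simp
  have t7: "has_top_coeff \<xi> (Suc r) (\<lambda>z. 0) (\<lambda>s. ?D (\<lambda>z. v z * ?e s z))"
    by (rule has_top_coeff_raise[OF D[OF has_top_coeff_mult[OF e v]]]) simp
  \<comment> \<open>In the terms \<open>t4\<close> and \<open>t5\<close> the symbol of a product does not depend on the order of the factors.\<close>
  have total: "has_top_coeff \<xi> (Suc r)
    (\<lambda>z. (\<Sum>a\<in>UNIV. - (1 / 2) * (?\<xi> a * \<sigma>' a z + \<sigma>' a z * ?\<xi> a)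
        + (0 + (p a z * (\<sigma> z * ?\<xi> a) + - 1 * (\<sigma> z * (p a z * ?\<xi> a))))) + (0 + - 1 * 0))
    (\<lambda>s. diff_op k c' (?e s))"
  proof -
    have "diff_op k c' (?e s) = (\<lambda>z. (\<Sum>a\<in>UNIV. - (1 / 2) *
          (partial_x a (?D' a (?e s)) z + ?D' a (partial_x a (?e s)) z)
        + (p a z * ?D' a (?e s) z + (p a z * ?D (partial_x a (?e s)) z
            + - 1 * ?D (\<lambda>z. p a z * partial_x a (?e s) z) z)))
      + (v z * ?D (?e s) z + - 1 * ?D (\<lambda>z. v z * ?e s z) z))" for s
      by (rule ext, subst comm[OF smooth_plane_wave, symmetric])
         (rule spatial_op_diff_op_commutator[OF p v c smooth_plane_wave])
    then show ?thesis
      by (simp only:) (intro has_top_coeff_add has_top_coeff_sum has_top_coeff_cmult t1 t2 t3 t4 t5 t6 t7)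
  qed
  show "symbol j c' (z, \<xi>) = 0" if "Suc r < j" "j < k" for j z
    by (rule has_top_coeff_unique(1)[OF total diff_op_plane_wave that])
  show "(\<Sum>a\<in>UNIV. ?\<xi> a * symbol r (\<lambda>w. partial_x a (c w)) (z, \<xi>))
      = (if Suc r < k then - symbol (Suc r) c' (z, \<xi>) else 0)" for z
  proof -
    have "(\<Sum>a\<in>UNIV. - (1 / 2) * (?\<xi> a * \<sigma>' a z + \<sigma>' a z * ?\<xi> a)
        + (0 + (p a z * (\<sigma> z * ?\<xi> a) + - 1 * (\<sigma> z * (p a z * ?\<xi> a)))))
      = (\<Sum>a\<in>UNIV. - (?\<xi> a * \<sigma>' a z))"
      by (rule sum.cong) (auto simp: algebra_simps)
    then have *: "- (\<Sum>a\<in>UNIV. ?\<xi> a * \<sigma>' a z) = (if Suc r < k then symbol (Suc r) c' (z, \<xi>) else 0)"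
      using has_top_coeff_unique(2)[OF total diff_op_plane_wave, of z] by (simp add: sum_negf)
    have "(\<Sum>a\<in>UNIV. ?\<xi> a * \<sigma>' a z) = - (if Suc r < k then symbol (Suc r) c' (z, \<xi>) else 0)"
      unfolding *[symmetric] by simp
    then show ?thesis unfolding \<sigma>'_def by simp
  qed
qed

section \<open>Leading symbols as functions of position and covector\<close>

type_synonym 'n symfun = "((real ^ 'n) \<times> real) \<times> (real ^ 'n) \<Rightarrow> complex"

definition pos_deriv :: "'n::finite \<Rightarrow> 'n symfun \<Rightarrow> 'n symfun" where
  "pos_deriv a = dir_deriv ((axis a 1, 0), 0)"

definition fib_deriv :: "'n::finite \<Rightarrow> 'n symfun \<Rightarrow> 'n symfun" where
  "fib_deriv a = dir_deriv (0, axis a 1)"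

definition fib_coord :: "'n::finite \<Rightarrow> 'n symfun" where
  "fib_coord a = (\<lambda>p. complex_of_real (snd p $ a))"

text \<open>
  The derivative \<open>\<Sum>\<^sub>a \<xi>\<^sub>a \<partial>/\<partial>x\<^sub>a\<close> along straight lines; by the previous section, minus its value on
  the leading symbol of an operator is the leading symbol of the commutator with \<open>H\<close>.
\<close>

definition transport :: "'n::finite symfun \<Rightarrow> 'n symfun" where
  "transport F = (\<lambda>p. \<Sum>a\<in>UNIV. fib_coord a p * pos_deriv a F p)"

lemma bounded_linear_fib_coord: "bounded_linear (fib_coord a)"
  unfolding fib_coord_def
  by (intro bounded_linear_compose[OF bounded_linear_of_real]
      bounded_linear_compose[OF bounded_linear_vec_nth] bounded_linear_snd)

lemma smooth_fib_coord: "smooth (fib_coord a)"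
  by (rule smooth_bounded_linear[OF bounded_linear_fib_coord])

lemma pos_deriv_fib_coord: "pos_deriv b (fib_coord a) = (\<lambda>p. 0)"
  unfolding pos_deriv_def
  by (rule ext, subst dir_deriv_eqI[OF bounded_linear_imp_has_derivative[OF bounded_linear_fib_coord]])
     (simp add: fib_coord_def)

lemma fib_deriv_fib_coord: "fib_deriv b (fib_coord a) = (\<lambda>p. if a = b then 1 else 0)"
  unfolding fib_deriv_def
  by (rule ext, subst dir_deriv_eqI[OF bounded_linear_imp_has_derivative[OF bounded_linear_fib_coord]])
     (auto simp: fib_coord_def axis_def)

lemma smooth_pos_deriv: "smooth F \<Longrightarrow> smooth (pos_deriv a F)"
  and smooth_fib_deriv: "smooth F \<Longrightarrow> smooth (fib_deriv a F)"
  by (simp_all add: pos_deriv_def fib_deriv_def smooth_dir_deriv)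

lemma smooth_transport: "smooth F \<Longrightarrow> smooth (transport F)"
  unfolding transport_def
  by (rule smooth_sum, rule smooth_mult[OF smooth_fib_coord smooth_pos_deriv])

lemma smooth_transport_pow: "smooth F \<Longrightarrow> smooth ((transport ^^ m) F)"
  by (induction m) (auto intro: smooth_transport)

lemma pos_deriv_transport:
  assumes "smooth F"
  shows "pos_deriv b (transport F) = transport (pos_deriv b F)"
proof -
  have "pos_deriv b (transport F) = (\<lambda>p. \<Sum>a\<in>UNIV. pos_deriv b (\<lambda>p. fib_coord a p * pos_deriv a F p) p)"
    unfolding transport_def pos_deriv_def
    by (rule dir_deriv_sum)
       (rule smooth_mult[OF smooth_fib_coord smooth_dir_deriv[OF assms]])
  also have "\<dots> = (\<lambda>p. \<Sum>a\<in>UNIV. fib_coord a p * pos_deriv b (pos_deriv a F) p)"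
    unfolding pos_deriv_def
    by (subst dir_deriv_mult_smooth[OF smooth_fib_coord smooth_dir_deriv[OF assms]])
       (simp add: pos_deriv_fib_coord[unfolded pos_deriv_def])
  also have "\<dots> = transport (pos_deriv b F)"
    unfolding transport_def pos_deriv_def by (subst dir_deriv_commute[OF assms]) simp
  finally show ?thesis .
qed

lemma fib_deriv_sum_coord:
  assumes "\<And>a. smooth (G a)"
  shows "fib_deriv b (\<lambda>p. \<Sum>a\<in>UNIV. fib_coord a p * G a p)
    = (\<lambda>p. G b p + (\<Sum>a\<in>UNIV. fib_coord a p * fib_deriv b (G a) p))"
proof
  fix p
  have "fib_deriv b (\<lambda>p. \<Sum>a\<in>UNIV. fib_coord a p * G a p) p
      = (\<Sum>a\<in>UNIV. fib_deriv b (\<lambda>p. fib_coord a p * G a p) p)"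
    unfolding fib_deriv_def
    by (rule fun_cong[OF dir_deriv_sum]) (rule smooth_mult[OF smooth_fib_coord assms])
  also have "\<dots> = (\<Sum>a\<in>UNIV. (if a = b then 1 else 0) * G a p + fib_coord a p * fib_deriv b (G a) p)"
    unfolding fib_deriv_def
    by (subst dir_deriv_mult_smooth[OF smooth_fib_coord assms])
       (simp add: fib_deriv_fib_coord[unfolded fib_deriv_def])
  also have "\<dots> = G b p + (\<Sum>a\<in>UNIV. fib_coord a p * fib_deriv b (G a) p)"
    unfolding sum.distrib by (simp add: if_distrib[of "\<lambda>x. x * _"] cong: if_cong)
  finally show "fib_deriv b (\<lambda>p. \<Sum>a\<in>UNIV. fib_coord a p * G a p) p
    = G b p + (\<Sum>a\<in>UNIV. fib_coord a p * fib_deriv b (G a) p)" .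
qed

text \<open>
  The commutation relation \<open>[\<partial>/\<partial>\<xi>\<^sub>b, \<Sum>\<^sub>a \<xi>\<^sub>a \<partial>/\<partial>x\<^sub>a] = \<partial>/\<partial>x\<^sub>b\<close> drives the rest of this section.
\<close>

lemma fib_deriv_transport:
  assumes "smooth F"
  shows "fib_deriv b (transport F) = (\<lambda>p. pos_deriv b F p + transport (fib_deriv b F) p)"
proof -
  have "fib_deriv b (pos_deriv a F) = pos_deriv a (fib_deriv b F)" for a
    unfolding fib_deriv_def pos_deriv_def by (rule dir_deriv_commute[OF assms])
  then show ?thesis
    unfolding transport_def fib_deriv_sum_coord[OF smooth_pos_deriv[OF assms]] by simp
qed

lemma transport_combination:
  assumes "smooth F" "smooth G"
  shows "transport (\<lambda>p. F p + c * G p) = (\<lambda>p. transport F p + c * transport G p)"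
proof -
  have "pos_deriv a (\<lambda>p. F p + c * G p) p = pos_deriv a F p + c * pos_deriv a G p" for a p
    unfolding pos_deriv_def
    by (subst dir_deriv_add)
       (simp_all add: smooth_differentiable assms smooth_mult smooth_const dir_deriv_cmult)
  then show ?thesis
    by (simp add: transport_def distrib_left sum.distrib sum_distrib_left mult.left_commute)
qed

lemma transport_zero: "transport (\<lambda>p. 0) = (\<lambda>p. 0)"
  by (simp add: transport_def pos_deriv_def dir_deriv_zero)

lemma transport_cmult:
  "smooth G \<Longrightarrow> transport (\<lambda>p. c * G p) = (\<lambda>p. c * transport G p)"
  using transport_combination[OF smooth_const[of 0], of G c] by (simp add: transport_zero)

lemma transport_pow_cmult:
  "smooth G \<Longrightarrow> (transport ^^ m) (\<lambda>p. c * G p) = (\<lambda>p. c * (transport ^^ m) G p)"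
  by (induction m) (simp_all add: transport_cmult smooth_transport_pow)

lemma transport_pow_fib_deriv:
  assumes "smooth F"
  shows "(transport ^^ Suc m) (fib_deriv b F)
    = (\<lambda>p. transport (fib_deriv b ((transport ^^ m) F)) p
        + (- of_nat m) * pos_deriv b ((transport ^^ m) F) p)"
proof (induction m)
  case (Suc m)
  define G where "G = (transport ^^ m) F"
  have G: "smooth G" unfolding G_def by (rule smooth_transport_pow[OF assms])
  have sT: "smooth (transport (fib_deriv b G))" by (intro smooth_transport smooth_fib_deriv G)
  have sP: "smooth (pos_deriv b G)" by (rule smooth_pos_deriv[OF G])
  have "(transport ^^ Suc (Suc m)) (fib_deriv b F)
      = transport (\<lambda>p. transport (fib_deriv b G) p + (- of_nat m) * pos_deriv b G p)"
    using Suc unfolding G_def by simp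
  also have "\<dots> = (\<lambda>p. transport (transport (fib_deriv b G)) p + (- of_nat m) * transport (pos_deriv b G) p)"
    by (rule transport_combination[OF sT sP])
  also have "\<dots> = (\<lambda>p. transport (fib_deriv b (transport G)) p
      + (- of_nat (Suc m)) * pos_deriv b (transport G) p)"
    unfolding fib_deriv_transport[OF G] pos_deriv_transport[OF G]
    using transport_combination[OF sP sT, of 1] by (simp add: algebra_simps)
  finally show ?case by (simp add: G_def)
qed simp

text \<open>
  Differentiating a solution of \<open>T\<^sup>m F = 0\<close> in the covector costs one more power of \<open>T\<close>: the error term
  \<open>m \<partial>/\<partial>x\<^sub>b T\<^sup>m\<^sup>-\<^sup>1 F\<close> is removed by applying \<open>T\<close> once more.
\<close>

corollary transport_pow_fib_deriv_eq_0:
  assumes "smooth F" "(transport ^^ m) F = (\<lambda>p. 0)"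
  shows "(transport ^^ Suc m) (fib_deriv b F) = (\<lambda>p. 0)"
  unfolding transport_pow_fib_deriv[OF assms(1)] assms(2)
  by (simp add: fib_deriv_def pos_deriv_def dir_deriv_zero transport_zero)

lemma symbol_0: "symbol 0 c = (\<lambda>p. c [] (fst p))"
  by (auto simp: symbol_def)

lemma symbol_Suc:
  "symbol (Suc k) c = (\<lambda>p. \<Sum>a\<in>UNIV. fib_coord a p * symbol k (\<lambda>w. c (a # w)) p)"
  by (auto simp: symbol_def sum_words_Suc fib_coord_def sum_distrib_left mult.left_commute)

lemma bounded_linear_embed_pos:
  "bounded_linear (\<lambda>z :: (real ^ 'n::finite) \<times> real. (z, 0 :: real ^ 'n))"
  by (intro bounded_linear_Pair bounded_linear_ident bounded_linear_zero)

lemma smooth_fst_compose: "smooth f \<Longrightarrow> smooth (\<lambda>p. f (fst p))"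
  for f :: "'a::real_normed_vector \<Rightarrow> 'b::real_normed_vector"
  using smooth_compose_affine[OF bounded_linear_ident bounded_linear_fst, of f 0] by simp

lemma dir_deriv_fst_compose:
  fixes f :: "'a::real_normed_vector \<Rightarrow> 'b::real_normed_vector"
  assumes "smooth f"
  shows "dir_deriv v (\<lambda>p :: 'a \<times> 'c::real_normed_vector. f (fst p)) = (\<lambda>p. dir_deriv (fst v) f (fst p))"
  using dir_deriv_compose_affine(1)[OF bounded_linear_ident bounded_linear_fst, of f _ 0 v]
  by (intro ext) (simp add: smooth_differentiable assms)

lemma smooth_symbol:
  assumes "\<And>w. smooth (c w)"
  shows "smooth (symbol k c)"
  using assms
proof (induction k arbitrary: c)
  case 0
  then show ?case by (simp add: symbol_0 smooth_fst_compose)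
next
  case (Suc k)
  show ?case
    unfolding symbol_Suc
    by (rule smooth_sum, rule smooth_mult[OF smooth_fib_coord], rule Suc.IH, rule Suc.prems)
qed

text \<open>
  Euler's rule for a homogeneous polynomial with symmetric coefficients.
\<close>

lemma fib_deriv_symbol:
  assumes "\<And>w. smooth (c w)" "\<And>w w'. mset w = mset w' \<Longrightarrow> c w = c w'"
  shows "fib_deriv a (symbol (Suc k) c) = (\<lambda>p. of_nat (Suc k) * symbol k (\<lambda>w. c (a # w)) p)"
  using assms
proof (induction k arbitrary: c)
  case 0
  have sm: "smooth (symbol 0 (\<lambda>w. c (b # w)))" for b by (rule smooth_symbol) (rule "0.prems")
  have "fib_deriv a (symbol 0 (\<lambda>w. c (b # w))) = (\<lambda>p. 0)" for b
    unfolding fib_deriv_def symbol_0 by (simp add: dir_deriv_fst_compose "0.prems"(1) dir_deriv_at_0)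
  then show ?case
    unfolding symbol_Suc fib_deriv_sum_coord[OF sm] by simp
next
  case (Suc k)
  have sm: "smooth (symbol (Suc k) (\<lambda>w. c (b # w)))" for b by (rule smooth_symbol) (rule Suc.prems)
  have "fib_deriv a (symbol (Suc k) (\<lambda>w. c (b # w)))
      = (\<lambda>p. of_nat (Suc k) * symbol k (\<lambda>w. c (b # a # w)) p)" for b
    by (rule Suc.IH) (rule Suc.prems, rule Suc.prems(2), simp)
  moreover have "(\<lambda>w. c (b # a # w)) = (\<lambda>w. c (a # b # w))" for b
    by (rule ext, rule Suc.prems(2)) simp
  ultimately have IH: "fib_deriv a (symbol (Suc k) (\<lambda>w. c (b # w)))
      = (\<lambda>p. of_nat (Suc k) * symbol k (\<lambda>w. c (a # b # w)) p)" for b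
    by simp
  have "(\<Sum>b\<in>UNIV. fib_coord b p * (of_nat (Suc k) * symbol k (\<lambda>w. c (a # b # w)) p))
      = of_nat (Suc k) * symbol (Suc k) (\<lambda>w. c (a # w)) p" for p
    unfolding symbol_Suc by (simp add: sum_distrib_left mult.left_commute)
  then show ?case
    unfolding symbol_Suc[of "Suc k"] fib_deriv_sum_coord[OF sm] IH by (simp add: algebra_simps)
qed

lemma symbol_eq_0_imp:
  assumes "\<And>w. smooth (c w)" "\<And>w w'. mset w = mset w' \<Longrightarrow> c w = c w'"
    and "symbol k c = (\<lambda>p. 0)" "length u = k"
  shows "c u = (\<lambda>z. 0)"
  using assms
proof (induction k arbitrary: c u)
  case 0
  have "c [] z = 0" for z using fun_cong[OF "0.prems"(3), of "(z, 0)"] by (simp add: symbol_0)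
  then show ?case using "0.prems"(4) by auto
next
  case (Suc k)
  obtain a w where u: "u = a # w" "length w = k" using Suc.prems(4) by (auto simp: length_Suc_conv)
  have "fib_deriv a (symbol (Suc k) c) = (\<lambda>p. 0)"
    unfolding Suc.prems(3) by (simp add: fib_deriv_def dir_deriv_zero)
  then have "(\<lambda>p. of_nat (Suc k) * symbol k (\<lambda>w. c (a # w)) p) = (\<lambda>p. 0)"
    by (simp only: fib_deriv_symbol[OF Suc.prems(1,2)])
  then have "symbol k (\<lambda>w. c (a # w)) = (\<lambda>p. 0)"
    by (simp add: fun_eq_iff del: of_nat_Suc)
  then show ?case
    unfolding u(1)
    by (intro Suc.IH[of "\<lambda>w. c (a # w)", OF _ _ _ u(2)]) (rule Suc.prems(1), rule Suc.prems(2), simp)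
qed

lemma transport_symbol:
  assumes "\<And>w. smooth (c w)"
  shows "transport (symbol k c) (z, \<xi>)
    = (\<Sum>a\<in>UNIV. complex_of_real (\<xi> $ a) * symbol k (\<lambda>w. partial_x a (c w)) (z, \<xi>))"
proof -
  have "pos_deriv a (symbol k c) = symbol k (\<lambda>w. partial_x a (c w))" for a
    using assms
  proof (induction k arbitrary: c)
    case 0
    then show ?case
      by (simp add: pos_deriv_def symbol_0 dir_deriv_fst_compose partial_x_def)
  next
    case (Suc k)
    have sm: "smooth (symbol k (\<lambda>w. c (b # w)))" for b by (rule smooth_symbol) (rule Suc.prems)
    have IH: "pos_deriv a (symbol k (\<lambda>w. c (b # w))) = symbol k (\<lambda>w. partial_x a (c (b # w)))" for b
      by (rule Suc.IH) (rule Suc.prems)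
    have "pos_deriv a (symbol (Suc k) c)
        = (\<lambda>p. \<Sum>b\<in>UNIV. pos_deriv a (\<lambda>p. fib_coord b p * symbol k (\<lambda>w. c (b # w)) p) p)"
      unfolding symbol_Suc pos_deriv_def
      by (rule dir_deriv_sum) (rule smooth_mult[OF smooth_fib_coord sm])
    also have "\<dots> = (\<lambda>p. \<Sum>b\<in>UNIV. fib_coord b p * pos_deriv a (symbol k (\<lambda>w. c (b # w))) p)"
      unfolding pos_deriv_def
      by (subst dir_deriv_mult_smooth[OF smooth_fib_coord sm])
         (simp add: pos_deriv_fib_coord[unfolded pos_deriv_def])
    finally show ?case unfolding IH symbol_Suc .
  qed
  then show ?thesis by (simp add: transport_def fib_coord_def)
qed

text \<open>
  After \<open>k\<close> derivatives in the covector a homogeneous symbol of degree \<open>k\<close> has become a single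
  coefficient, at the cost of \<open>k\<close> further powers of the transport operator.
\<close>

lemma transport_pow_symbol_eq_0_imp:
  assumes "\<And>w. smooth (c w)" "\<And>w w'. mset w = mset w' \<Longrightarrow> c w = c w'"
    and "(transport ^^ m) (symbol k c) = (\<lambda>p. 0)" "length u = k"
  shows "(transport ^^ (m + k)) (\<lambda>p. c u (fst p)) = (\<lambda>p. 0)"
  using assms
proof (induction k arbitrary: c u m)
  case 0
  show ?case using "0.prems"(3,4) by (simp add: symbol_0)
next
  case (Suc k)
  obtain a w where u: "u = a # w" "length w = k" using Suc.prems(4) by (auto simp: length_Suc_conv)
  have sm: "smooth (symbol k (\<lambda>w. c (a # w)))" by (rule smooth_symbol) (rule Suc.prems)
  have "(transport ^^ Suc m) (fib_deriv a (symbol (Suc k) c)) = (\<lambda>p. 0)"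
    by (rule transport_pow_fib_deriv_eq_0[OF smooth_symbol[OF Suc.prems(1)] Suc.prems(3)])
  then have "(\<lambda>p. of_nat (Suc k) * (transport ^^ Suc m) (symbol k (\<lambda>w. c (a # w))) p) = (\<lambda>p. 0)"
    by (simp only: fib_deriv_symbol[OF Suc.prems(1,2)] transport_pow_cmult[OF sm])
  then have "(transport ^^ Suc m) (symbol k (\<lambda>w. c (a # w))) = (\<lambda>p. 0)"
    by (simp add: fun_eq_iff del: of_nat_Suc funpow.simps)
  then have "(transport ^^ (Suc m + k)) (\<lambda>p. c (a # w) (fst p)) = (\<lambda>p. 0)"
    by (intro Suc.IH[of "\<lambda>w. c (a # w)", OF _ _ _ u(2)]) (rule Suc.prems(1), rule Suc.prems(2), simp)
  then show ?case by (simp add: u(1))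
qed

lemma dir_deriv_spatial:
  fixes \<xi> :: "real ^ 'n::finite"
  assumes "smooth g"
  shows "dir_deriv (\<xi>, 0) g z = (\<Sum>a\<in>UNIV. complex_of_real (\<xi> $ a) * partial_x a g z)"
proof -
  note lin = has_derivative_linear[OF smooth_has_derivative[OF assms], of z]
  have "(\<xi>, 0 :: real) = (\<Sum>a\<in>UNIV. \<xi> $ a *\<^sub>R (axis a 1, 0))"
    by (rule prod_eqI) (simp_all add: fst_sum snd_sum vec_eq_iff axis_def if_distrib cong: if_cong)
  then have "dir_deriv (\<xi>, 0) g z = (\<Sum>a\<in>UNIV. \<xi> $ a *\<^sub>R dir_deriv (axis a 1, 0) g z)"
    by (simp only: linear_sum[OF lin] linear_cmul[OF lin])
  then show ?thesis by (simp add: partial_x_def scaleR_conv_of_real)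
qed

text \<open>
  On functions of position alone, with the covector \<open>\<xi>\<close> fixed, the powers of the transport operator are
  iterated directional derivatives along \<open>\<xi>\<close>.
\<close>

lemma transport_pow_at:
  fixes \<xi> :: "real ^ 'n::finite"
  assumes "smooth F"
  shows "(\<lambda>z. (transport ^^ m) F (z, \<xi>)) = ((dir_deriv (\<xi>, 0)) ^^ m) (\<lambda>z. F (z, \<xi>))"
proof (induction m)
  case (Suc m)
  let ?G = "(transport ^^ m) F"
  have G: "smooth ?G" by (rule smooth_transport_pow[OF assms])
  have sG: "smooth (\<lambda>z. ?G (z, \<xi>))"
    using smooth_compose_affine[OF bounded_linear_ident bounded_linear_embed_pos G, of "(0, \<xi>)"] by simp
  have "partial_x a (\<lambda>z. ?G (z, \<xi>)) z = pos_deriv a ?G (z, \<xi>)" for a z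
    using dir_deriv_compose_affine(1)[OF bounded_linear_ident bounded_linear_embed_pos
        smooth_differentiable[OF G], where d = "(0, \<xi>)" and v = "(axis a 1, 0)" and z = z]
    by (simp add: partial_x_def pos_deriv_def)
  then have "(\<lambda>z. transport ?G (z, \<xi>)) = dir_deriv (\<xi>, 0) (\<lambda>z. ?G (z, \<xi>))"
    by (simp add: transport_def fib_coord_def dir_deriv_spatial[OF sG] fun_eq_iff)
  then show ?case using Suc by simp
qed simp

lemma constant_on_line:
  fixes g :: "'a::real_normed_vector \<Rightarrow> complex"
  assumes g: "smooth g" and zero: "\<And>s. dir_deriv u g (z0 + s *\<^sub>R u) = 0"
  shows "g (z0 + s *\<^sub>R u) = g z0"
proof -
  have "((\<lambda>s. g (z0 + s *\<^sub>R u)) has_derivative (\<lambda>r. 0)) (at s)" for s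
  proof -
    have line: "((\<lambda>s. z0 + s *\<^sub>R u) has_derivative (\<lambda>s. s *\<^sub>R u)) (at s)"
      by (intro has_derivative_eq_rhs[OF has_derivative_add[OF has_derivative_const
            has_derivative_scaleR_left[OF has_derivative_ident]]]) simp
    have "dir_deriv (r *\<^sub>R u) g (z0 + s *\<^sub>R u) = 0" for r
      using linear_cmul[OF has_derivative_linear[OF smooth_has_derivative[OF g]]] zero by simp
    then show ?thesis
      using diff_chain_at[OF line smooth_has_derivative[OF g]] by (simp add: o_def)
  qed
  then have "\<exists>c. \<forall>s\<in>UNIV. g (z0 + s *\<^sub>R u) = c"
    by (intro has_derivative_zero_constant) auto
  then have "g (z0 + s *\<^sub>R u) = g (z0 + 0 *\<^sub>R u)" by (metis UNIV_I)
  then show ?thesis by simp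
qed

lemma vanishes_on_line:
  fixes g :: "'a::real_normed_vector \<Rightarrow> complex"
  assumes "smooth g" "((dir_deriv u) ^^ k) g = (\<lambda>z. 0)"
    and "\<And>j. j < k \<Longrightarrow> ((dir_deriv u) ^^ j) g z0 = 0"
  shows "g (z0 + s *\<^sub>R u) = 0"
  using assms
proof (induction k arbitrary: g s)
  case (Suc k)
  have "dir_deriv u g (z0 + s *\<^sub>R u) = 0" for s
  proof (rule Suc.IH)
    show "smooth (dir_deriv u g)" by (rule smooth_dir_deriv[OF Suc.prems(1)])
    show "((dir_deriv u) ^^ k) (dir_deriv u g) = (\<lambda>z. 0)"
      using Suc.prems(2) by (simp add: funpow_Suc_right del: funpow.simps)
    show "((dir_deriv u) ^^ j) (dir_deriv u g) z0 = 0" if "j < k" for j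
      using Suc.prems(3)[of "Suc j"] that by (simp add: funpow_Suc_right del: funpow.simps)
  qed
  then have "g (z0 + s *\<^sub>R u) = g z0" by (rule constant_on_line[OF Suc.prems(1)])
  then show ?case using Suc.prems(3)[of 0] by simp
qed simp

lemma dir_deriv_pow_at_0:
  fixes \<xi> :: "real ^ 'n::finite"
  assumes "smooth g" "\<And>v. length v \<le> j \<Longrightarrow> partial_word v g z0 = 0"
  shows "((dir_deriv (\<xi>, 0)) ^^ j) g z0 = 0"
  using assms
proof (induction j arbitrary: g)
  case 0
  then show ?case using "0.prems"(2)[of "[]"] by simp
next
  case (Suc j)
  have comm: "partial_word v (dir_deriv (\<xi>, 0) g) = dir_deriv (\<xi>, 0) (partial_word v g)" for v
  proof (induction v)
    case (Cons a v)
    then show ?case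
      unfolding foldr.simps o_apply partial_x_def[of a]
      by (subst dir_deriv_commute[OF smooth_partial_word[OF Suc.prems(1)]]) simp
  qed simp
  have "((dir_deriv (\<xi>, 0)) ^^ j) (dir_deriv (\<xi>, 0) g) z0 = 0"
  proof (rule Suc.IH)
    show "smooth (dir_deriv (\<xi>, 0) g)" by (rule smooth_dir_deriv[OF Suc.prems(1)])
    fix v :: "'n list" assume v: "length v \<le> j"
    have "partial_x a (partial_word v g) z0 = 0" for a
      using Suc.prems(2)[of "a # v"] v by simp
    then show "partial_word v (dir_deriv (\<xi>, 0) g) z0 = 0"
      unfolding comm dir_deriv_spatial[OF smooth_partial_word[OF Suc.prems(1)]] by simp
  qed
  then show ?case by (simp add: funpow_Suc_right del: funpow.simps)
qed

text \<open>
  A function with \<open>(\<xi>\<cdot>\<partial>)\<^sup>k g = 0\<close> for all \<open>\<xi>\<close> is a polynomial of degree less than \<open>k\<close> on every line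
  through the origin, so its derivatives of order less than \<open>k\<close> at the origin determine it. The time
  variable is a parameter.
\<close>

lemma transport_kernel_determined_by_jet:
  fixes g :: "'n::finite stfun"
  assumes g: "smooth g" and T: "(transport ^^ k) (\<lambda>p. g (fst p)) = (\<lambda>p. 0)"
    and jet: "\<And>v t. length v < k \<Longrightarrow> partial_word v g (0, t) = 0"
  shows "g = (\<lambda>z. 0)"
proof
  fix z :: "(real ^ 'n) \<times> real"
  obtain \<xi> t where z: "z = (\<xi>, t)" by (cases z)
  have "((dir_deriv (\<xi>, 0)) ^^ k) g = (\<lambda>z. 0)"
    using transport_pow_at[OF smooth_fst_compose[OF g], of k \<xi>] T by simp
  moreover have "((dir_deriv (\<xi>, 0)) ^^ j) g (0, t) = 0" if "j < k" for j
    by (rule dir_deriv_pow_at_0[OF g]) (use jet that in auto)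
  ultimately have "g ((0, t) + 1 *\<^sub>R (\<xi>, 0)) = 0"
    by (rule vanishes_on_line[OF g])
  then show "g z = 0" by (simp add: z)
qed

section \<open>Operators all of whose iterated commutators have bounded order\<close>

lemma symmetric_smoothD:
  "symmetric_smooth c \<Longrightarrow> smooth (c w)" "symmetric_smooth c \<Longrightarrow> mset w = mset w' \<Longrightarrow> c w = c w'"
  unfolding symmetric_smooth_def by blast+

lemma symmetric_smoothI:
  "(\<And>w. smooth (c w)) \<Longrightarrow> (\<And>w w'. mset w = mset w' \<Longrightarrow> c w = c w') \<Longrightarrow> symmetric_smooth c"
  unfolding symmetric_smooth_def by blast

text \<open>
  The operators \<open>D\<^sub>0\<close>, \<open>[H, D\<^sub>0]\<close>, \<open>[H, [H, D\<^sub>0]]\<close>, \<open>\<dots>\<close>, given by their coefficients, all of order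
  less than \<open>k\<close>. In general the \<open>j\<close>-th one would have order \<open>j\<close> more than \<open>D\<^sub>0\<close>; the uniform bound is
  the strong condition.
\<close>

definition commutator_chain ::
    "('n::finite \<Rightarrow> 'n stfun) \<Rightarrow> 'n stfun \<Rightarrow> nat \<Rightarrow> (nat \<Rightarrow> 'n list \<Rightarrow> 'n stfun) \<Rightarrow> bool" where
  "commutator_chain p v k \<beta> \<longleftrightarrow> (\<forall>j. symmetric_smooth (\<beta> j)) \<and>
     (\<forall>j \<psi> z. smooth \<psi> \<longrightarrow> spatial_op p v (diff_op k (\<beta> j) \<psi>) z
        - diff_op k (\<beta> j) (spatial_op p v \<psi>) z = diff_op k (\<beta> (Suc j)) \<psi> z)"

lemma commutator_chainI:
  assumes "\<And>j. symmetric_smooth (\<beta> j)"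
    and "\<And>j \<psi> z. smooth \<psi> \<Longrightarrow> spatial_op p v (diff_op k (\<beta> j) \<psi>) z
        - diff_op k (\<beta> j) (spatial_op p v \<psi>) z = diff_op k (\<beta> (Suc j)) \<psi> z"
  shows "commutator_chain p v k \<beta>"
  unfolding commutator_chain_def using assms by blast

lemma commutator_chainD:
  assumes "commutator_chain p v k \<beta>"
  shows "symmetric_smooth (\<beta> j)"
    and "smooth \<psi> \<Longrightarrow> spatial_op p v (diff_op k (\<beta> j) \<psi>) z
        - diff_op k (\<beta> j) (spatial_op p v \<psi>) z = diff_op k (\<beta> (Suc j)) \<psi> z"
  using assms unfolding commutator_chain_def by blast+

lemma chain_smooth: "commutator_chain p v k \<beta> \<Longrightarrow> smooth (\<beta> j w)"
  by (rule symmetric_smoothD(1)[OF commutator_chainD(1)])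

text \<open>
  Each commutator applies minus the transport operator to the leading symbol. Starting at order
  \<open>r\<close>, the bound is reached after \<open>k - 1 - r\<close> steps, and the following step must give \<open>0\<close>.
\<close>

lemma chain_leading_symbol:
  assumes p: "\<And>a. smooth (p a)" and v: "smooth v" and chain: "commutator_chain p v k \<beta>"
    and r: "r < k" "\<And>w. r < length w \<Longrightarrow> length w < k \<Longrightarrow> \<beta> 0 w = (\<lambda>z. 0)"
  shows "(transport ^^ (k - r)) (symbol r (\<beta> 0)) = (\<lambda>p. 0)"
proof -
  have sym: "symmetric_smooth (\<beta> j)" for j using chain by (simp add: commutator_chain_def)
  note sm = symmetric_smoothD(1)[OF sym] and perm = symmetric_smoothD(2)[OF sym]
  have comm: "spatial_op p v (diff_op k (\<beta> j) \<psi>) z - diff_op k (\<beta> j) (spatial_op p v \<psi>) z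
      = diff_op k (\<beta> (Suc j)) \<psi> z" if "smooth \<psi>" for j \<psi> z
    using chain that unfolding commutator_chain_def by blast
  \<comment> \<open>The \<open>i\<close>-th operator of the chain has order at most \<open>r + i\<close>, with a known symbol of that order.\<close>
  have step: "(\<forall>w. r + i < length w \<longrightarrow> length w < k \<longrightarrow> \<beta> i w = (\<lambda>z. 0)) \<and>
      symbol (r + i) (\<beta> i) = (\<lambda>p. (- 1) ^ i * (transport ^^ i) (symbol r (\<beta> 0)) p)"
    if "r + i < k" for i
    using that
  proof (induction i)
    case 0
    then show ?case using r(2) by simp
  next
    case (Suc i)
    then have i: "r + i < k" "Suc (r + i) < k" by auto
    have top: "\<beta> i w = (\<lambda>z. 0)" if "r + i < length w" "length w < k" for w
      using Suc.IH[OF i(1)] that by blast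
    have symb: "symbol (r + i) (\<beta> i) = (\<lambda>p. (- 1) ^ i * (transport ^^ i) (symbol r (\<beta> 0)) p)"
      using Suc.IH[OF i(1)] by blast
    have "symbol j (\<beta> (Suc i)) = (\<lambda>p. 0)" if "Suc (r + i) < j" "j < k" for j
    proof
      fix q show "symbol j (\<beta> (Suc i)) q = 0"
        using commutator_symbol(1)[OF p v sm comm i(1) top that, where \<xi> = "snd q" and z = "fst q"] by simp
    qed
    then have "\<beta> (Suc i) w = (\<lambda>z. 0)" if "Suc (r + i) < length w" "length w < k" for w
      using that by (intro symbol_eq_0_imp[where c = "\<beta> (Suc i)", OF sm perm _ refl])
    moreover have "symbol (Suc (r + i)) (\<beta> (Suc i))
        = (\<lambda>p. (- 1) ^ Suc i * (transport ^^ Suc i) (symbol r (\<beta> 0)) p)"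
    proof
      fix q
      have "transport (symbol (r + i) (\<beta> i)) q = - symbol (Suc (r + i)) (\<beta> (Suc i)) q"
        using commutator_symbol(2)[OF p v sm comm i(1) top, where \<xi> = "snd q" and z = "fst q"] i(2)
          transport_symbol[where k = "r + i" and c = "\<beta> i" and z = "fst q" and \<xi> = "snd q", OF sm] by simp
      then show "symbol (Suc (r + i)) (\<beta> (Suc i)) q
          = (- 1) ^ Suc i * (transport ^^ Suc i) (symbol r (\<beta> 0)) q"
        unfolding symb transport_cmult[OF smooth_transport_pow[OF smooth_symbol[OF sm]]]
        by (simp add: equation_minus_iff)
    qed
    ultimately show ?case by simp
  qed
  obtain i where i: "k = Suc (r + i)" using r(1) less_iff_Suc_add by auto
  then have top: "\<beta> i w = (\<lambda>z. 0)" if "r + i < length w" "length w < k" for w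
    using step[of i] that by blast
  have symb: "symbol (r + i) (\<beta> i) = (\<lambda>p. (- 1) ^ i * (transport ^^ i) (symbol r (\<beta> 0)) p)"
    using step[of i] i by blast
  have "(transport ^^ Suc i) (symbol r (\<beta> 0)) q = 0" for q
  proof -
    have "transport (symbol (r + i) (\<beta> i)) q = 0"
      using commutator_symbol(2)[OF p v sm comm _ top, where \<xi> = "snd q" and z = "fst q"] i
        transport_symbol[where k = "r + i" and c = "\<beta> i" and z = "fst q" and \<xi> = "snd q", OF sm] by simp
    then show ?thesis
      unfolding symb transport_cmult[OF smooth_transport_pow[OF smooth_symbol[OF sm]]] by simp
  qed
  then have "(transport ^^ Suc i) (symbol r (\<beta> 0)) = (\<lambda>p. 0)" by (rule ext)
  then show ?thesis using i by simp
qed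

text \<open>
  This is the finite-dimensionality statement: finitely many numbers determine the first
  operator of a chain with time-independent coefficients. The coefficients are shown to vanish
  from the top order downwards; at each order \<open>r\<close>, the \<open>k - r\<close> powers of the transport
  operator that annihilate the symbol and the \<open>r\<close> powers lost in passing to a coefficient add up to \<open>k\<close>.
\<close>

lemma chain_determined_by_jet:
  assumes p: "\<And>a. smooth (p a)" and v: "smooth v" and chain: "commutator_chain p v k \<beta>"
    and jet: "\<And>u w t. length u < k \<Longrightarrow> length w < k \<Longrightarrow> partial_word u (\<beta> 0 w) (0, t) = 0"
    and w: "length w < k"
  shows "\<beta> 0 w = (\<lambda>z. 0)"
proof -
  have sym: "symmetric_smooth (\<beta> j)" for j using chain by (simp add: commutator_chain_def)
  note sm = symmetric_smoothD(1)[OF sym] and perm = symmetric_smoothD(2)[OF sym]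
  have "\<forall>w. k - n \<le> length w \<longrightarrow> length w < k \<longrightarrow> \<beta> 0 w = (\<lambda>z. 0)" for n
  proof (induction n)
    case (Suc n)
    show ?case
    proof (intro allI impI)
      fix w :: "'a list" assume w: "k - Suc n \<le> length w" "length w < k"
      show "\<beta> 0 w = (\<lambda>z. 0)"
      proof (cases "k - n \<le> length w")
        case True
        then show ?thesis using Suc w by blast
      next
        case False
        then have top: "\<beta> 0 w' = (\<lambda>z. 0)" if "length w < length w'" "length w' < k" for w'
        proof -
          have "k - n \<le> length w'" using w(1) that(1) by arith
          then show ?thesis using Suc that(2) by blast
        qed
        have "(transport ^^ (k - length w + length w)) (\<lambda>p. \<beta> 0 w (fst p)) = (\<lambda>p. 0)"
          by (rule transport_pow_symbol_eq_0_imp[OF sm perm chain_leading_symbol[OF p v chain w(2) top] refl])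
        then have "(transport ^^ k) (\<lambda>p. \<beta> 0 w (fst p)) = (\<lambda>p. 0)" using w by simp
        then show ?thesis
          by (rule transport_kernel_determined_by_jet[OF sm]) (rule jet[OF _ w(2)])
      qed
    qed
  qed simp
  from this[of k] w show ?thesis by simp
qed

section \<open>Restriction to a fixed time\<close>

text \<open>
  A symmetry operator at a fixed time is regarded again as an operator on functions of space and
  time, by extending its coefficients constantly in time.
\<close>

definition freeze :: "real \<Rightarrow> 'n::finite stfun \<Rightarrow> 'n stfun" where
  "freeze t f = (\<lambda>z. f (fst z, t))"

definition stationary :: "'n::finite stfun \<Rightarrow> bool" where
  "stationary f \<longleftrightarrow> (\<forall>t. freeze t f = f)"

lemma freeze_freeze [simp]: "freeze t (freeze t' f) = freeze t' f"
  by (simp add: freeze_def)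

lemma stationary_freeze: "stationary (freeze t f)"
  by (simp add: stationary_def)

lemma bounded_linear_forget_time:
  "bounded_linear (\<lambda>z :: (real ^ 'n::finite) \<times> real. (fst z, 0 :: real))"
  by (intro bounded_linear_Pair bounded_linear_fst bounded_linear_zero)

lemma smooth_freeze: "smooth f \<Longrightarrow> smooth (freeze t f)"
  using smooth_compose_affine[OF bounded_linear_ident bounded_linear_forget_time, of f "(0, t)"]
  by (simp add: freeze_def)

lemma partial_x_freeze: "smooth f \<Longrightarrow> partial_x a (freeze t f) = freeze t (partial_x a f)"
  using dir_deriv_compose_affine(1)[OF bounded_linear_ident bounded_linear_forget_time
      smooth_differentiable, where f = f and d = "(0, t)" and v = "(axis a 1, 0)"]
  by (simp add: freeze_def partial_x_def fun_eq_iff)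

lemma partial_word_freeze:
  "smooth f \<Longrightarrow> partial_word w (freeze t f) = freeze t (partial_word w f)"
  by (induction w) (simp_all add: partial_x_freeze smooth_partial_word)

lemma freeze_diff_op:
  "smooth \<psi> \<Longrightarrow> freeze t (diff_op k c \<psi>) = diff_op k (\<lambda>w. freeze t (c w)) (freeze t \<psi>)"
  by (simp add: diff_op_def partial_word_freeze) (simp add: freeze_def)

lemma freeze_spatial_op:
  assumes "\<And>a. stationary (p a)" "stationary v" "smooth \<psi>"
  shows "freeze t (spatial_op p v \<psi>) = spatial_op p v (freeze t \<psi>)"
proof -
  have "freeze t (p a) z = p a z" "freeze t v z = v z" for a z
    using assms(1,2) by (simp_all add: stationary_def)
  then show ?thesis
    by (simp add: spatial_op_def partial_x_freeze smooth_partial_x assms(3))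
       (simp add: freeze_def)
qed

lemma partial_t_stationary:
  fixes f :: "'n::finite stfun"
  assumes "stationary f" "smooth f"
  shows "partial_t f = (\<lambda>z. 0)"
proof
  fix z :: "(real ^ 'n) \<times> real"
  have "partial_t (freeze 0 f) z = dir_deriv 0 f (fst z, 0)"
    using dir_deriv_compose_affine(1)[OF bounded_linear_ident bounded_linear_forget_time
        smooth_differentiable[OF assms(2)], where z = z and d = 0 and v = "(0, 1)"]
    by (simp add: freeze_def partial_t_def zero_prod_def)
  then show "partial_t f z = 0"
    using assms(1) by (simp add: stationary_def dir_deriv_at_0[OF assms(2)])
qed

lemma smooth_partial_t: "smooth \<psi> \<Longrightarrow> smooth (partial_t \<psi>)"
  by (simp add: partial_t_def smooth_dir_deriv)

lemma partial_t_mult: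
  "smooth \<psi> \<Longrightarrow> smooth \<phi> \<Longrightarrow>
    partial_t (\<lambda>z. \<psi> z * \<phi> z) = (\<lambda>z. partial_t \<psi> z * \<phi> z + \<psi> z * partial_t \<phi> z)"
  unfolding partial_t_def by (rule dir_deriv_mult_smooth)

lemma partial_word_partial_t:
  "smooth \<psi> \<Longrightarrow> partial_word w (partial_t \<psi>) = partial_t (partial_word w \<psi>)"
proof (induction w)
  case (Cons a w)
  then show ?case
    unfolding foldr.simps o_apply partial_x_def[of a] partial_t_def
    by (subst dir_deriv_commute[OF smooth_partial_word[OF Cons.prems]]) simp
qed simp

lemma partial_t_partial_x: "smooth \<psi> \<Longrightarrow> partial_t (partial_x a \<psi>) = partial_x a (partial_t \<psi>)"
  using partial_word_partial_t[of \<psi> "[a]"] by simp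

lemma partial_t_diff_op:
  assumes "\<And>w. smooth (c w)" "smooth \<psi>"
  shows "partial_t (diff_op k c \<psi>)
    = (\<lambda>z. diff_op k (\<lambda>w. partial_t (c w)) \<psi> z + diff_op k c (partial_t \<psi>) z)"
proof -
  have "partial_t (diff_op k c \<psi>)
      = (\<lambda>z. \<Sum>w | length w < k. partial_t (\<lambda>z. c w z * partial_word w \<psi> z) z)"
    unfolding diff_op_def partial_t_def
    by (rule dir_deriv_sum) (rule smooth_mult[OF assms(1) smooth_partial_word[OF assms(2)]])
  then show ?thesis
    by (simp add: partial_t_mult[OF assms(1) smooth_partial_word[OF assms(2)]] diff_op_def
        partial_word_partial_t[OF assms(2)] sum.distrib)
qed

lemma partial_t_spatial_op:
  assumes p: "\<And>a. smooth (p a)" "\<And>a. stationary (p a)" and v: "smooth v" "stationary v"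
    and \<psi>: "smooth \<psi>"
  shows "partial_t (spatial_op p v \<psi>) = spatial_op p v (partial_t \<psi>)"
proof -
  have \<psi>': "smooth (partial_x a \<psi>)" "smooth (partial_x a (partial_x a \<psi>))" for a
    by (intro smooth_partial_x \<psi>)+
  have drift: "smooth (\<lambda>z. p a z * partial_x a \<psi> z)" for a by (rule smooth_mult[OF p(1) \<psi>'(1)])
  have kin: "smooth (\<lambda>z. - (1 / 2) * (\<Sum>a\<in>UNIV. partial_x a (partial_x a \<psi>) z))"
    by (intro smooth_mult smooth_const smooth_sum \<psi>')
  have "partial_t (spatial_op p v \<psi>)
    = (\<lambda>z. partial_t (\<lambda>z. - (1 / 2) * (\<Sum>a\<in>UNIV. partial_x a (partial_x a \<psi>) z)) z
      + (partial_t (\<lambda>z. \<Sum>a\<in>UNIV. p a z * partial_x a \<psi> z) z + partial_t (\<lambda>z. v z * \<psi> z) z))"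
    unfolding spatial_op_def partial_t_def
    by (simp only: dir_deriv_add_smooth[OF kin smooth_add[OF smooth_sum[OF drift] smooth_mult[OF v(1) \<psi>]]]
        dir_deriv_add_smooth[OF smooth_sum[OF drift] smooth_mult[OF v(1) \<psi>]])
  also have "partial_t (\<lambda>z. v z * \<psi> z) = (\<lambda>z. v z * partial_t \<psi> z)"
    by (simp add: partial_t_mult v \<psi> partial_t_stationary)
  also have "partial_t (\<lambda>z. \<Sum>a\<in>UNIV. p a z * partial_x a \<psi> z)
      = (\<lambda>z. \<Sum>a\<in>UNIV. partial_t (\<lambda>z. p a z * partial_x a \<psi> z) z)"
    unfolding partial_t_def by (rule dir_deriv_sum[OF drift])
  also have "(\<lambda>z. \<Sum>a\<in>UNIV. partial_t (\<lambda>z. p a z * partial_x a \<psi> z) z)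
      = (\<lambda>z. \<Sum>a\<in>UNIV. p a z * partial_x a (partial_t \<psi>) z)"
    by (simp add: partial_t_mult[OF p(1) \<psi>'(1)] partial_t_stationary[OF p(2,1)] partial_t_partial_x[OF \<psi>])
  also have "partial_t (\<lambda>z. - (1 / 2) * (\<Sum>a\<in>UNIV. partial_x a (partial_x a \<psi>) z))
      = (\<lambda>z. - (1 / 2) * partial_t (\<lambda>z. \<Sum>a\<in>UNIV. partial_x a (partial_x a \<psi>) z) z)"
    unfolding partial_t_def by (rule dir_deriv_cmult[OF smooth_sum[OF \<psi>'(2)]])
  also have "partial_t (\<lambda>z. \<Sum>a\<in>UNIV. partial_x a (partial_x a \<psi>) z)
      = (\<lambda>z. \<Sum>a\<in>UNIV. partial_t (partial_x a (partial_x a \<psi>)) z)"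
    unfolding partial_t_def by (rule dir_deriv_sum[OF \<psi>'(2)])
  also have "\<dots> = (\<lambda>z. \<Sum>a\<in>UNIV. partial_x a (partial_x a (partial_t \<psi>)) z)"
    by (simp add: partial_t_partial_x[OF \<psi>'(1)] partial_t_partial_x[OF \<psi>])
  finally show ?thesis by (simp add: spatial_op_def)
qed

lemma spatial_op_combination:
  fixes f :: "'a \<Rightarrow> 'n::finite stfun"
  assumes f: "\<And>i. i \<in> I \<Longrightarrow> smooth (f i)"
  shows "spatial_op p v (\<lambda>z. \<Sum>i\<in>I. c i * f i z) = (\<lambda>z. \<Sum>i\<in>I. c i * spatial_op p v (f i) z)"
proof -
  have d: "partial_x a (\<lambda>z. \<Sum>i\<in>I. c i * g i z) = (\<lambda>z. \<Sum>i\<in>I. c i * partial_x a (g i) z)"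
    if "\<And>i. i \<in> I \<Longrightarrow> smooth (g i)" for a and g :: "'a \<Rightarrow> 'n stfun"
    by (subst partial_x_sum)
       (auto intro!: sum.cong smooth_mult smooth_const that simp: partial_x_cmult that)
  have 1: "(\<Sum>a\<in>UNIV. \<Sum>i\<in>I. c i * partial_x a (partial_x a (f i)) z)
      = (\<Sum>i\<in>I. c i * (\<Sum>a\<in>UNIV. partial_x a (partial_x a (f i)) z))" for z
    by (subst sum.swap) (simp add: sum_distrib_left)
  have 2: "(\<Sum>a\<in>UNIV. p a z * (\<Sum>i\<in>I. c i * partial_x a (f i) z))
      = (\<Sum>i\<in>I. c i * (\<Sum>a\<in>UNIV. p a z * partial_x a (f i) z))" for z
    unfolding sum_distrib_left by (subst sum.swap) (simp add: mult.left_commute)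
  have pull: "m * (\<Sum>i\<in>I. c i * g i) = (\<Sum>i\<in>I. c i * (m * g i))" for m and g :: "'a \<Rightarrow> complex"
    by (simp add: sum_distrib_left mult.left_commute)
  have d1: "partial_x a (\<lambda>z. \<Sum>i\<in>I. c i * f i z) = (\<lambda>z. \<Sum>i\<in>I. c i * partial_x a (f i) z)" for a
    by (rule d) (rule f)
  have d2: "partial_x a (\<lambda>z. \<Sum>i\<in>I. c i * partial_x a (f i) z)
      = (\<lambda>z. \<Sum>i\<in>I. c i * partial_x a (partial_x a (f i)) z)" for a
    by (rule d) (rule smooth_partial_x[OF f])
  show ?thesis
    unfolding spatial_op_def d1 d2 1 2 by (simp only: distrib_left sum.distrib pull)
qed

lemma spatial_op_time_factor:
  assumes "smooth \<tau>" "\<And>a. partial_x a \<tau> = (\<lambda>z. 0)" "smooth \<psi>"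
  shows "spatial_op p v (\<lambda>z. \<tau> z * \<psi> z) = (\<lambda>z. \<tau> z * spatial_op p v \<psi> z)"
proof -
  have d: "partial_x a (\<lambda>z. \<tau> z * \<phi> z) = (\<lambda>z. \<tau> z * partial_x a \<phi> z)" if "smooth \<phi>" for a \<phi>
    by (simp add: partial_x_mult assms that)
  show ?thesis
    unfolding spatial_op_def d[OF assms(3)] d[OF smooth_partial_x[OF assms(3)]]
    by (simp add: distrib_left sum_distrib_left mult.left_commute)
qed

text \<open>
  \<open>H\<close> commutes with restriction to a fixed time. At the time \<open>s\<close> of the given point, \<open>\<psi>\<close> may be replaced
  by its constant extension \<open>\<phi>\<close> from time \<open>s\<close>; the original chain is then evaluated on \<open>\<phi>\<close> at time \<open>t\<close>,
  where it has the frozen coefficients.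
\<close>

lemma chain_freeze:
  assumes p: "\<And>a. smooth (p a)" "\<And>a. stationary (p a)" and v: "smooth v" "stationary v"
    and chain: "commutator_chain p v k \<beta>"
  shows "commutator_chain p v k (\<lambda>j w. freeze t (\<beta> j w))"
proof (rule commutator_chainI)
  note sm = chain_smooth[OF chain]
  show "symmetric_smooth (\<lambda>w. freeze t (\<beta> j w))" for j
    by (rule symmetric_smoothI, rule smooth_freeze[OF sm])
       (rule arg_cong[OF symmetric_smoothD(2)[OF commutator_chainD(1)[OF chain]]])
  fix j and \<psi> :: "'a stfun" and z :: "(real ^ 'a) \<times> real"
  assume \<psi>: "smooth \<psi>"
  let ?H = "spatial_op p v" and ?D = "\<lambda>j. diff_op k (\<beta> j)"
  let ?F = "\<lambda>j. diff_op k (\<lambda>w. freeze t (\<beta> j w))"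
  define \<phi> where "\<phi> = freeze (snd z) \<psi>"
  have \<phi>: "smooth \<phi>" unfolding \<phi>_def by (rule smooth_freeze[OF \<psi>])
  have z: "freeze (snd z) f z = f z" for f by (simp add: freeze_def)
  have H\<psi>: "smooth (?H \<psi>)" "smooth (?H \<phi>)" by (rule smooth_spatial_op[OF p(1) v(1)], fact)+
  have F: "freeze s (?F j \<theta>) = ?F j (freeze s \<theta>)" if "smooth \<theta>" for s \<theta> j
    by (simp add: freeze_diff_op that)
  have D: "freeze t (?D j \<theta>) = ?F j (freeze t \<theta>)" if "smooth \<theta>" for \<theta> j
    by (simp add: freeze_diff_op that)
  have H: "freeze s (?H \<theta>) = ?H (freeze s \<theta>)" if "smooth \<theta>" for s \<theta>
    by (rule freeze_spatial_op[OF p(2) v(2) that])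
  have t\<phi>: "freeze t \<phi> = \<phi>" by (simp add: \<phi>_def)
  have sF: "smooth (?F j \<psi>)" by (intro smooth_diff_op smooth_freeze sm \<psi>)
  have sD: "smooth (?D j \<phi>)" by (intro smooth_diff_op sm \<phi>)
  have "?H (?F j \<psi>) z = freeze t (?H (?D j \<phi>)) z"
    using z[of "?H (?F j \<psi>)"] by (simp only: H[OF sF] F[OF \<psi>] \<phi>_def[symmetric] H[OF sD] D[OF \<phi>] t\<phi>)
  moreover have "?F j (?H \<psi>) z = freeze t (?D j (?H \<phi>)) z"
    using z[of "?F j (?H \<psi>)"]
    by (simp only: F[OF H\<psi>(1)] H[OF \<psi>] \<phi>_def[symmetric] D[OF H\<psi>(2)] H[OF \<phi>] t\<phi>)
  moreover have "?F (Suc j) \<psi> z = freeze t (?D (Suc j) \<phi>) z"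
    using z[of "?F (Suc j) \<psi>"] by (simp only: F[OF \<psi>] \<phi>_def[symmetric] D[OF \<phi>] t\<phi>)
  moreover have "freeze t (?H (?D j \<phi>)) z - freeze t (?D j (?H \<phi>)) z = freeze t (?D (Suc j) \<phi>) z"
    unfolding freeze_def by (rule commutator_chainD(2)[OF chain \<phi>])
  ultimately show "?H (?F j \<psi>) z - ?F j (?H \<psi>) z = ?F (Suc j) \<psi> z" by simp
qed

section \<open>Eigenoperators of the commutator with the Hamiltonian\<close>

lemma diff_op_combination:
  "diff_op k (\<lambda>w z. \<Sum>i\<in>I. c i * \<beta> i w z) \<psi> z = (\<Sum>i\<in>I. c i * diff_op k (\<beta> i) \<psi> z)"
  unfolding diff_op_def sum_distrib_left sum_distrib_right
  by (subst sum.swap) (simp add: mult.assoc)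

lemma chain_combination:
  assumes p: "\<And>a. smooth (p a)" and v: "smooth v" and chain: "commutator_chain p v k \<beta>"
    and I: "finite I"
  shows "commutator_chain p v k (\<lambda>j w z. \<Sum>i\<in>I. c i * \<beta> (i + j) w z)"
proof (rule commutator_chainI)
  note sm = chain_smooth[OF chain]
  show "symmetric_smooth (\<lambda>w z. \<Sum>i\<in>I. c i * \<beta> (i + j) w z)" for j
  proof (rule symmetric_smoothI)
    show "smooth (\<lambda>z. \<Sum>i\<in>I. c i * \<beta> (i + j) w z)" for w
      by (intro smooth_sum smooth_mult smooth_const sm)
    fix w w' :: "'a list" assume "mset w = mset w'"
    then have "\<beta> i w = \<beta> i w'" for i
      by (rule symmetric_smoothD(2)[OF commutator_chainD(1)[OF chain]])
    then show "(\<lambda>z. \<Sum>i\<in>I. c i * \<beta> (i + j) w z) = (\<lambda>z. \<Sum>i\<in>I. c i * \<beta> (i + j) w' z)" by simp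
  qed
  fix j z and \<psi> :: "'a stfun" assume \<psi>: "smooth \<psi>"
  let ?H = "spatial_op p v" and ?D = "\<lambda>j. diff_op k (\<beta> j)"
  have "?H (diff_op k (\<lambda>w z. \<Sum>i\<in>I. c i * \<beta> (i + j) w z) \<psi>) z
      = (\<Sum>i\<in>I. c i * ?H (?D (i + j) \<psi>) z)"
    unfolding diff_op_combination[abs_def]
    by (rule fun_cong[OF spatial_op_combination]) (intro smooth_diff_op sm \<psi>)
  then show "?H (diff_op k (\<lambda>w z. \<Sum>i\<in>I. c i * \<beta> (i + j) w z) \<psi>) z
      - diff_op k (\<lambda>w z. \<Sum>i\<in>I. c i * \<beta> (i + j) w z) (?H \<psi>) z
      = diff_op k (\<lambda>w z. \<Sum>i\<in>I. c i * \<beta> (i + Suc j) w z) \<psi> z"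
    unfolding diff_op_combination
    by (simp add: commutator_chainD(2)[OF chain \<psi>, symmetric] right_diff_distrib sum_subtractf)
qed

lemma partial_word_combination:
  assumes "\<And>i. i \<in> I \<Longrightarrow> smooth (f i)"
  shows "partial_word u (\<lambda>z. \<Sum>i\<in>I. c i * f i z) = (\<lambda>z. \<Sum>i\<in>I. c i * partial_word u (f i) z)"
proof (induction u)
  case (Cons a u)
  have "partial_x a (\<lambda>z. \<Sum>i\<in>I. c i * partial_word u (f i) z)
      = (\<lambda>z. \<Sum>i\<in>I. partial_x a (\<lambda>z. c i * partial_word u (f i) z) z)"
    by (rule partial_x_sum) (intro smooth_mult smooth_const smooth_partial_word assms)
  also have "\<dots> = (\<lambda>z. \<Sum>i\<in>I. c i * partial_x a (partial_word u (f i)) z)"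
    by (intro ext sum.cong refl fun_cong[OF partial_x_cmult] smooth_partial_word assms)
  finally show ?case using Cons by simp
qed simp

text \<open>
  Gaussian elimination: the equation \<open>\<phi>\<close> is used to eliminate one unknown \<open>k0\<close>.
\<close>

lemma nontrivial_solution_of_linear_system:
  fixes m :: "'a \<Rightarrow> 'b \<Rightarrow> 'c::field"
  assumes "finite \<Phi>" "finite K" "card \<Phi> < card K"
  shows "\<exists>c. (\<exists>k\<in>K. c k \<noteq> 0) \<and> (\<forall>\<phi>\<in>\<Phi>. (\<Sum>k\<in>K. c k * m \<phi> k) = 0)"
  using assms
proof (induction \<Phi> arbitrary: K m rule: finite_induct)
  case empty
  then obtain k where "k \<in> K" by fastforce
  then show ?case by (intro exI[of _ "\<lambda>_. 1"]) auto
next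
  case (insert \<phi> \<Phi>)
  show ?case
  proof (cases "\<forall>k\<in>K. m \<phi> k = 0")
    case True
    have "card \<Phi> < card K" using insert by simp
    from insert.IH[OF insert.prems(1) this, of m] obtain c
      where "\<exists>k\<in>K. c k \<noteq> 0" "\<forall>\<phi>\<in>\<Phi>. (\<Sum>k\<in>K. c k * m \<phi> k) = 0" by blast
    then show ?thesis using True by (intro exI[of _ c]) simp
  next
    case False
    then obtain k0 where k0: "k0 \<in> K" "m \<phi> k0 \<noteq> 0" by blast
    define L where "L = K - {k0}"
    have L: "finite L" "card \<Phi> < card L" "k0 \<notin> L" "K = insert k0 L"
      using insert k0 by (auto simp: L_def)
    define m' where "m' = (\<lambda>\<theta> k. m \<theta> k - m \<theta> k0 * (m \<phi> k / m \<phi> k0))"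
    from insert.IH[OF L(1,2), of m'] obtain c
      where c: "\<exists>k\<in>L. c k \<noteq> 0" "\<forall>\<phi>\<in>\<Phi>. (\<Sum>k\<in>L. c k * m' \<phi> k) = 0" by blast
    define s where "s = - (\<Sum>k\<in>L. c k * (m \<phi> k / m \<phi> k0))"
    define d where "d = (\<lambda>k. if k = k0 then s else c k)"
    have sum_d: "(\<Sum>k\<in>K. d k * m \<theta> k) = s * m \<theta> k0 + (\<Sum>k\<in>L. c k * m \<theta> k)" for \<theta>
    proof -
      have "(\<Sum>k\<in>L. d k * m \<theta> k) = (\<Sum>k\<in>L. c k * m \<theta> k)"
        by (rule sum.cong) (use L(3) in \<open>auto simp: d_def\<close>)
      then show ?thesis using L(1,3) by (simp add: L(4) d_def)
    qed
    have "(\<Sum>k\<in>K. d k * m \<theta> k) = (\<Sum>k\<in>L. c k * m' \<theta> k)" for \<theta>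
      unfolding sum_d m'_def s_def
      by (simp add: right_diff_distrib sum_subtractf sum_distrib_left sum_distrib_right mult_ac)
    moreover have "(\<Sum>k\<in>K. d k * m \<phi> k) = 0"
    proof -
      have "s * m \<phi> k0 = - (\<Sum>k\<in>L. c k * m \<phi> k)"
        using k0(2) by (simp add: s_def sum_distrib_right)
      then show ?thesis by (simp add: sum_d)
    qed
    moreover have "\<exists>k\<in>K. d k \<noteq> 0"
      using c(1) L(3,4) by (auto simp: d_def)
    ultimately show ?thesis using c(2) by (intro exI[of _ d]) simp
  qed
qed

text \<open>
  The operators with coefficients \<open>\<beta> 1, \<beta> 2, \<dots>\<close> are linearly dependent: a combination of the shifted
  chains is a chain, and it vanishes as soon as finitely many numbers do, namely the derivatives of order
  less than \<open>k\<close>, at the origin, of its coefficients on words of length less than \<open>k\<close>.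
\<close>

lemma chain_annihilating_polynomial:
  assumes p: "\<And>a. smooth (p a)" and v: "smooth v" and chain: "commutator_chain p v k \<beta>"
    and st: "\<And>j w. stationary (\<beta> j w)"
  shows "\<exists>P :: complex poly. P \<noteq> 0 \<and> (\<forall>w z. length w < k \<longrightarrow>
    (\<Sum>i\<le>degree P. coeff P i * \<beta> (i + 1) w z) = 0)"
proof -
  define J where "J = {u :: 'a list. length u < k} \<times> {w :: 'a list. length w < k}"
  have "finite J" by (simp add: J_def finite_words)
  obtain c where c: "\<exists>i\<in>{..card J}. c i \<noteq> 0"
    "\<forall>\<phi>\<in>J. (\<Sum>i\<in>{..card J}. c i * partial_word (fst \<phi>) (\<beta> (i + 1) (snd \<phi>)) 0) = 0"
    using nontrivial_solution_of_linear_system[OF \<open>finite J\<close>, of "{..card J}"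
        "\<lambda>\<phi> i. partial_word (fst \<phi>) (\<beta> (i + 1) (snd \<phi>)) 0"] by auto
  define \<gamma> where "\<gamma> = (\<lambda>j w z. \<Sum>i\<le>card J. c i * \<beta> (i + (j + 1)) w z)"
  have "commutator_chain p v k (\<lambda>j. \<beta> (j + 1))"
    by (rule commutator_chainI) (use commutator_chainD[OF chain] in simp_all)
  from chain_combination[OF p v this, of "{..card J}" c]
  have \<gamma>: "commutator_chain p v k \<gamma>" by (simp add: \<gamma>_def add.assoc)
  have zero: "\<gamma> 0 w = (\<lambda>z. 0)" if w: "length w < k" for w
  proof (rule chain_determined_by_jet[OF p v \<gamma> _ w])
    fix u w :: "'a list" and t :: real assume "length u < k" "length w < k"
    then have "(u, w) \<in> J" by (simp add: J_def)
    have sm: "smooth (\<beta> j w)" for j by (rule chain_smooth[OF chain])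
    have "partial_word u (\<beta> j w) (0, t) = partial_word u (\<beta> j w) 0" for j
    proof -
      have "freeze 0 (partial_word u (\<beta> j w)) = partial_word u (\<beta> j w)"
        using st[of j w] partial_word_freeze[OF sm, of u 0 j] by (simp add: stationary_def)
      then show ?thesis by (metis freeze_def fst_conv zero_prod_def)
    qed
    then show "partial_word u (\<gamma> 0 w) (0, t) = 0"
      unfolding \<gamma>_def using c(2) \<open>(u, w) \<in> J\<close> by (subst partial_word_combination[OF sm]) force
  qed
  define P where "P = (\<Sum>i\<le>card J. monom (c i) i)"
  have coeff: "coeff P i = (if i \<le> card J then c i else 0)" for i
    by (simp add: P_def coeff_sum coeff_monom if_distrib cong: if_cong)
  have "P \<noteq> 0" using c(1) coeff by (metis atMost_iff coeff_0)
  moreover have "(\<Sum>i\<le>degree P. coeff P i * \<beta> (i + 1) w z) = 0" if "length w < k" for w z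
  proof -
    have "degree P \<le> card J" by (rule degree_le) (simp add: coeff)
    moreover have "c i = 0" if "i \<le> card J" "degree P < i" for i
      using coeff_eq_0[OF that(2)] coeff[of i] that(1) by simp
    ultimately have "(\<Sum>i\<le>degree P. coeff P i * \<beta> (i + 1) w z) = (\<Sum>i\<le>card J. c i * \<beta> (i + 1) w z)"
      by (intro sum.mono_neutral_cong_left) (auto simp: coeff)
    then show ?thesis using fun_cong[OF zero[OF that], of z] by (simp add: \<gamma>_def)
  qed
  ultimately show ?thesis by blast
qed

text \<open>
  Let \<open>K\<close> be the operator with coefficients \<open>\<beta> 0\<close>, and let \<open>P\<close> have least degree among the nonzero
  polynomials with \<open>P(ad\<^sub>H) ad\<^sub>H K = 0\<close>. It is not constant as \<open>ad\<^sub>H K \<noteq> 0\<close>, so \<open>P = (X - \<mu>) R\<close>; put \<open>\<delta> = R(ad\<^sub>H) K\<close> and \<open>\<gamma> = ad\<^sub>H \<delta>\<close>. Then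
  \<open>ad\<^sub>H \<gamma> = \<mu> \<gamma>\<close>, and \<open>\<gamma> \<noteq> 0\<close> because \<open>R\<close> has smaller degree. Starting from \<open>ad\<^sub>H K\<close> instead of \<open>K\<close> gives
  \<open>\<gamma>\<close> as a commutator, which is what the case \<open>\<mu> = 0\<close> needs.
\<close>

lemma chain_eigenvector:
  assumes p: "\<And>a. smooth (p a)" and v: "smooth v" and chain: "commutator_chain p v k \<beta>"
    and st: "\<And>j w. stationary (\<beta> j w)"
    and w0: "length w0 < k" "\<beta> 1 w0 \<noteq> (\<lambda>z. 0)"
  obtains \<delta> \<gamma> \<mu> w where "symmetric_smooth \<delta>" "symmetric_smooth \<gamma>"
    "\<And>w. stationary (\<delta> w)" "\<And>w. stationary (\<gamma> w)" "length w < k" "\<gamma> w \<noteq> (\<lambda>z. 0)"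
    "\<And>\<psi> z. smooth \<psi> \<Longrightarrow>
      spatial_op p v (diff_op k \<delta> \<psi>) z - diff_op k \<delta> (spatial_op p v \<psi>) z = diff_op k \<gamma> \<psi> z"
    "\<And>\<psi> z. smooth \<psi> \<Longrightarrow>
      spatial_op p v (diff_op k \<gamma> \<psi>) z - diff_op k \<gamma> (spatial_op p v \<psi>) z = \<mu> * diff_op k \<gamma> \<psi> z"
proof -
  define ann where "ann = (\<lambda>P :: complex poly. P \<noteq> 0 \<and> (\<forall>w z. length w < k \<longrightarrow>
    (\<Sum>i\<le>degree P. coeff P i * \<beta> (i + 1) w z) = 0))"
  have "\<exists>P. ann P" unfolding ann_def by (rule chain_annihilating_polynomial[OF p v chain st])
  then obtain P' where "ann P'" by blast
  from ex_has_least_nat[of ann, OF this, of degree]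
  obtain P where P: "ann P" "\<And>R. ann R \<Longrightarrow> degree P \<le> degree R" by blast
  have P0: "P \<noteq> 0" and ann: "\<And>w z. length w < k \<Longrightarrow> (\<Sum>i\<le>degree P. coeff P i * \<beta> (i + 1) w z) = 0"
    using P(1) by (auto simp: ann_def)
  have "degree P \<noteq> 0"
  proof
    assume deg: "degree P = 0"
    then have "coeff P 0 \<noteq> 0" using P0 by (metis leading_coeff_0_iff)
    moreover have "coeff P 0 * \<beta> 1 w0 z = 0" for z using ann[OF w0(1), of z] deg by simp
    ultimately show False using w0(2) by auto
  qed
  then have "\<not> constant (poly P)" by (simp add: constant_degree)
  then obtain \<mu> where "poly P \<mu> = 0" using fundamental_theorem_of_algebra by blast
  then have "[:- \<mu>, 1:] dvd P" by (simp add: poly_eq_0_iff_dvd)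
  then obtain R where R: "P = [:- \<mu>, 1:] * R" by (rule dvdE)
  then have R0: "R \<noteq> 0" using P0 by auto
  have deg: "degree P = Suc (degree R)" unfolding R using R0 by (subst degree_mult_eq) auto
  define \<eta> where "\<eta> = (\<lambda>j w z. \<Sum>i\<le>degree R. coeff R i * \<beta> (i + j) w z)"
  have \<eta>: "commutator_chain p v k \<eta>" unfolding \<eta>_def by (rule chain_combination[OF p v chain]) simp
  have shift: "\<eta> 2 w z = \<mu> * \<eta> 1 w z" if "length w < k" for w z
  proof -
    have "coeff P i = coeff (pCons 0 R) i - \<mu> * coeff R i" for i by (simp add: R)
    then have "0 = (\<Sum>i\<le>Suc (degree R). (coeff (pCons 0 R) i - \<mu> * coeff R i) * \<beta> (i + 1) w z)"
      using ann[OF that, of z] by (simp add: deg)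
    also have "\<dots> = (\<Sum>i\<le>Suc (degree R). coeff (pCons 0 R) i * \<beta> (i + 1) w z)
        - \<mu> * (\<Sum>i\<le>Suc (degree R). coeff R i * \<beta> (i + 1) w z)"
      by (simp only: left_diff_distrib sum_subtractf sum_distrib_left mult.assoc)
    also have "(\<Sum>i\<le>Suc (degree R). coeff (pCons 0 R) i * \<beta> (i + 1) w z) = \<eta> 2 w z"
      unfolding \<eta>_def by (subst sum.atMost_Suc_shift) simp
    also have "(\<Sum>i\<le>Suc (degree R). coeff R i * \<beta> (i + 1) w z) = \<eta> 1 w z"
      unfolding \<eta>_def by (simp add: coeff_eq_0)
    finally show ?thesis by simp
  qed
  have "\<not> ann R" using P(2)[of R] deg by auto
  then obtain w z where w: "length w < k" "\<eta> 1 w z \<noteq> 0" using R0 by (auto simp: ann_def \<eta>_def)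
  have st\<eta>: "stationary (\<eta> j w)" for j w
  proof -
    have "\<beta> i w (fst z, t) = \<beta> i w z" for i z t
      using st[of i w] by (metis stationary_def freeze_def)
    then show ?thesis by (simp add: stationary_def freeze_def \<eta>_def)
  qed
  show thesis
  proof (rule that[of "\<eta> 0" "\<eta> 1" w \<mu>])
    show "\<eta> 1 w \<noteq> (\<lambda>z. 0)" using w(2) by auto
    fix z and \<psi> :: "'a stfun" assume \<psi>: "smooth \<psi>"
    show "spatial_op p v (diff_op k (\<eta> 0) \<psi>) z - diff_op k (\<eta> 0) (spatial_op p v \<psi>) z
        = diff_op k (\<eta> 1) \<psi> z"
      using commutator_chainD(2)[OF \<eta> \<psi>, of 0 z] by simp
    have "diff_op k (\<eta> 2) \<psi> z = \<mu> * diff_op k (\<eta> 1) \<psi> z"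
      unfolding diff_op_def sum_distrib_left by (rule sum.cong) (simp_all add: shift)
    then show "spatial_op p v (diff_op k (\<eta> 1) \<psi>) z - diff_op k (\<eta> 1) (spatial_op p v \<psi>) z
        = \<mu> * diff_op k (\<eta> 1) \<psi> z"
      using commutator_chainD(2)[OF \<eta> \<psi>, of 1 z] by (simp add: numeral_2_eq_2)
  qed (rule commutator_chainD(1)[OF \<eta>] st\<eta> w(1))+
qed

lemma diff_op_eq_0_imp:
  assumes c: "symmetric_smooth c" and zero: "\<And>\<psi>. smooth \<psi> \<Longrightarrow> diff_op k c \<psi> = (\<lambda>z. 0)"
    and u: "length u < k"
  shows "c u = (\<lambda>z. 0)"
proof -
  have "symbol (length u) c (z, \<xi>) = 0" for z \<xi>
  proof -
    have "0 = plane_wave \<xi> s z * (\<Sum>j<k. s ^ j * symbol j c (z, \<xi>))" for s z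
      using diff_op_plane_wave[of k c \<xi> s z] zero[OF smooth_plane_wave] by simp
    note uniq = has_top_coeff_unique[OF has_top_coeff_zero[of \<xi> 0] this]
    show ?thesis
    proof (cases "length u = 0")
      case True
      then show ?thesis using uniq(2)[of z] u by simp
    next
      case False
      then show ?thesis using uniq(1)[of "length u" z] u by simp
    qed
  qed
  then have *: "symbol (length u) c = (\<lambda>p. 0)" by (intro ext) (metis prod.exhaust)
  show ?thesis
  proof (rule symbol_eq_0_imp[OF _ _ * refl])
    show "smooth (c w)" for w by (rule symmetric_smoothD(1)[OF c])
    show "c w = c w'" if "mset w = mset w'" for w w' by (rule symmetric_smoothD(2)[OF c that])
  qed
qed

section \<open>Symmetry operators of the Schroedinger operator\<close>

definition stationary_schroedinger ::
    "('n::finite oper) \<Rightarrow> ('n \<Rightarrow> 'n stfun) \<Rightarrow> 'n stfun \<Rightarrow> bool" where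
  "stationary_schroedinger L p v \<longleftrightarrow> (\<forall>a. smooth (p a) \<and> stationary (p a)) \<and> smooth v \<and> stationary v \<and>
     (\<forall>\<psi>. smooth \<psi> \<longrightarrow> L \<psi> = (\<lambda>z. \<i> * partial_t \<psi> z - spatial_op p v \<psi> z))"

lemma stationary_schroedingerD:
  assumes "stationary_schroedinger L p v"
  shows "smooth (p a)" "stationary (p a)" "smooth v" "stationary v"
    "smooth \<psi> \<Longrightarrow> L \<psi> = (\<lambda>z. \<i> * partial_t \<psi> z - spatial_op p v \<psi> z)"
  using assms unfolding stationary_schroedinger_def by blast+

lemma smooth_static:
  fixes f :: "real ^ 'n::finite \<Rightarrow> 'b::real_normed_vector"
  assumes "smooth f" "bounded_linear (B :: 'b \<Rightarrow> complex)"
  shows "smooth (\<lambda>z :: (real ^ 'n) \<times> real. B (f (fst z)))"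
  using smooth_compose_affine[OF assms(2) bounded_linear_fst assms(1), of 0] by simp

lemma schroedinger_op_stationary:
  fixes A :: "real ^ 'n::finite \<Rightarrow> real ^ 'n"
  assumes A: "smooth A" and V: "smooth V"
  shows "\<exists>p v. stationary_schroedinger (schroedinger_op e A V) p v"
proof -
  \<comment> \<open>\<open>(p\<^sub>a - \<alpha>\<^sub>a)\<^sup>2 = -\<partial>\<^sub>a\<^sup>2 + 2\<i> \<alpha>\<^sub>a \<partial>\<^sub>a + \<i> (\<partial>\<^sub>a\<alpha>\<^sub>a) + \<alpha>\<^sub>a\<^sup>2\<close>\<close>
  define \<alpha> :: "'n \<Rightarrow> 'n stfun" where "\<alpha> = (\<lambda>a z. complex_of_real (e * A (fst z) $ a))"
  define p where "p = (\<lambda>a z. \<i> * \<alpha> a z)"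
  define v where "v = (\<lambda>z. (1 / 2) * ((\<Sum>a\<in>UNIV. \<i> * partial_x a (\<alpha> a) z + \<alpha> a z * \<alpha> a z)
    + complex_of_real (V (fst z))))"
  have \<alpha>: "smooth (\<alpha> a)" for a
    unfolding \<alpha>_def
    by (rule smooth_static[OF A]) (intro bounded_linear_compose[OF bounded_linear_of_real]
        bounded_linear_const_mult bounded_linear_vec_nth)
  have Vc: "smooth (\<lambda>z :: (real ^ 'n) \<times> real. complex_of_real (V (fst z)))"
    by (rule smooth_static[OF V bounded_linear_of_real])
  have st\<alpha>: "freeze t (\<alpha> a) = \<alpha> a" for a t by (simp add: freeze_def \<alpha>_def)
  have st\<alpha>': "freeze t (partial_x a (\<alpha> a)) = partial_x a (\<alpha> a)" for a t
    using partial_x_freeze[OF \<alpha>, of a t a] by (simp add: st\<alpha>)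
  have at: "\<alpha> a (fst z, t) = \<alpha> a z" "partial_x a (\<alpha> a) (fst z, t) = partial_x a (\<alpha> a) z" for a t z
    using fun_cong[OF st\<alpha>[of t a], of z] fun_cong[OF st\<alpha>'[of t a], of z] by (simp_all add: freeze_def)
  have "schroedinger_op e A V \<psi> = (\<lambda>z. \<i> * partial_t \<psi> z - spatial_op p v \<psi> z)"
    if \<psi>: "smooth \<psi>" for \<psi>
  proof
    fix z :: "(real ^ 'n) \<times> real"
    have km: "kinetic_momentum e A a \<phi> = (\<lambda>z. - \<i> * partial_x a \<phi> z + (- 1) * (\<alpha> a z * \<phi> z))" for a \<phi>
      by (simp add: kinetic_momentum_def momentum_def \<alpha>_def)
    have d: "partial_x a (\<lambda>z. - \<i> * partial_x a \<psi> z + (- 1) * (\<alpha> a z * \<psi> z)) z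
      = - \<i> * partial_x a (partial_x a \<psi>) z
        + (- 1) * (partial_x a (\<alpha> a) z * \<psi> z + \<alpha> a z * partial_x a \<psi> z)" for a
    proof -
      note s1 = smooth_partial_x[OF \<psi>, of a] and s2 = smooth_mult[OF \<alpha> \<psi>, of a]
      show ?thesis
        unfolding partial_x_add[OF smooth_mult[OF smooth_const s1] smooth_mult[OF smooth_const s2]]
          partial_x_cmult[OF s1] partial_x_cmult[OF s2] partial_x_mult[OF \<alpha> \<psi>] ..
    qed
    have sq: "kinetic_momentum e A a (kinetic_momentum e A a \<psi>) z
      = - partial_x a (partial_x a \<psi>) z + 2 * (p a z * partial_x a \<psi> z)
        + (\<i> * partial_x a (\<alpha> a) z + \<alpha> a z * \<alpha> a z) * \<psi> z" for a
      unfolding km d p_def by (simp add: algebra_simps)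
    show "schroedinger_op e A V \<psi> z = \<i> * partial_t \<psi> z - spatial_op p v \<psi> z"
      unfolding schroedinger_op_def sq spatial_op_def v_def
      by (simp only: sum.distrib sum_negf sum_distrib_left[symmetric] sum_distrib_right[symmetric])
         (simp add: algebra_simps)
  qed
  moreover have "smooth (p a)" for a unfolding p_def by (intro smooth_mult smooth_const \<alpha>)
  moreover have "smooth v"
    unfolding v_def by (intro smooth_mult smooth_const smooth_add smooth_sum smooth_partial_x \<alpha> Vc)
  moreover have "stationary (p a)" "stationary v" for a
    by (simp_all add: p_def v_def stationary_def freeze_def at)
  ultimately show ?thesis unfolding stationary_schroedinger_def by blast
qed

lemma stationary_schroedinger_smooth:
  assumes L: "stationary_schroedinger L p v" and \<psi>: "smooth \<psi>"
  shows "smooth (L \<psi>)"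
  unfolding stationary_schroedingerD(5)[OF L \<psi>]
  by (intro smooth_diff smooth_mult smooth_const smooth_partial_t smooth_spatial_op
      stationary_schroedingerD(1,3)[OF L] \<psi>)

lemma stationary_schroedinger_linear:
  assumes L: "stationary_schroedinger L p v" and \<psi>: "smooth \<psi>" and \<phi>: "smooth \<phi>"
  shows "L (\<lambda>z. \<psi> z + m * \<phi> z) = (\<lambda>z. L \<psi> z + m * L \<phi> z)"
proof -
  let ?f = "\<lambda>i :: bool. if i then \<psi> else \<phi>" and ?c = "\<lambda>i :: bool. if i then 1 else m"
  have f: "smooth (?f i)" for i using \<psi> \<phi> by simp
  have e: "(\<lambda>z. \<psi> z + m * \<phi> z) = (\<lambda>z. \<Sum>i\<in>UNIV. ?c i * ?f i z)" by (simp add: UNIV_bool add.commute)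
  have 1: "spatial_op p v (\<lambda>z. \<psi> z + m * \<phi> z) = (\<lambda>z. spatial_op p v \<psi> z + m * spatial_op p v \<phi> z)"
    unfolding e spatial_op_combination[OF f] by (simp add: UNIV_bool add.commute)
  have m\<phi>: "smooth (\<lambda>z. m * \<phi> z)" by (intro smooth_mult smooth_const \<phi>)
  have 2: "partial_t (\<lambda>z. \<psi> z + m * \<phi> z) = (\<lambda>z. partial_t \<psi> z + m * partial_t \<phi> z)"
    unfolding partial_t_def dir_deriv_add_smooth[OF \<psi> m\<phi>] dir_deriv_cmult[OF \<phi>] ..
  show ?thesis
    unfolding stationary_schroedingerD(5)[OF L smooth_add[OF \<psi> m\<phi>]]
      stationary_schroedingerD(5)[OF L \<psi>] stationary_schroedingerD(5)[OF L \<phi>] 1 2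
    by (simp add: algebra_simps)
qed

text \<open>
  As the potentials are time-independent, \<open>L\<close> commutes with \<open>\<partial>\<^sub>t\<close>, so differentiating the coefficients of a
  symmetry operator, which amounts to the commutator with \<open>\<partial>\<^sub>t\<close>, gives symmetry operators with the same bound
  on the order.
  For each of them \<open>[L, Q] = 0\<close> reads \<open>[H, Q] = \<i> \<partial>\<^sub>tQ\<close>, where \<open>\<partial>\<^sub>tQ\<close> has the differentiated coefficients.
\<close>

lemma symmetry_chain:
  fixes L :: "'n::finite oper"
  assumes L: "stationary_schroedinger L p v"
    and b: "symmetric_smooth b"
    and comm: "\<And>\<psi>. smooth \<psi> \<Longrightarrow> L (diff_op k b \<psi>) = diff_op k b (L \<psi>)"
  shows "commutator_chain p v k (\<lambda>j w z. \<i> ^ j * (partial_t ^^ j) (b w) z)"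
proof -
  note p = stationary_schroedingerD(1,2)[OF L] and v = stationary_schroedingerD(3,4)[OF L]
    and L_eq = stationary_schroedingerD(5)[OF L]
  define B where "B = (\<lambda>j w. (partial_t ^^ j) (b w))"
  have B_sm: "smooth (B j w)" for j w
    by (induction j) (simp_all add: B_def symmetric_smoothD(1)[OF b] smooth_partial_t)
  note L_sm = stationary_schroedinger_smooth[OF L]
  have L_diff: "L (\<lambda>z. \<psi> z - \<phi> z) = (\<lambda>z. L \<psi> z - L \<phi> z)" if "smooth \<psi>" "smooth \<phi>" for \<psi> \<phi>
    using stationary_schroedinger_linear[OF L that, of "- 1"] by simp
  have L_t: "partial_t (L \<psi>) = L (partial_t \<psi>)" if \<psi>: "smooth \<psi>" for \<psi>
  proof -
    note s = smooth_partial_t[OF \<psi>] and h = smooth_spatial_op[where p = p and v = v, OF p(1) v(1) \<psi>]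
    have "partial_t (L \<psi>) = (\<lambda>z. \<i> * partial_t (partial_t \<psi>) z + - 1 * partial_t (spatial_op p v \<psi>) z)"
      using dir_deriv_add_smooth[OF smooth_mult[OF smooth_const s] smooth_mult[OF smooth_const h],
          of "(0, 1)" \<i> "- 1"] dir_deriv_cmult[OF s, of "(0, 1)" \<i>] dir_deriv_cmult[OF h, of "(0, 1)" "- 1"]
      unfolding L_eq[OF \<psi>] partial_t_def by simp
    then show ?thesis
      unfolding partial_t_spatial_op[OF p v \<psi>] L_eq[OF s] by simp
  qed
  have D_t: "diff_op k (B (Suc j)) \<psi> = (\<lambda>z. partial_t (diff_op k (B j) \<psi>) z - diff_op k (B j) (partial_t \<psi>) z)"
    if "smooth \<psi>" for j \<psi>
    unfolding partial_t_diff_op[OF B_sm that] by (simp add: B_def)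
  have B_comm: "L (diff_op k (B j) \<psi>) = diff_op k (B j) (L \<psi>)" if "smooth \<psi>" for j \<psi>
    using that
  proof (induction j arbitrary: \<psi>)
    case 0
    then show ?case using comm by (simp add: B_def)
  next
    case (Suc j)
    note \<psi> = Suc.prems
    have sD: "smooth (diff_op k (B j) \<psi>)" "smooth (diff_op k (B j) (partial_t \<psi>))"
      by (intro smooth_diff_op B_sm smooth_partial_t \<psi>)+
    show ?case
      unfolding D_t[OF \<psi>] D_t[OF L_sm[OF \<psi>]] L_diff[OF smooth_partial_t[OF sD(1)] sD(2)]
        Suc.IH[OF smooth_partial_t[OF \<psi>]] L_t[OF sD(1), symmetric] Suc.IH[OF \<psi>] L_t[OF \<psi>] ..
  qed
  show ?thesis
  proof (rule commutator_chainI)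
    show "symmetric_smooth (\<lambda>w z. \<i> ^ j * (partial_t ^^ j) (b w) z)" for j
    proof (rule symmetric_smoothI)
      show "smooth (\<lambda>z. \<i> ^ j * (partial_t ^^ j) (b w) z)" for w
        using B_sm unfolding B_def by (intro smooth_mult smooth_const)
      fix w w' :: "'n list" assume "mset w = mset w'"
      then have "b w = b w'" by (rule symmetric_smoothD(2)[OF b])
      then show "(\<lambda>z. \<i> ^ j * (partial_t ^^ j) (b w) z) = (\<lambda>z. \<i> ^ j * (partial_t ^^ j) (b w') z)" by simp
    qed
    fix j z and \<psi> :: "'n stfun" assume \<psi>: "smooth \<psi>"
    have pull: "diff_op k (\<lambda>w z. \<i> ^ j * (partial_t ^^ j) (b w) z) \<phi> = (\<lambda>z. \<i> ^ j * diff_op k (B j) \<phi> z)" for j \<phi>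
      by (simp add: diff_op_def B_def sum_distrib_left mult.assoc)
    have sD: "smooth (diff_op k (B j) \<psi>)" by (intro smooth_diff_op B_sm \<psi>)
    have H: "spatial_op p v (\<lambda>z. \<i> ^ j * diff_op k (B j) \<psi> z)
        = (\<lambda>z. \<i> ^ j * spatial_op p v (diff_op k (B j) \<psi>) z)"
      by (rule spatial_op_time_factor[OF smooth_const partial_x_const sD])
    have DL: "\<i> * diff_op k (B j) (partial_t \<psi>) z
        = diff_op k (B j) (L \<psi>) z + diff_op k (B j) (spatial_op p v \<psi>) z"
    proof -
      note s = smooth_partial_t[OF \<psi>] and h = smooth_spatial_op[where p = p and v = v, OF p(1) v(1) \<psi>]
      have "L \<psi> = (\<lambda>z. \<i> * partial_t \<psi> z + - 1 * spatial_op p v \<psi> z)" by (simp add: L_eq[OF \<psi>])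
      then show ?thesis
        by (simp only: diff_op_add[OF smooth_mult[OF smooth_const s] smooth_mult[OF smooth_const h]]
            diff_op_cmult[OF s] diff_op_cmult[OF h]) simp
    qed
    have LD: "\<i> * partial_t (diff_op k (B j) \<psi>) z
        = diff_op k (B j) (L \<psi>) z + spatial_op p v (diff_op k (B j) \<psi>) z"
      unfolding B_comm[OF \<psi>, symmetric] L_eq[OF sD] by simp
    have "spatial_op p v (diff_op k (B j) \<psi>) z - diff_op k (B j) (spatial_op p v \<psi>) z
        = \<i> * diff_op k (B (Suc j)) \<psi> z"
      unfolding D_t[OF \<psi>] right_diff_distrib DL LD by simp
    then show "spatial_op p v (diff_op k (\<lambda>w z. \<i> ^ j * (partial_t ^^ j) (b w) z) \<psi>) z
        - diff_op k (\<lambda>w z. \<i> ^ j * (partial_t ^^ j) (b w) z) (spatial_op p v \<psi>) z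
        = diff_op k (\<lambda>w z. \<i> ^ Suc j * (partial_t ^^ Suc j) (b w) z) \<psi> z"
      unfolding pull H by (simp add: right_diff_distrib[symmetric])
  qed
qed

text \<open>
  For a stationary operator \<open>D\<close> this is \<open>[L, \<tau> D] = \<i> \<tau>' D - \<tau> [H, D]\<close>.
\<close>

lemma commutator_time_factor:
  fixes L :: "'n::finite oper"
  assumes L: "stationary_schroedinger L p v"
    and c: "\<And>w. smooth (c w)" "\<And>w. stationary (c w)"
    and \<tau>: "smooth \<tau>" "\<And>a. partial_x a \<tau> = (\<lambda>z. 0)" and \<psi>: "smooth \<psi>"
  shows "L (\<lambda>z. \<tau> z * diff_op k c \<psi> z) z - \<tau> z * diff_op k c (L \<psi>) z
    = \<i> * partial_t \<tau> z * diff_op k c \<psi> z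
      - \<tau> z * (spatial_op p v (diff_op k c \<psi>) z - diff_op k c (spatial_op p v \<psi>) z)"
proof -
  note p = stationary_schroedingerD(1,2)[OF L] and v = stationary_schroedingerD(3,4)[OF L]
    and L_eq = stationary_schroedingerD(5)[OF L]
  note s = smooth_partial_t[OF \<psi>] and h = smooth_spatial_op[where p = p and v = v, OF p(1) v(1) \<psi>]
  have D: "smooth (diff_op k c \<psi>)" by (intro smooth_diff_op c \<psi>)
  have zero: "diff_op k (\<lambda>w z. 0) \<psi> z = 0" for z by (simp add: diff_op_def)
  have Dt: "partial_t (diff_op k c \<psi>) = diff_op k c (partial_t \<psi>)"
    unfolding partial_t_diff_op[OF c(1) \<psi>] by (simp add: partial_t_stationary[OF c(2,1)] zero)
  have DL: "diff_op k c (L \<psi>) z = \<i> * diff_op k c (partial_t \<psi>) z - diff_op k c (spatial_op p v \<psi>) z"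
  proof -
    have "L \<psi> = (\<lambda>z. \<i> * partial_t \<psi> z + - 1 * spatial_op p v \<psi> z)" by (simp add: L_eq[OF \<psi>])
    then show ?thesis
      by (simp only: diff_op_add[OF smooth_mult[OF smooth_const s] smooth_mult[OF smooth_const h]]
          diff_op_cmult[OF s] diff_op_cmult[OF h]) simp
  qed
  have LD: "L (\<lambda>z. \<tau> z * diff_op k c \<psi> z) z
      = \<i> * (partial_t \<tau> z * diff_op k c \<psi> z + \<tau> z * diff_op k c (partial_t \<psi>) z)
        - \<tau> z * spatial_op p v (diff_op k c \<psi>) z"
    unfolding L_eq[OF smooth_mult[OF \<tau>(1) D]] partial_t_mult[OF \<tau>(1) D] Dt
      spatial_op_time_factor[OF \<tau> D] ..
  show ?thesis unfolding DL LD by (simp add: algebra_simps)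
qed

section \<open>Time dependence of the special operators\<close>

lemma diff_operatorD:
  assumes "diff_operator q b Q"
  shows "symmetric_smooth b" "smooth \<psi> \<Longrightarrow> Q \<psi> = diff_op (Suc q) b \<psi>"
  using assms unfolding diff_operator_def op_eq_def derivative_form_eq by blast+

lemma freeze_time_independent_op:
  assumes "diff_operator q b K" "time_independent_coeffs q b" "smooth \<psi>"
  shows "freeze t (K \<psi>) = K (freeze t \<psi>)"
proof -
  have "freeze t (b w) z = b w z" if "length w < Suc q" for w z
    using assms(2) that unfolding time_independent_coeffs_def freeze_def
    by (metis less_Suc_eq_le prod.collapse)
  then have "diff_op (Suc q) (\<lambda>w. freeze t (b w)) (freeze t \<psi>) = diff_op (Suc q) b (freeze t \<psi>)"
    unfolding diff_op_def by (intro ext sum.cong) auto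
  then show ?thesis
    by (simp add: diff_operatorD(2)[OF assms(1)] assms(3) smooth_freeze freeze_diff_op)
qed

text \<open>
  A nonzero time-independent operator is nonzero on some function that does not depend on time:
  extend \<open>\<psi>\<close> constantly from a time at which \<open>K \<psi>\<close> does not vanish.
\<close>

lemma time_independent_op_not_zeroE:
  assumes K: "time_independent_op K" and "\<not> op_eq K op_zero"
  obtains \<phi> x where "smooth \<phi>" "\<And>t. freeze t \<phi> = \<phi>" "K \<phi> (x, 0) \<noteq> 0"
proof -
  obtain \<psi> z where \<psi>: "smooth \<psi>" "K \<psi> z \<noteq> 0"
    using assms(2) unfolding op_eq_def op_zero_def by (metis ext)
  obtain q b where b: "diff_operator q b K" "time_independent_coeffs q b"
    using K by (auto simp: time_independent_op_def)
  define \<phi> where "\<phi> = freeze (snd z) \<psi>"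
  have "freeze 0 (K \<phi>) = freeze (snd z) (K \<psi>)"
    by (simp add: freeze_time_independent_op[OF b] smooth_freeze \<psi>(1) \<phi>_def)
  then have "K \<phi> (fst z, 0) = K \<psi> z" by (auto simp: freeze_def dest: fun_cong[of _ _ z])
  then show thesis
    using \<psi> by (intro that[of \<phi> "fst z"]) (simp_all add: \<phi>_def smooth_freeze)
qed

lemma time_independent_op_value:
  assumes "time_independent_op K" "smooth \<phi>" "\<And>t. freeze t \<phi> = \<phi>"
  shows "K \<phi> (x, t) = K \<phi> (x, 0)"
proof -
  obtain q b where b: "diff_operator q b K" "time_independent_coeffs q b"
    using assms(1) by (auto simp: time_independent_op_def)
  show ?thesis
    using fun_cong[OF freeze_time_independent_op[OF b assms(2), of 0], of "(x, t)"]
    unfolding assms(3) by (simp add: freeze_def)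
qed

text \<open>
  An operator with time-independent coefficients maps functions constant in time to such functions.
\<close>

lemma time_dependent_opI:
  assumes "diff_operator q b Q" "smooth \<phi>" "\<And>t. freeze t \<phi> = \<phi>" "Q \<phi> (x, t) \<noteq> Q \<phi> (x, 0)"
  shows "time_dependent_op Q"
  using assms time_independent_op_value[of Q \<phi> x t]
  unfolding time_dependent_op_def time_independent_op_def by blast

lemma exp_times_time_dependent:
  assumes Q: "diff_operator q b Q" "op_eq Q (exp_times l K)" and l: "l \<noteq> 0"
    and K: "time_independent_op K" "\<not> op_eq K op_zero"
  shows "time_dependent_op Q"
proof -
  obtain \<phi> x where \<phi>: "smooth \<phi>" "\<And>t. freeze t \<phi> = \<phi>" "K \<phi> (x, 0) \<noteq> 0"
    by (rule time_independent_op_not_zeroE[OF K]) blast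
  have val: "Q \<phi> (x, t) = exp (l * complex_of_real t) * K \<phi> (x, 0)" for t
    using Q(2) \<phi>(1) time_independent_op_value[OF K(1) \<phi>(1,2), of x t]
    by (simp add: op_eq_def exp_times_def)
  \<comment> \<open>Then \<open>l t\<close> has norm \<open>1 < 2\<pi>\<close>, too small for a nonzero period of \<open>exp\<close>.\<close>
  define t where "t = 1 / norm l"
  have "exp (l * complex_of_real t) \<noteq> 1"
  proof
    assume "exp (l * complex_of_real t) = 1"
    then have "exp (l * complex_of_real t) = exp 0" by simp
    moreover have "norm (l * complex_of_real t) = 1"
      using l by (simp add: t_def norm_mult norm_divide)
    then have "\<bar>Im (l * complex_of_real t) - Im 0\<bar> < 2 * pi"
      using abs_Im_le_cmod[of "l * complex_of_real t"] pi_gt3 by simp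
    ultimately have "l * complex_of_real t = 0" by (metis exp_complex_eqI)
    then show False using l by (simp add: t_def)
  qed
  then have "Q \<phi> (x, t) \<noteq> Q \<phi> (x, 0)" using \<phi>(3) by (simp add: val)
  then show ?thesis by (rule time_dependent_opI[OF Q(1) \<phi>(1,2)])
qed

lemma linear_in_time_time_dependent:
  assumes Q: "diff_operator q b Q" "op_eq Q (linear_in_time K0 K1)"
    and K: "time_independent_op K0" "time_independent_op K1" "\<not> op_eq K1 op_zero"
  shows "time_dependent_op Q"
proof -
  obtain \<phi> x where \<phi>: "smooth \<phi>" "\<And>t. freeze t \<phi> = \<phi>" "K1 \<phi> (x, 0) \<noteq> 0"
    by (rule time_independent_op_not_zeroE[OF K(2,3)]) blast
  have "Q \<phi> (x, t) = K0 \<phi> (x, 0) + complex_of_real t * K1 \<phi> (x, 0)" for t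
    using Q(2) \<phi>(1) time_independent_op_value[OF K(1) \<phi>(1,2), of x t]
      time_independent_op_value[OF K(2) \<phi>(1,2), of x t]
    by (simp add: op_eq_def linear_in_time_def)
  then have "Q \<phi> (x, 1) \<noteq> Q \<phi> (x, 0)" using \<phi>(3) by simp
  then show ?thesis by (rule time_dependent_opI[OF Q(1) \<phi>(1,2)])
qed

lemma stationary_diff_op:
  assumes "symmetric_smooth c" "\<And>w. stationary (c w)"
  shows "time_independent_op (diff_op (Suc q) c)"
proof -
  have "diff_operator q c (diff_op (Suc q) c)"
    by (rule diff_operatorI[OF assms(1)]) (simp add: op_eq_def)
  moreover have "c w (x, t) = c w (x, t')" for w x t t'
  proof -
    have "freeze t' (c w) (x, t) = c w (x, t)" using assms(2)[of w] by (simp add: stationary_def)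
    then show ?thesis by (simp add: freeze_def)
  qed
  then have "time_independent_coeffs q c" by (simp add: time_independent_coeffs_def)
  ultimately show ?thesis unfolding time_independent_op_def by blast
qed

lemma diff_op_not_zero:
  assumes "symmetric_smooth c" "length w < k" "c w \<noteq> (\<lambda>z. 0)"
  shows "\<not> op_eq (diff_op k c) op_zero"
  using diff_op_eq_0_imp[OF assms(1) _ assms(2)] assms(3) by (auto simp: op_eq_def op_zero_def)

section \<open>The equivalence\<close>

lemma partial_time_function:
  fixes f :: "'n::finite stfun"
  assumes "\<And>z. f z = g (snd z)" "\<And>t. (g has_vector_derivative g' t) (at t)"
  shows "partial_x a f = (\<lambda>z. 0)" "partial_t f = (\<lambda>z. g' (snd z))"
proof -
  have "(f has_derivative (\<lambda>v. snd v *\<^sub>R g' (snd z))) (at z)" for z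
  proof -
    have "(g \<circ> snd has_derivative (\<lambda>r. r *\<^sub>R g' (snd z)) \<circ> snd) (at z)"
      by (rule diff_chain_at[OF bounded_linear_imp_has_derivative[OF bounded_linear_snd]
            assms(2)[unfolded has_vector_derivative_def]])
    moreover have "f = g \<circ> snd" using assms(1) by auto
    ultimately show ?thesis by (simp add: o_def)
  qed
  then have d: "dir_deriv v f z = snd v *\<^sub>R g' (snd z)" for v z by (rule dir_deriv_eqI)
  show "partial_x a f = (\<lambda>z. 0)" "partial_t f = (\<lambda>z. g' (snd z))"
    by (simp_all add: partial_x_def partial_t_def d fun_eq_iff)
qed

text \<open>
  The exponent is chosen to make \<open>\<i> \<tau>' = \<mu> \<tau>\<close>, which cancels the commutator \<open>\<mu> D\<close>.
\<close>

lemma exp_symmetry_operator: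
  fixes A :: "real ^ 'n::finite \<Rightarrow> real ^ 'n"
  assumes L: "stationary_schroedinger (schroedinger_op e A V) p v"
    and \<gamma>: "symmetric_smooth \<gamma>" "\<And>w. stationary (\<gamma> w)"
    and eig: "\<And>\<psi> z. smooth \<psi> \<Longrightarrow> spatial_op p v (diff_op (Suc q) \<gamma> \<psi>) z
      - diff_op (Suc q) \<gamma> (spatial_op p v \<psi>) z = \<mu> * diff_op (Suc q) \<gamma> \<psi> z"
  shows "symmetry_operator e A V (exp_times (- \<i> * \<mu>) (diff_op (Suc q) \<gamma>))"
proof -
  define \<tau> :: "'n stfun" where "\<tau> = (\<lambda>z. exp (- \<i> * \<mu> * complex_of_real (snd z)))"
  have \<tau>_sm: "smooth \<tau>"
    unfolding \<tau>_def by (intro smooth_exp smooth_bounded_linear bounded_linear_const_mult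
        bounded_linear_compose[OF bounded_linear_of_real] bounded_linear_snd)
  have "((\<lambda>t. exp (- \<i> * \<mu> * complex_of_real t)) has_vector_derivative
      - \<i> * \<mu> * exp (- \<i> * \<mu> * complex_of_real t)) (at t)" for t
    by (rule has_vector_derivative_real_field) (auto intro!: derivative_eq_intros)
  note d\<tau> = partial_time_function[where f = \<tau>, OF _ this]
  have \<tau>_x: "partial_x a \<tau> = (\<lambda>z. 0)" for a by (rule d\<tau>(1)) (simp add: \<tau>_def)
  have \<tau>_t: "partial_t \<tau> = (\<lambda>z. - \<i> * \<mu> * \<tau> z)" by (subst d\<tau>(2)) (simp_all add: \<tau>_def)
  have Q: "exp_times (- \<i> * \<mu>) (diff_op (Suc q) \<gamma>) \<psi> = (\<lambda>z. \<tau> z * diff_op (Suc q) \<gamma> \<psi> z)" for \<psi>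
    by (simp add: exp_times_def \<tau>_def)
  have "symmetric_smooth (\<lambda>w z. \<tau> z * \<gamma> w z)"
  proof (rule symmetric_smoothI)
    show "smooth (\<lambda>z. \<tau> z * \<gamma> w z)" for w by (rule smooth_mult[OF \<tau>_sm symmetric_smoothD(1)[OF \<gamma>(1)]])
    show "(\<lambda>z. \<tau> z * \<gamma> w z) = (\<lambda>z. \<tau> z * \<gamma> w' z)" if "mset w = mset w'" for w w'
      using symmetric_smoothD(2)[OF \<gamma>(1) that] by simp
  qed
  then have "diff_operator q (\<lambda>w z. \<tau> z * \<gamma> w z) (exp_times (- \<i> * \<mu>) (diff_op (Suc q) \<gamma>))"
    by (rule diff_operatorI) (simp only: op_eq_def Q diff_op_def sum_distrib_left mult.assoc simp_thms)
  moreover have "commutator (schroedinger_op e A V) (exp_times (- \<i> * \<mu>) (diff_op (Suc q) \<gamma>)) \<psi> z = 0"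
    if "smooth \<psi>" for \<psi> z
    unfolding commutator_def Q
      commutator_time_factor[OF L symmetric_smoothD(1)[OF \<gamma>(1)] \<gamma>(2) \<tau>_sm \<tau>_x that] \<tau>_t eig[OF that]
    by (simp add: algebra_simps)
  ultimately show ?thesis
    unfolding symmetry_operator_def op_eq_def op_zero_def by blast
qed

lemma linear_symmetry_operator:
  fixes A :: "real ^ 'n::finite \<Rightarrow> real ^ 'n"
  assumes L: "stationary_schroedinger (schroedinger_op e A V) p v"
    and \<delta>: "symmetric_smooth \<delta>" "\<And>w. stationary (\<delta> w)"
    and \<gamma>: "symmetric_smooth \<gamma>" "\<And>w. stationary (\<gamma> w)"
    and \<delta>_comm: "\<And>\<psi> z. smooth \<psi> \<Longrightarrow> spatial_op p v (diff_op (Suc q) \<delta> \<psi>) z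
      - diff_op (Suc q) \<delta> (spatial_op p v \<psi>) z = \<i> * diff_op (Suc q) \<gamma> \<psi> z"
    and \<gamma>_comm: "\<And>\<psi> z. smooth \<psi> \<Longrightarrow> spatial_op p v (diff_op (Suc q) \<gamma> \<psi>) z
      - diff_op (Suc q) \<gamma> (spatial_op p v \<psi>) z = 0"
  shows "symmetry_operator e A V (linear_in_time (diff_op (Suc q) \<delta>) (diff_op (Suc q) \<gamma>))"
proof -
  let ?L = "schroedinger_op e A V" and ?D = "diff_op (Suc q)"
  define \<tau> :: "'n stfun" where "\<tau> = (\<lambda>z. complex_of_real (snd z))"
  have \<tau>_sm: "smooth \<tau>"
    unfolding \<tau>_def by (intro smooth_bounded_linear
        bounded_linear_compose[OF bounded_linear_of_real] bounded_linear_snd)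
  have "(complex_of_real has_vector_derivative 1) (at t)" for t
    by (rule has_vector_derivative_real_field[where f = "\<lambda>z. z"]) (rule DERIV_ident)
  note d\<tau> = partial_time_function[where f = \<tau>, OF _ this]
  have \<tau>_x: "partial_x a \<tau> = (\<lambda>z. 0)" for a by (rule d\<tau>(1)) (simp add: \<tau>_def)
  have \<tau>_t: "partial_t \<tau> = (\<lambda>z. 1)" by (subst d\<tau>(2)) (simp_all add: \<tau>_def)
  have Q: "linear_in_time (?D \<delta>) (?D \<gamma>) \<psi> = (\<lambda>z. ?D \<delta> \<psi> z + 1 * (\<tau> z * ?D \<gamma> \<psi> z))" for \<psi>
    by (simp add: linear_in_time_def \<tau>_def)
  note \<delta>_sm = symmetric_smoothD(1)[OF \<delta>(1)] and \<gamma>_sm = symmetric_smoothD(1)[OF \<gamma>(1)]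
  have "symmetric_smooth (\<lambda>w z. \<delta> w z + \<tau> z * \<gamma> w z)"
  proof (rule symmetric_smoothI)
    show "smooth (\<lambda>z. \<delta> w z + \<tau> z * \<gamma> w z)" for w
      by (intro smooth_add smooth_mult \<tau>_sm \<delta>_sm \<gamma>_sm)
    show "(\<lambda>z. \<delta> w z + \<tau> z * \<gamma> w z) = (\<lambda>z. \<delta> w' z + \<tau> z * \<gamma> w' z)" if "mset w = mset w'" for w w'
      using symmetric_smoothD(2)[OF \<delta>(1) that] symmetric_smoothD(2)[OF \<gamma>(1) that] by simp
  qed
  then have "diff_operator q (\<lambda>w z. \<delta> w z + \<tau> z * \<gamma> w z) (linear_in_time (?D \<delta>) (?D \<gamma>))"
    by (rule diff_operatorI)
       (simp add: op_eq_def Q, simp add: diff_op_def sum_distrib_left mult.assoc distrib_right sum.distrib)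
  moreover have "commutator ?L (linear_in_time (?D \<delta>) (?D \<gamma>)) \<psi> z = 0" if \<psi>: "smooth \<psi>" for \<psi> z
  proof -
    have D: "smooth (?D \<delta> \<psi>)" "smooth (\<lambda>z. \<tau> z * ?D \<gamma> \<psi> z)"
      by (intro smooth_mult \<tau>_sm smooth_diff_op \<delta>_sm \<gamma>_sm \<psi>)+
    have "?L (?D \<delta> \<psi>) z - ?D \<delta> (?L \<psi>) z = - \<i> * ?D \<gamma> \<psi> z"
      using commutator_time_factor[where k = "Suc q" and z = z and c = \<delta>, OF L \<delta>_sm \<delta>(2) smooth_const[of 1] partial_x_const \<psi>]
      by (simp add: partial_t_def dir_deriv_zero \<delta>_comm[OF \<psi>, symmetric])
    moreover have "?L (\<lambda>z. \<tau> z * ?D \<gamma> \<psi> z) z - \<tau> z * ?D \<gamma> (?L \<psi>) z = \<i> * ?D \<gamma> \<psi> z"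
      using commutator_time_factor[where k = "Suc q" and z = z and c = \<gamma>, OF L \<gamma>_sm \<gamma>(2) \<tau>_sm \<tau>_x \<psi>]
        \<gamma>_comm[OF \<psi>, of z] by (simp add: \<tau>_t)
    ultimately show ?thesis
      unfolding commutator_def Q stationary_schroedinger_linear[OF L D] by (simp add: algebra_simps)
  qed
  ultimately show ?thesis
    unfolding symmetry_operator_def op_eq_def op_zero_def by blast
qed

theorem theorem3:
  fixes e :: real and A :: "real ^ 'n \<Rightarrow> real ^ 'n" and V :: "real ^ 'n \<Rightarrow> real"
  assumes "CARD('n) \<in> {1, 2, 3, 4}"
    and "smooth A" and "smooth V"
  shows "(\<exists>Q. symmetry_operator e A V Q \<and> time_dependent_op Q) \<longleftrightarrow>
    (\<exists>Q. symmetry_operator e A V Q \<and>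
      ((\<exists>l K0. l \<noteq> 0 \<and> time_independent_op K0 \<and> \<not> op_eq K0 op_zero \<and>
          op_eq Q (exp_times l K0)) \<or>
       (\<exists>K0 K1. time_independent_op K0 \<and> time_independent_op K1 \<and> \<not> op_eq K1 op_zero \<and>
          op_eq Q (linear_in_time K0 K1))))"
    (is "?dependent \<longleftrightarrow> ?special")
proof
  let ?L = "schroedinger_op e A V"
  obtain p v where L: "stationary_schroedinger ?L p v"
    using schroedinger_op_stationary[OF assms(2,3)] by blast
  note p = stationary_schroedingerD(1,2)[OF L] and v = stationary_schroedingerD(3,4)[OF L]
  assume ?dependent
  then obtain Q q b where Q: "symmetry_operator e A V Q" "diff_operator q b Q"
    "\<not> time_independent_coeffs q b"
    unfolding time_dependent_op_def by blast
  note b = diff_operatorD(1)[OF Q(2)] and Q_eq = diff_operatorD(2)[OF Q(2)]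
  have "?L (diff_op (Suc q) b \<psi>) = diff_op (Suc q) b (?L \<psi>)" if \<psi>: "smooth \<psi>" for \<psi>
  proof
    fix z
    have "commutator ?L Q \<psi> z = 0"
      using Q(1) \<psi> by (simp add: symmetry_operator_def op_eq_def op_zero_def)
    then show "?L (diff_op (Suc q) b \<psi>) z = diff_op (Suc q) b (?L \<psi>) z"
      unfolding commutator_def Q_eq[OF \<psi>] Q_eq[OF stationary_schroedinger_smooth[OF L \<psi>]] by simp
  qed
  note chain = symmetry_chain[OF L b this]
  obtain w x t t' where w: "length w < Suc q" "b w (x, t) \<noteq> b w (x, t')"
    using Q(3) unfolding time_independent_coeffs_def by (metis less_Suc_eq_le)
  \<comment> \<open>A time at which \<open>[H, Q(t0)] \<noteq> 0\<close>; the chain starts from \<open>Q(t0)\<close>.\<close>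
  obtain t0 where t0: "partial_t (b w) (x, t0) \<noteq> 0"
  proof (rule ccontr)
    assume "\<not> thesis"
    then have "dir_deriv (0, 1) (b w) ((x, t') + s *\<^sub>R (0, 1)) = 0" for s
      using that unfolding partial_t_def by auto
    from constant_on_line[OF symmetric_smoothD(1)[OF b] this, of "t - t'"]
    show False using w(2) by simp
  qed
  define \<beta> where "\<beta> = (\<lambda>j w. freeze t0 (\<lambda>z. \<i> ^ j * (partial_t ^^ j) (b w) z))"
  have \<beta>: "commutator_chain p v (Suc q) \<beta>"
    unfolding \<beta>_def by (rule chain_freeze[OF p v chain])
  have st: "stationary (\<beta> j w)" for j w unfolding \<beta>_def by (rule stationary_freeze)
  have "\<beta> 1 w (x, 0) \<noteq> 0" using t0 by (simp add: \<beta>_def freeze_def)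
  then have \<beta>1: "\<beta> 1 w \<noteq> (\<lambda>z. 0)" by auto
  obtain \<delta> \<gamma> \<mu> w where ch: "symmetric_smooth \<delta>" "symmetric_smooth \<gamma>"
    "\<And>w. stationary (\<delta> w)" "\<And>w. stationary (\<gamma> w)" "length w < Suc q" "\<gamma> w \<noteq> (\<lambda>z. 0)"
    "\<And>\<psi> z. smooth \<psi> \<Longrightarrow> spatial_op p v (diff_op (Suc q) \<delta> \<psi>) z
      - diff_op (Suc q) \<delta> (spatial_op p v \<psi>) z = diff_op (Suc q) \<gamma> \<psi> z"
    "\<And>\<psi> z. smooth \<psi> \<Longrightarrow> spatial_op p v (diff_op (Suc q) \<gamma> \<psi>) z
      - diff_op (Suc q) \<gamma> (spatial_op p v \<psi>) z = \<mu> * diff_op (Suc q) \<gamma> \<psi> z"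
    by (rule chain_eigenvector[OF p(1) v(1) \<beta> st w(1) \<beta>1]) blast
  show ?special
  proof (cases "\<mu> = 0")
    case False
    have "symmetry_operator e A V (exp_times (- \<i> * \<mu>) (diff_op (Suc q) \<gamma>))"
      by (rule exp_symmetry_operator[OF L ch(2,4,8)])
    moreover have "time_independent_op (diff_op (Suc q) \<gamma>)" by (rule stationary_diff_op[OF ch(2,4)])
    moreover have "\<not> op_eq (diff_op (Suc q) \<gamma>) op_zero" by (rule diff_op_not_zero[OF ch(2,5,6)])
    moreover have "- \<i> * \<mu> \<noteq> 0" using False by simp
    ultimately show ?thesis unfolding op_eq_def by blast
  next
    case True
    \<comment> \<open>With \<open>[H, \<delta>] = \<gamma>\<close> and \<open>[H, \<gamma>] = 0\<close>, the operator \<open>\<delta> - \<i> t \<gamma>\<close> commutes with \<open>L\<close>.\<close>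
    define \<eta> where "\<eta> = (\<lambda>w z. - \<i> * \<gamma> w z)"
    have \<eta>: "symmetric_smooth \<eta>"
    proof (rule symmetric_smoothI)
      show "smooth (\<eta> w)" for w
        unfolding \<eta>_def by (intro smooth_mult smooth_const symmetric_smoothD(1)[OF ch(2)])
      show "\<eta> w = \<eta> w'" if "mset w = mset w'" for w w'
        unfolding \<eta>_def using symmetric_smoothD(2)[OF ch(2) that] by simp
    qed
    have st\<eta>: "stationary (\<eta> w)" for w
      using ch(4)[of w] by (simp add: stationary_def freeze_def \<eta>_def fun_eq_iff)
    have \<eta>_op: "diff_op (Suc q) \<eta> \<psi> = (\<lambda>z. - \<i> * diff_op (Suc q) \<gamma> \<psi> z)" for \<psi>
      by (simp add: diff_op_def \<eta>_def sum_distrib_left mult.assoc sum_negf)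
    have "symmetry_operator e A V (linear_in_time (diff_op (Suc q) \<delta>) (diff_op (Suc q) \<eta>))"
    proof (rule linear_symmetry_operator[OF L ch(1,3) \<eta> st\<eta>])
      fix z and \<psi> :: "'n stfun" assume \<psi>: "smooth \<psi>"
      show "spatial_op p v (diff_op (Suc q) \<delta> \<psi>) z - diff_op (Suc q) \<delta> (spatial_op p v \<psi>) z
          = \<i> * diff_op (Suc q) \<eta> \<psi> z"
        unfolding \<eta>_op ch(7)[OF \<psi>] by (simp add: mult.assoc[symmetric])
      have "smooth (diff_op (Suc q) \<gamma> \<psi>)" by (intro smooth_diff_op symmetric_smoothD(1)[OF ch(2)] \<psi>)
      note pull = spatial_op_time_factor[where p = p and v = v, OF smooth_const[of "- \<i>"] partial_x_const this]
      show "spatial_op p v (diff_op (Suc q) \<eta> \<psi>) z - diff_op (Suc q) \<eta> (spatial_op p v \<psi>) z = 0"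
        unfolding \<eta>_op pull using ch(8)[OF \<psi>, of z] True by simp
    qed
    moreover have "time_independent_op (diff_op (Suc q) \<delta>)" by (rule stationary_diff_op[OF ch(1,3)])
    moreover have "time_independent_op (diff_op (Suc q) \<eta>)" by (rule stationary_diff_op[OF \<eta> st\<eta>])
    moreover have "\<eta> w \<noteq> (\<lambda>z. 0)" using ch(6) by (auto simp: \<eta>_def fun_eq_iff)
    then have "\<not> op_eq (diff_op (Suc q) \<eta>) op_zero" by (rule diff_op_not_zero[OF \<eta> ch(5)])
    ultimately show ?thesis unfolding op_eq_def by blast
  qed
next
  assume ?special
  then obtain Q where Q: "symmetry_operator e A V Q" and special:
    "(\<exists>l K0. l \<noteq> 0 \<and> time_independent_op K0 \<and> \<not> op_eq K0 op_zero \<and> op_eq Q (exp_times l K0)) \<or>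
     (\<exists>K0 K1. time_independent_op K0 \<and> time_independent_op K1 \<and> \<not> op_eq K1 op_zero \<and>
        op_eq Q (linear_in_time K0 K1))"
    by blast
  obtain q b where b: "diff_operator q b Q" using Q unfolding symmetry_operator_def by blast
  have "time_dependent_op Q"
    using special exp_times_time_dependent[OF b] linear_in_time_time_dependent[OF b] by blast
  then show ?dependent using Q by blast
qed

end
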